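(* Assume that $E\to Y$ is a smooth fibre bundle, $X$ is a smooth manifold, $T$ is a topological space, and $f_t:X\to Y$ $(t\in T)$ is a continuous family of smooth maps. Set $E_t:=f_t^*E\to X$ for $t\in T$. Given a point $t_0\in T$ and a relatively compact domain $U\Subset X$, there are a neighbourhood $T_0\subset T$ of $t_0$ and a continuous family of smooth fibre bundle diffeomorphisms $\Theta_t:E_t|_U\to E_{t_0}|_U$ for $t\in T_0$.
   Context: A continuous family means a family depending continuously on the parameter $t$. Writing $\pi:E\to Y$ for the bundle projection, the pullback bundle is $f_t^*E=\{(x,e)\in X\times E: f_t(x)=\pi(e)\}$ with projection $(x,e)\mapsto x$ to $X$, and $E_t|_U$ denotes its restriction to $U$. A fibre bundle diffeomorphism $E_t|_U\to E_{t_0}|_U$ is a diffeomorphism mapping the fibre over each $x\in U$ onto the fibre over $x$. *)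

theory Defs
  imports "HOL-Analysis.Analysis"
begin

section \<open>Smooth functions of several real variables\<close>

text \<open>
  \<open>dderivs [h\<^sub>1, \<dots>, h\<^sub>k] f\<close> is the iterated directional derivative
  \<open>\<partial>\<^bsub>h\<^sub>k\<^esub> \<cdots> \<partial>\<^bsub>h\<^sub>1\<^esub> f\<close>.  It is only meaningful at points near which the derivatives exist.
\<close>

primrec dderivs :: "'m::real_normed_vector list \<Rightarrow> ('m \<Rightarrow> 'n::real_normed_vector) \<Rightarrow> 'm \<Rightarrow> 'n" where
  "dderivs [] f = f"
| "dderivs (h # hs) f = dderivs hs (\<lambda>u. frechet_derivative f (at u) h)"

text \<open>Class \<open>C\<^sup>\<infinity>\<close>; meant for open subsets \<open>S\<close> of a finite-dimensional space.\<close>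

definition smooth_on :: "'m::real_normed_vector set \<Rightarrow> ('m \<Rightarrow> 'n::real_normed_vector) \<Rightarrow> bool" where
  "smooth_on S f \<longleftrightarrow> (\<forall>hs. \<forall>u\<in>S. dderivs hs f differentiable (at u))"


section \<open>Smooth manifolds and smooth maps\<close>

text \<open>
  A manifold is a topological space together with a (not necessarily maximal) smooth atlas.
  A chart is a pair \<open>(D, \<phi>)\<close> of its domain and its coordinate map.  The model space is a
  finite-dimensional real inner product space, not a type of class \<open>euclidean_space\<close>: that class
  excludes dimension 0, which is needed, for instance, for the fibres of covering spaces.
\<close>

record ('a, 'm) manifold =
  mtop :: "'a topology"
  atlas :: "('a set \<times> ('a \<Rightarrow> 'm)) set"

abbreviation points :: "('a, 'm) manifold \<Rightarrow> 'a set" where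
  "points M \<equiv> topspace (mtop M)"

definition smooth_manifold :: "('a, 'm::real_inner) manifold \<Rightarrow> bool" where
  "smooth_manifold M \<longleftrightarrow>
     (\<exists>B::'m set. finite B \<and> span B = UNIV) \<and>
     Hausdorff_space (mtop M) \<and>
     second_countable (mtop M) \<and>
     (\<Union>(D, \<phi>)\<in>atlas M. D) = points M \<and>
     (\<forall>(D, \<phi>)\<in>atlas M. openin (mtop M) D \<and> open (\<phi> ` D) \<and>
          homeomorphic_map (subtopology (mtop M) D) (top_of_set (\<phi> ` D)) \<phi>) \<and>
     (\<forall>(D, \<phi>)\<in>atlas M. \<forall>(D', \<phi>')\<in>atlas M. smooth_on (\<phi> ` (D \<inter> D')) (\<phi>' \<circ> inv_into D \<phi>))"

definition smooth_map ::
    "('a, 'm::real_inner) manifold \<Rightarrow> ('b, 'n::real_inner) manifold \<Rightarrow> ('a \<Rightarrow> 'b) \<Rightarrow> bool" where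
  "smooth_map M N f \<longleftrightarrow>
     continuous_map (mtop M) (mtop N) f \<and>
     (\<forall>(D, \<phi>)\<in>atlas M. \<forall>(D', \<psi>)\<in>atlas N.
        smooth_on (\<phi> ` {p \<in> D. f p \<in> D'}) (\<psi> \<circ> f \<circ> inv_into D \<phi>))"

definition diffeomorphism ::
    "('a, 'm::real_inner) manifold \<Rightarrow> ('b, 'n::real_inner) manifold \<Rightarrow> ('a \<Rightarrow> 'b) \<Rightarrow> bool" where
  "diffeomorphism M N f \<longleftrightarrow>
     bij_betw f (points M) (points N) \<and> smooth_map M N f \<and>
     smooth_map N M (inv_into (points M) f)"

definition prod_manifold ::
    "('a, 'm) manifold \<Rightarrow> ('b, 'n) manifold \<Rightarrow> ('a \<times> 'b, 'm \<times> 'n) manifold" where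
  "prod_manifold M N =
     \<lparr>mtop = prod_topology (mtop M) (mtop N),
      atlas = {(D \<times> D', map_prod \<phi> \<psi>) | D \<phi> D' \<psi>. (D, \<phi>) \<in> atlas M \<and> (D', \<psi>) \<in> atlas N}\<rparr>"

text \<open>Restriction of the topology and of all coordinate maps to a subset.\<close>

definition restrict_to :: "('a, 'm) manifold \<Rightarrow> 'a set \<Rightarrow> ('a, 'm) manifold" where
  "restrict_to M S =
     \<lparr>mtop = subtopology (mtop M) S, atlas = (\<lambda>(D, \<phi>). (D \<inter> S, \<phi>)) ` atlas M\<rparr>"


section \<open>Smooth fibre bundles and pullbacks\<close>

definition local_trivialization ::
    "('e, 'k::real_inner) manifold \<Rightarrow> ('y, 'n::real_inner) manifold \<Rightarrow> ('f, 'l::real_inner) manifold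
      \<Rightarrow> ('e \<Rightarrow> 'y) \<Rightarrow> 'y set \<Rightarrow> ('e \<Rightarrow> 'y \<times> 'f) \<Rightarrow> bool" where
  "local_trivialization E Y F \<pi> V \<Phi> \<longleftrightarrow>
     openin (mtop Y) V \<and>
     diffeomorphism (restrict_to E {e \<in> points E. \<pi> e \<in> V}) (prod_manifold (restrict_to Y V) F) \<Phi> \<and>
     (\<forall>e\<in>points E. \<pi> e \<in> V \<longrightarrow> fst (\<Phi> e) = \<pi> e)"

definition smooth_fibre_bundle ::
    "('e, 'k::real_inner) manifold \<Rightarrow> ('y, 'n::real_inner) manifold \<Rightarrow> ('f, 'l::real_inner) manifold
      \<Rightarrow> ('e \<Rightarrow> 'y) \<Rightarrow> bool" where
  "smooth_fibre_bundle E Y F \<pi> \<longleftrightarrow>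
     smooth_manifold E \<and> smooth_manifold Y \<and> smooth_manifold F \<and> smooth_map E Y \<pi> \<and>
     (\<forall>y\<in>points Y. \<exists>V \<Phi>. y \<in> V \<and> local_trivialization E Y F \<pi> V \<Phi>)"

text \<open>
  The product space \<open>X \<times> E\<close> equipped with the maps
  \<open>(x, e) \<mapsto> (\<phi> x, \<psi> (pr\<^sub>2 (\<Phi> e)))\<close>, where \<open>\<phi>\<close> is a chart of \<open>X\<close>, \<open>\<Phi>\<close> a local trivialization
  of \<open>E \<rightarrow> Y\<close> and \<open>\<psi>\<close> a chart of the fibre.  They are not charts of \<open>X \<times> E\<close> (so this is not a
  manifold), but for every smooth \<open>g : X \<rightarrow> Y\<close> their restrictions to \<open>g\<^sup>*E\<close> are the usual charts
  of the pullback bundle; only the domains of these charts depend on \<open>g\<close>.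
\<close>

definition pullback_charts ::
    "('x, 'm::real_inner) manifold \<Rightarrow> ('e, 'k::real_inner) manifold \<Rightarrow> ('y, 'n::real_inner) manifold
      \<Rightarrow> ('f, 'l::real_inner) manifold \<Rightarrow> ('e \<Rightarrow> 'y) \<Rightarrow> ('x \<times> 'e, 'm \<times> 'l) manifold" where
  "pullback_charts X E Y F \<pi> =
     \<lparr>mtop = prod_topology (mtop X) (mtop E),
      atlas = {({(x, e). x \<in> D \<and> e \<in> points E \<and> \<pi> e \<in> V \<and> snd (\<Phi> e) \<in> D'},
                \<lambda>(x, e). (\<phi> x, \<psi> (snd (\<Phi> e)))) | D \<phi> V \<Phi> D' \<psi>.
               (D, \<phi>) \<in> atlas X \<and> local_trivialization E Y F \<pi> V \<Phi> \<and> (D', \<psi>) \<in> atlas F}\<rparr>"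

definition pullback_set :: "'x set \<Rightarrow> 'e set \<Rightarrow> ('e \<Rightarrow> 'y) \<Rightarrow> ('x \<Rightarrow> 'y) \<Rightarrow> ('x \<times> 'e) set" where
  "pullback_set A B \<pi> g = {(x, e). x \<in> A \<and> e \<in> B \<and> g x = \<pi> e}"

definition pullback_bundle ::
    "('x, 'm::real_inner) manifold \<Rightarrow> ('e, 'k::real_inner) manifold \<Rightarrow> ('y, 'n::real_inner) manifold
      \<Rightarrow> ('f, 'l::real_inner) manifold \<Rightarrow> ('e \<Rightarrow> 'y) \<Rightarrow> ('x \<Rightarrow> 'y) \<Rightarrow> ('x \<times> 'e, 'm \<times> 'l) manifold" where
  "pullback_bundle X E Y F \<pi> g =
     restrict_to (pullback_charts X E Y F \<pi>) (pullback_set (points X) (points E) \<pi> g)"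

definition bundle_restriction :: "('p, 'm) manifold \<Rightarrow> ('p \<Rightarrow> 'x) \<Rightarrow> 'x set \<Rightarrow> ('p, 'm) manifold" where
  "bundle_restriction P pr U = restrict_to P {p \<in> points P. pr p \<in> U}"

definition fibre_bundle_diffeomorphism ::
    "('p, 'm::real_inner) manifold \<Rightarrow> ('p \<Rightarrow> 'x) \<Rightarrow> ('q, 'n::real_inner) manifold \<Rightarrow> ('q \<Rightarrow> 'x)
      \<Rightarrow> 'x set \<Rightarrow> ('p \<Rightarrow> 'q) \<Rightarrow> bool" where
  "fibre_bundle_diffeomorphism P pr Q pr' U \<Theta> \<longleftrightarrow>
     diffeomorphism P Q \<Theta> \<and>
     (\<forall>x\<in>U. \<Theta> ` {p \<in> points P. pr p = x} = {q \<in> points Q. pr' q = x})"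


section \<open>Continuous families of smooth maps\<close>

text \<open>
  \<open>continuous_family T A S N f\<close>: the smooth maps \<open>f t : restrict_to A (S t) \<rightarrow> N\<close> depend
  continuously, in the \<open>C\<^sup>\<infinity>\<close> sense, on \<open>t\<close> in the topological space \<open>T\<close>; that is, \<open>f t p\<close> is
  jointly continuous in \<open>(t, p)\<close> and so are, in charts, all its derivatives with respect to \<open>p\<close>.
  For a fixed source manifold \<open>A\<close> one takes \<open>S t = points A\<close>, and this is continuity of
  \<open>t \<mapsto> f t\<close> in the compact-open \<open>C\<^sup>\<infinity>\<close> topology.  A variable source is needed for maps on the
  pullback bundles \<open>f\<^sub>t\<^sup>*E\<close>; there \<open>A\<close> is \<open>pullback_charts\<close>.
\<close>

definition continuous_family ::
    "'t topology \<Rightarrow> ('a, 'm::real_inner) manifold \<Rightarrow> ('t \<Rightarrow> 'a set) \<Rightarrow> ('b, 'n::real_inner) manifold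
      \<Rightarrow> ('t \<Rightarrow> 'a \<Rightarrow> 'b) \<Rightarrow> bool" where
  "continuous_family T A S N f \<longleftrightarrow>
     (\<forall>t\<in>topspace T. smooth_map (restrict_to A (S t)) N (f t)) \<and>
     continuous_map
       (subtopology (prod_topology T (mtop A)) {(t, p). t \<in> topspace T \<and> p \<in> S t})
       (mtop N) (\<lambda>(t, p). f t p) \<and>
     (\<forall>(D, \<phi>)\<in>atlas A. \<forall>(D', \<psi>)\<in>atlas N. \<forall>hs.
        continuous_map
          (subtopology (prod_topology T euclidean)
             {(t, \<phi> p) | t p. t \<in> topspace T \<and> p \<in> D \<inter> S t \<and> f t p \<in> D'})
          euclidean
          (\<lambda>(t, u). dderivs hs (\<psi> \<circ> f t \<circ> inv_into (D \<inter> S t) \<phi>) u))"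

lemma restrict_to_restrict_to: "restrict_to (restrict_to M S) S' = restrict_to M (S \<inter> S')"
  by (simp add: restrict_to_def subtopology_subtopology image_image case_prod_unfold Int_assoc)

text \<open>The restricted pullback bundle is again given by \<open>pullback_charts\<close> on a subset.\<close>

lemma bundle_restriction_pullback:
  assumes "U \<subseteq> points X"
  shows "bundle_restriction (pullback_bundle X E Y F \<pi> g) fst U =
         restrict_to (pullback_charts X E Y F \<pi>) (pullback_set U (points E) \<pi> g)"
proof -
  have "pullback_set (points X) (points E) \<pi> g
          \<inter> {p \<in> points (pullback_bundle X E Y F \<pi> g). fst p \<in> U} = pullback_set U (points E) \<pi> g"
    using assms
    by (auto simp: pullback_set_def pullback_bundle_def restrict_to_def pullback_charts_def)
  then show ?thesis
    by (simp add: bundle_restriction_def pullback_bundle_def restrict_to_restrict_to)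
qed

end

theory Submission
  imports Defs
begin

text \<open>
  Let \<open>g = f t\<^sub>0\<close>.  Near a point of \<open>X\<close>, choose a chart of \<open>X\<close> in which \<open>g\<close> maps a ball into a coordinate
  ball of \<open>Y\<close> over which \<open>E\<close> is trivial, and a bump function \<open>w\<close> with support in that ball.  For \<open>t\<close> near
  \<open>t\<^sub>0\<close>, the map \<open>f t\<close> can be replaced by \<open>f t + w (g - f t)\<close>, computed in the coordinates of \<open>Y\<close>: this agrees
  with \<open>g\<close> where \<open>w = 1\<close> and wherever \<open>f t\<close> already did.  The trivialization identifies the fibres of
  \<open>E\<close> over the old and the new image of a point, and this identification is the identity where \<open>w = 0\<close>,
  so it is a diffeomorphism of pullback bundles; in the charts given by the trivialization it is the
  identity map.  Finitely many such steps deform \<open>f t\<close> to a map that agrees with \<open>g\<close> on the compact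
  closure of \<open>U\<close>.  No connection on \<open>E\<close> is involved, so the fibre need not be compact.
\<close>

section \<open>Finite-dimensional inner product spaces\<close>

text \<open>The parameter space is an arbitrary topological space, so nothing can be integrated or
  differentiated in t. Dependence on t means joint continuity, on open subsets of T times a model
  space, of all derivatives in the remaining variable. The sources of the diffeomorphisms vary with
  t as well; the charts of all the pullback bundles are therefore treated as charts of one total
  space over T, with open images. Their transition maps contain \<open>f t\<close> read in
  coordinates of Y, and this is where the derivatives of \<open>f t\<close>, and not only its
  values, have to be continuous in t. The interpolation is done in a coordinate ball because
  convexity keeps the new values where E is trivial. Compactness enters twice: a tube argument over
  a closed ball of X gives one neighbourhood of \<open>t\<^sub>0\<close> for the whole ball, and
  finitely many balls cover the closure of U, so that the parameter space is shrunk only finitely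
  often.\<close>

definition finite_dim :: "'m::real_inner itself \<Rightarrow> bool" where
  "finite_dim _ \<longleftrightarrow> (\<exists>B::'m set. finite B \<and> span B = UNIV)"

text \<open>Gram-Schmidt turns a finite spanning set into an orthogonal one, and pairing with
  \<open>c\<close> isolates its coefficient. \<open>C\<close> may contain 0, whose term vanishes.
  The point of the formula is that the coefficients are bounded linear in \<open>v\<close>.\<close>

lemma finite_dim_expansion:
  assumes "finite_dim TYPE('m::real_inner)"
  obtains C :: "'m::real_inner set" where "finite C" "\<And>v. v = (\<Sum>c\<in>C. (v \<bullet> c / (c \<bullet> c)) *\<^sub>R c)"
proof -
  obtain B :: "'m set" where "finite B" "span B = UNIV"
    using assms unfolding finite_dim_def by blast
  then obtain C :: "'m set" where C: "finite C" "span C = UNIV" "pairwise orthogonal C"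
    using basis_orthogonal by metis
  have "v = (\<Sum>c\<in>C. (v \<bullet> c / (c \<bullet> c)) *\<^sub>R c)" for v
  proof -
    have "v \<in> range (\<lambda>a. \<Sum>c\<in>C. a c *\<^sub>R c)"
      using span_finite[OF C(1)] C(2) by simp
    then obtain a where v: "v = (\<Sum>c\<in>C. a c *\<^sub>R c)" ..
    have "v \<bullet> c = a c * (c \<bullet> c)" if "c \<in> C" for c
    proof -
      have "v \<bullet> c = (\<Sum>d\<in>C. if d = c then a c * (c \<bullet> c) else 0)"
        unfolding v inner_sum_left
        by (rule sum.cong) (use C(3) that in \<open>auto simp: pairwise_def orthogonal_def\<close>)
      then show ?thesis using C(1) that by simp
    qed
    then have "(v \<bullet> c / (c \<bullet> c)) *\<^sub>R c = a c *\<^sub>R c" if "c \<in> C" for c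
      using that by (cases "c = 0") auto
    then have "(\<Sum>c\<in>C. (v \<bullet> c / (c \<bullet> c)) *\<^sub>R c) = (\<Sum>c\<in>C. a c *\<^sub>R c)"
      by (rule sum.cong[OF refl])
    then show ?thesis using v by metis
  qed
  with C(1) that show thesis by blast
qed

lemma finite_dim_real: "finite_dim TYPE(real)"
  unfolding finite_dim_def by (rule exI[of _ "{1}"]) (auto simp: span_singleton image_def)

lemma finite_dim_prod:
  assumes "finite_dim TYPE('m::real_inner)" "finite_dim TYPE('n::real_inner)"
  shows "finite_dim TYPE('m::real_inner \<times> 'n::real_inner)"
proof -
  obtain B :: "'m set" where B: "finite B" "\<And>v. v = (\<Sum>c\<in>B. (v \<bullet> c / (c \<bullet> c)) *\<^sub>R c)"
    using finite_dim_expansion[OF assms(1)] by blast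
  obtain C :: "'n set" where C: "finite C" "\<And>v. v = (\<Sum>c\<in>C. (v \<bullet> c / (c \<bullet> c)) *\<^sub>R c)"
    using finite_dim_expansion[OF assms(2)] by blast
  let ?S = "(\<lambda>b. (b, 0)) ` B \<union> (\<lambda>c. (0, c)) ` C"
  have "(v, w) \<in> span ?S" for v w
  proof -
    have "(v, w) = (\<Sum>b\<in>B. (v \<bullet> b / (b \<bullet> b)) *\<^sub>R (b, 0)) + (\<Sum>c\<in>C. (w \<bullet> c / (c \<bullet> c)) *\<^sub>R (0, c))"
      by (rule prod_eqI) (use B(2)[of v] C(2)[of w] in \<open>simp_all add: fst_sum snd_sum\<close>)
    also have "\<dots> \<in> span ?S"
      by (intro span_add span_sum span_scale) (auto intro: span_base)
    finally show ?thesis .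
  qed
  then have "span ?S = UNIV" by auto
  then show ?thesis unfolding finite_dim_def by (intro exI[of _ ?S]) (simp add: B(1) C(1))
qed

text \<open>A linear image of a cube, built up one direction at a time as a sum of compact sets;
  \<open>C\<close> need not be linearly independent.\<close>

lemma compact_scaled_sums:
  fixes C :: "'m::real_normed_vector set"
  assumes "finite C"
  shows "compact {\<Sum>c\<in>C. a c *\<^sub>R c | a. \<forall>c\<in>C. \<bar>a c\<bar> \<le> (M::real)}" (is "compact (?S C)")
  using assms
proof (induction C)
  case (insert d C)
  let ?D = "(\<lambda>r. r *\<^sub>R d) ` {-M..M}"
  have D: "compact ?D"
    by (intro compact_continuous_image continuous_intros) auto
  have eq: "?S (insert d C) = {x + y |x y. x \<in> ?D \<and> y \<in> ?S C}"
  proof safe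
    fix a assume a: "\<forall>c\<in>insert d C. \<bar>a c\<bar> \<le> M"
    then have "a d *\<^sub>R d \<in> ?D" by (intro imageI) (auto simp: abs_le_iff)
    moreover have "(\<Sum>c\<in>C. a c *\<^sub>R c) \<in> ?S C" using a by auto
    ultimately show "\<exists>x y. (\<Sum>c\<in>insert d C. a c *\<^sub>R c) = x + y \<and> x \<in> ?D \<and> y \<in> ?S C"
      using insert.hyps by (metis (no_types, lifting) sum.insert)
  next
    fix r a assume r: "r \<in> {-M..M}" and a: "\<forall>c\<in>C. \<bar>a c\<bar> \<le> M"
    have "(\<Sum>c\<in>C. a c *\<^sub>R c) = (\<Sum>c\<in>C. (a(d := r)) c *\<^sub>R c)"
      using insert.hyps by (intro sum.cong) auto
    then have "r *\<^sub>R d + (\<Sum>c\<in>C. a c *\<^sub>R c) = (\<Sum>c\<in>insert d C. (a(d := r)) c *\<^sub>R c)"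
      using insert.hyps by simp
    moreover have "\<forall>c\<in>insert d C. \<bar>(a(d := r)) c\<bar> \<le> M" using r a by (auto simp: abs_le_iff)
    ultimately show "\<exists>a'. r *\<^sub>R d + (\<Sum>c\<in>C. a c *\<^sub>R c) = (\<Sum>c\<in>insert d C. a' c *\<^sub>R c) \<and>
        (\<forall>c\<in>insert d C. \<bar>a' c\<bar> \<le> M)" by blast
  qed
  show ?case unfolding eq by (rule compact_sums[OF D insert.IH])
next
  case empty
  have "?S {} = {0}" by simp
  then show ?case by (simp only: compact_sing)
qed

text \<open>Cauchy-Schwarz bounds the coordinates on a ball, so the ball is a closed subset of a
  compact set of the preceding kind. It supplies the compact sets in charts.\<close>

lemma compact_cball_finite_dim:
  assumes "finite_dim TYPE('m::real_inner)"
  shows "compact (cball (x::'m::real_inner) r)"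
proof -
  obtain C :: "'m set" where C: "finite C" "\<And>v. v = (\<Sum>c\<in>C. (v \<bullet> c / (c \<bullet> c)) *\<^sub>R c)"
    using finite_dim_expansion[OF assms] by blast
  define R where "R = norm x + \<bar>r\<bar>"
  \<comment> \<open>The sum over \<open>C\<close> serves as a common bound for the finitely many
    coordinate bounds, and makes sense for empty \<open>C\<close> too.\<close>
  define M where "M = (\<Sum>c\<in>C. R * norm c / (c \<bullet> c))"
  have "cball x r \<subseteq> {\<Sum>c\<in>C. a c *\<^sub>R c | a. \<forall>c\<in>C. \<bar>a c\<bar> \<le> M}"
  proof
    fix v assume "v \<in> cball x r"
    then have "norm v \<le> R"
      using norm_triangle_ineq2[of v x] by (auto simp: R_def dist_norm norm_minus_commute)
    then have "\<bar>v \<bullet> c / (c \<bullet> c)\<bar> \<le> R * norm c / (c \<bullet> c)" for c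
      using Cauchy_Schwarz_ineq2[of v c] mult_right_mono[of "norm v" R "norm c"]
      by (auto simp: abs_divide intro!: divide_right_mono)
    moreover have "R * norm c / (c \<bullet> c) \<le> M" if "c \<in> C" for c
      unfolding M_def by (rule member_le_sum) (use that C(1) in \<open>auto simp: R_def\<close>)
    ultimately have "\<forall>c\<in>C. \<bar>v \<bullet> c / (c \<bullet> c)\<bar> \<le> M" by (meson order_trans)
    then show "v \<in> {\<Sum>c\<in>C. a c *\<^sub>R c | a. \<forall>c\<in>C. \<bar>a c\<bar> \<le> M}"
      using C(2)[of v] by (intro CollectI exI[of _ "\<lambda>c. v \<bullet> c / (c \<bullet> c)"] conjI)
  qed
  then have eq: "cball x r \<inter> {\<Sum>c\<in>C. a c *\<^sub>R c | a. \<forall>c\<in>C. \<bar>a c\<bar> \<le> M} = cball x r"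
    by (rule Int_absorb2)
  show ?thesis
    using closed_Int_compact[OF closed_cball compact_scaled_sums[OF C(1), of M], of x r] unfolding eq .
qed

section \<open>Smooth families of functions\<close>

definition cont_family ::
    "'t topology \<Rightarrow> ('t \<times> 'm::topological_space) set \<Rightarrow> ('t \<Rightarrow> 'm \<Rightarrow> 'n::topological_space) \<Rightarrow> bool" where
  "cont_family T W g \<longleftrightarrow>
     continuous_map (subtopology (prod_topology T euclidean) W) euclidean (\<lambda>(t, u). g t u)"

text \<open>
  Recursion on the order of differentiability instead of on the list of directions: the chain and
  product rules below are inductions on \<open>k\<close>.
\<close>

primrec ck_family ::
    "nat \<Rightarrow> 't topology \<Rightarrow> ('t \<times> 'm::real_normed_vector) set \<Rightarrow> ('t \<Rightarrow> 'm \<Rightarrow> 'n::real_normed_vector) \<Rightarrow> bool" where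
  "ck_family 0 T W g \<longleftrightarrow> cont_family T W g"
| "ck_family (Suc k) T W g \<longleftrightarrow> cont_family T W g \<and> (\<forall>(t, u)\<in>W. g t differentiable at u) \<and>
     (\<forall>h. ck_family k T W (\<lambda>t u. frechet_derivative (g t) (at u) h))"

text \<open>The derivative clause of \<open>continuous_family\<close> with two additions: the
  derivatives exist (otherwise \<open>frechet_derivative\<close> is an arbitrary value), and
  \<open>W\<close> is open in T times the model space, so that its slices are open and each point
  can be examined in a smaller open set.\<close>

definition smooth_family ::
    "'t topology \<Rightarrow> ('t \<times> 'm::real_normed_vector) set \<Rightarrow> ('t \<Rightarrow> 'm \<Rightarrow> 'n::real_normed_vector) \<Rightarrow> bool" where
  "smooth_family T W g \<longleftrightarrow> openin (prod_topology T euclidean) W \<and>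
     (\<forall>hs. (\<forall>(t, u)\<in>W. dderivs hs (g t) differentiable at u) \<and>
           cont_family T W (\<lambda>t. dderivs hs (g t)))"

lemma ck_family_cont: "ck_family k T W g \<Longrightarrow> cont_family T W g"
  by (cases k) auto

lemma ck_family_SucD: "ck_family (Suc k) T W g \<Longrightarrow> ck_family k T W g"
proof (induction k arbitrary: g)
  case (Suc k)
  then have "ck_family k T W (\<lambda>t u. frechet_derivative (g t) (at u) h)" for h
    using Suc.IH Suc.prems by simp
  with Suc.prems show ?case by simp
qed simp

lemma ck_family_Suc_derivative:
  assumes "ck_family (Suc k) T W g"
  shows "(t, u) \<in> W \<Longrightarrow> (g t has_derivative frechet_derivative (g t) (at u)) (at u)"
    and "ck_family k T W (\<lambda>t u. frechet_derivative (g t) (at u) h)"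
  using assms by (auto simp flip: frechet_derivative_works)

text \<open>Both notions differentiate in the first direction and then recurse on the derivative, so
  \<open>g\<close> is generalised in the two inductions. For the empty list, order 1 is used, since
  \<open>smooth_family\<close> asks for differentiability and not only for continuity.\<close>

lemma smooth_family_iff_ck:
  "smooth_family T W g \<longleftrightarrow> openin (prod_topology T euclidean) W \<and> (\<forall>k. ck_family k T W g)"
proof -
  have "ck_family k T W g"
    if "\<forall>hs. (\<forall>(t, u)\<in>W. dderivs hs (g t) differentiable at u) \<and> cont_family T W (\<lambda>t. dderivs hs (g t))"
    for k
    using that
  proof (induction k arbitrary: g)
    case 0
    from 0[THEN spec, of "[]"] show ?case by simp
  next
    case (Suc k)
    have "ck_family k T W (\<lambda>t u. frechet_derivative (g t) (at u) h)" for h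
      by (rule Suc.IH) (use Suc.prems[THEN spec, of "h # _"] in simp)
    with Suc.prems[THEN spec, of "[]"] show ?case by simp
  qed
  moreover have "(\<forall>(t, u)\<in>W. dderivs hs (g t) differentiable at u) \<and> cont_family T W (\<lambda>t. dderivs hs (g t))"
    if "\<forall>k. ck_family k T W g" for hs
    using that
  proof (induction hs arbitrary: g)
    case Nil
    from Nil[THEN spec, of 1] show ?case by simp
  next
    case (Cons h hs)
    have "\<forall>k. ck_family k T W (\<lambda>t u. frechet_derivative (g t) (at u) h)"
      using Cons.prems[THEN spec, of "Suc _"] by simp
    from Cons.IH[OF this] show ?case by simp
  qed
  ultimately show ?thesis unfolding smooth_family_def by blast
qed

lemma smooth_family_openin: "smooth_family T W g \<Longrightarrow> openin (prod_topology T euclidean) W"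
  by (simp add: smooth_family_def)

lemma smooth_family_cont: "smooth_family T W g \<Longrightarrow> cont_family T W g"
  unfolding smooth_family_def by (auto dest!: spec[of _ "[]"])

section \<open>Open domains: invariance under equality, and the local character of the class of
  order k\<close>

lemma open_slice:
  assumes "openin (prod_topology T euclidean) W"
  shows "open {u. (t, u) \<in> W}"
proof (cases "t \<in> topspace T")
  case True
  then have "continuous_map euclidean (prod_topology T euclidean) (\<lambda>u. (t, u))"
    by (simp add: continuous_map_pairedI)
  from openin_continuous_map_preimage[OF this assms] show ?thesis by simp
next
  case False
  then have "{u. (t, u) \<in> W} = {}" using openin_subset[OF assms] by auto
  then show ?thesis by simp
qed

lemma has_derivative_cong_open:
  assumes "open S" "u \<in> S" "\<And>v. v \<in> S \<Longrightarrow> f v = g v"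
  shows "(f has_derivative d) (at u) \<longleftrightarrow> (g has_derivative d) (at u)"
  using has_derivative_transform_within_open[OF _ assms(1,2), of f d UNIV g]
    has_derivative_transform_within_open[OF _ assms(1,2), of g d UNIV f] assms(3)
  by auto

lemma cont_family_iff:
  assumes "openin (prod_topology T euclidean) W"
  shows "cont_family T W g \<longleftrightarrow>
    (\<forall>B. open B \<longrightarrow> openin (prod_topology T euclidean) {(t, u). (t, u) \<in> W \<and> g t u \<in> B})"
proof -
  have "{x \<in> topspace (subtopology (prod_topology T euclidean) W). (case x of (t, u) \<Rightarrow> g t u) \<in> B}
      = {(t, u). (t, u) \<in> W \<and> g t u \<in> B}" for B
    using openin_subset[OF assms] by auto
  then show ?thesis
    unfolding cont_family_def continuous_map_def
    using assms by (auto simp: openin_open_subtopology)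
qed

lemma cont_family_mono:
  "cont_family T W g \<Longrightarrow> W' \<subseteq> W \<Longrightarrow> cont_family T W' g"
  unfolding cont_family_def by (rule continuous_map_from_subtopology_mono)

lemma cont_family_cong:
  assumes "\<And>t u. (t, u) \<in> W \<Longrightarrow> g t u = g' t u"
  shows "cont_family T W g \<longleftrightarrow> cont_family T W g'"
  unfolding cont_family_def using assms by (auto intro: continuous_map_eq)

lemma cont_family_local:
  assumes "openin (prod_topology T euclidean) W"
    and loc: "\<And>z. z \<in> W \<Longrightarrow> \<exists>W'. openin (prod_topology T euclidean) W' \<and> z \<in> W' \<and> cont_family T (W' \<inter> W) g"
  shows "cont_family T W g"
  unfolding cont_family_iff[OF assms(1)]
proof (intro allI impI)
  fix B :: "'c set" assume "open B"
  show "openin (prod_topology T euclidean) {(t, u). (t, u) \<in> W \<and> g t u \<in> B}"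
  proof (subst openin_subopen, safe)
    fix t u assume tu: "(t, u) \<in> W" "g t u \<in> B"
    then obtain W' where W': "openin (prod_topology T euclidean) W'" "(t, u) \<in> W'" "cont_family T (W' \<inter> W) g"
      using loc by blast
    have o: "openin (prod_topology T euclidean) (W' \<inter> W)" using W' assms by blast
    show "\<exists>S. openin (prod_topology T euclidean) S \<and> (t, u) \<in> S \<and> S \<subseteq> {(t, u). (t, u) \<in> W \<and> g t u \<in> B}"
      using W'(3)[unfolded cont_family_iff[OF o], rule_format, OF \<open>open B\<close>] tu W'(2)
      by (intro exI[of _ "{(t, u). (t, u) \<in> W' \<inter> W \<and> g t u \<in> B}"]) auto
  qed
qed

lemma ck_family_mono: "ck_family k T W g \<Longrightarrow> W' \<subseteq> W \<Longrightarrow> ck_family k T W' g"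
  by (induction k arbitrary: g) (auto intro: cont_family_mono)

text \<open>Since the slices of \<open>W\<close> are open, the two families have the same
  derivatives at each point. \<open>frechet_derivative\<close> is a choice that depends only on
  \<open>has_derivative\<close>, so its values agree too and the induction applies to them.\<close>

lemma ck_family_cong:
  assumes "openin (prod_topology T euclidean) W"
    and "\<And>t u. (t, u) \<in> W \<Longrightarrow> g t u = g' t u" and "ck_family k T W g"
  shows "ck_family k T W g'"
  using assms(2,3)
proof (induction k arbitrary: g g')
  case 0
  then show ?case using cont_family_cong[of W g g'] by simp
next
  case (Suc k)
  have der: "(g t has_derivative d) (at u) \<longleftrightarrow> (g' t has_derivative d) (at u)" if "(t, u) \<in> W" for t u d
    using has_derivative_cong_open[OF open_slice[OF assms(1)], of u t "g t" "g' t"] that Suc.prems(1) by simp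
  then have "frechet_derivative (g t) (at u) h = frechet_derivative (g' t) (at u) h" if "(t, u) \<in> W" for t u h
    unfolding frechet_derivative_def using that by simp
  then have "ck_family k T W (\<lambda>t u. frechet_derivative (g' t) (at u) h)" for h
    using Suc.IH[of "\<lambda>t u. frechet_derivative (g t) (at u) h" "\<lambda>t u. frechet_derivative (g' t) (at u) h"]
      Suc.prems(2) by simp
  moreover have "\<forall>(t, u)\<in>W. g' t differentiable at u"
    using ck_family_Suc_derivative(1)[OF Suc.prems(2)] der by (auto simp: differentiable_def)
  ultimately show ?case using Suc.prems cont_family_cong[of W g g'] by simp
qed

lemma ck_family_local:
  assumes "openin (prod_topology T euclidean) W"
    and "\<And>z. z \<in> W \<Longrightarrow> \<exists>W'. openin (prod_topology T euclidean) W' \<and> z \<in> W' \<and> ck_family k T (W' \<inter> W) g"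
  shows "ck_family k T W g"
  using assms(2)
proof (induction k arbitrary: g)
  case 0
  show ?case
    unfolding ck_family.simps by (rule cont_family_local[OF assms(1)]) (use 0 in simp)
next
  case (Suc k)
  have "cont_family T W g"
    by (rule cont_family_local[OF assms(1)]) (use Suc.prems in fastforce)
  moreover have "\<forall>(t, u)\<in>W. g t differentiable at u"
    using Suc.prems by fastforce
  moreover have "ck_family k T W (\<lambda>t u. frechet_derivative (g t) (at u) h)" for h
    by (rule Suc.IH) (use Suc.prems in fastforce)
  ultimately show ?case by simp
qed

lemma smooth_family_mono:
  "smooth_family T W g \<Longrightarrow> openin (prod_topology T euclidean) W' \<Longrightarrow> W' \<subseteq> W \<Longrightarrow> smooth_family T W' g"
  unfolding smooth_family_iff_ck using ck_family_mono by blast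

lemma smooth_family_cong:
  assumes "smooth_family T W g" and "\<And>t u. (t, u) \<in> W \<Longrightarrow> g t u = g' t u"
  shows "smooth_family T W g'"
  using assms ck_family_cong unfolding smooth_family_iff_ck by metis

lemma smooth_family_local:
  assumes "openin (prod_topology T euclidean) W"
    and "\<And>z. z \<in> W \<Longrightarrow> \<exists>W'. z \<in> W' \<and> smooth_family T W' g"
  shows "smooth_family T W g"
  unfolding smooth_family_iff_ck
proof (intro conjI allI assms(1))
  fix k show "ck_family k T W g"
  proof (rule ck_family_local[OF assms(1)])
    fix z assume "z \<in> W"
    then obtain W' where "z \<in> W'" "smooth_family T W' g" using assms(2) by blast
    then show "\<exists>W'. openin (prod_topology T euclidean) W' \<and> z \<in> W' \<and> ck_family k T (W' \<inter> W) g"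
      unfolding smooth_family_iff_ck using ck_family_mono[of k T W' g "W' \<inter> W"] by blast
  qed
qed

section \<open>Closure of families under linear operations, products and composition\<close>

lemma cont_family_compose2:
  assumes "cont_family T W f" "cont_family T W g" "continuous_on UNIV (\<lambda>(x, y). p x y)"
  shows "cont_family T W (\<lambda>t u. p (f t u) (g t u))"
proof -
  have "continuous_map (prod_topology euclidean euclidean) euclidean (\<lambda>(x, y). p x y)"
    using assms(3) by (simp add: euclidean_product_topology)
  moreover have "continuous_map (subtopology (prod_topology T euclidean) W) (prod_topology euclidean euclidean)
      (\<lambda>z. ((\<lambda>(t, u). f t u) z, (\<lambda>(t, u). g t u) z))"
    using assms(1,2) unfolding cont_family_def by (rule continuous_map_pairedI)
  ultimately show ?thesis
    unfolding cont_family_def using continuous_map_compose[of _ _ _ _ "\<lambda>(x, y). p x y"]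
    by (fastforce simp: o_def case_prod_unfold)
qed

lemma cont_family_const: "cont_family T W (\<lambda>t u. c)"
  unfolding cont_family_def by (simp add: case_prod_unfold)

lemma cont_family_compose1:
  assumes "cont_family T W f" "continuous_on UNIV p"
  shows "cont_family T W (\<lambda>t u. p (f t u))"
proof -
  have "continuous_map euclidean euclidean p" using assms(2) by simp
  from continuous_map_compose[OF assms(1)[unfolded cont_family_def] this] show ?thesis
    unfolding cont_family_def by (simp add: o_def case_prod_unfold)
qed

lemma ck_family_const: "ck_family k T W (\<lambda>t u. c)"
  by (induction k arbitrary: c) (auto simp: cont_family_const)

text \<open>Uniqueness of the derivative replaces \<open>frechet_derivative\<close> by an explicit
  \<open>d\<close>, so that the rules below need only the textbook formula of a derivative and its
  regularity.\<close>

lemma ck_family_has_derivativeI: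
  assumes "openin (prod_topology T euclidean) W" "cont_family T W g"
    and "\<And>t u. (t, u) \<in> W \<Longrightarrow> (g t has_derivative d t u) (at u)"
    and "\<And>h. ck_family k T W (\<lambda>t u. d t u h)"
  shows "ck_family (Suc k) T W g"
proof -
  have "frechet_derivative (g t) (at u) = d t u" if "(t, u) \<in> W" for t u
    using frechet_derivative_at[OF assms(3)[OF that]] by simp
  then have "ck_family k T W (\<lambda>t u. frechet_derivative (g t) (at u) h)" for h
    using ck_family_cong[OF assms(1) _ assms(4)[of h]] by simp
  then show ?thesis using assms(2,3) by (auto simp: differentiable_def)
qed

lemma ck_family_bounded_linear:
  assumes "openin (prod_topology T euclidean) W" "bounded_linear p" "ck_family k T W g"
  shows "ck_family k T W (\<lambda>t u. p (g t u))"
  using assms(3)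
proof (induction k arbitrary: g)
  case 0
  then show ?case
    by (simp add: cont_family_compose1 linear_continuous_on[OF assms(2)])
next
  case (Suc k)
  note D = ck_family_Suc_derivative[OF Suc.prems]
  show ?case
  proof (rule ck_family_has_derivativeI[OF assms(1)])
    show "cont_family T W (\<lambda>t u. p (g t u))"
      using Suc.prems by (simp add: cont_family_compose1 linear_continuous_on[OF assms(2)])
    show "((\<lambda>u. p (g t u)) has_derivative (\<lambda>h. p (frechet_derivative (g t) (at u) h))) (at u)"
      if "(t, u) \<in> W" for t u
      using bounded_linear.has_derivative[OF assms(2) D(1)[OF that]] .
  qed (use Suc.IH D(2) in blast)
qed

lemma ck_family_add:
  assumes "openin (prod_topology T euclidean) W" "ck_family k T W f" "ck_family k T W g"
  shows "ck_family k T W (\<lambda>t u. f t u + g t u)"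
  using assms(2,3)
proof (induction k arbitrary: f g)
  case 0
  then show ?case
    by (simp add: cont_family_compose2 case_prod_unfold continuous_on_add continuous_on_fst continuous_on_snd)
next
  case (Suc k)
  note D = ck_family_Suc_derivative[OF Suc.prems(1)]
  note D' = ck_family_Suc_derivative[OF Suc.prems(2)]
  show ?case
  proof (rule ck_family_has_derivativeI[OF assms(1)])
    show "cont_family T W (\<lambda>t u. f t u + g t u)"
      using Suc.prems
      by (simp add: cont_family_compose2 case_prod_unfold continuous_on_add continuous_on_fst continuous_on_snd)
  qed (rule has_derivative_add[OF D(1) D'(1)] Suc.IH[OF D(2) D'(2)]; assumption?)+
qed

lemma ck_family_sum:
  assumes "openin (prod_topology T euclidean) W" "\<And>i. i \<in> I \<Longrightarrow> ck_family k T W (f i)"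
  shows "ck_family k T W (\<lambda>t u. \<Sum>i\<in>I. f i t u)"
  using assms(2) by (induction I rule: infinite_finite_induct)
    (auto simp: ck_family_const intro!: ck_family_add[OF assms(1)])

text \<open>The product rule leaves one factor undifferentiated in each summand. That factor is of
  order k by \<open>ck_family_SucD\<close>, so the induction hypothesis covers both
  summands.\<close>

lemma ck_family_bilinear:
  assumes "openin (prod_topology T euclidean) W" "bounded_bilinear p" "ck_family k T W f" "ck_family k T W g"
  shows "ck_family k T W (\<lambda>t u. p (f t u) (g t u))"
  using assms(3,4)
proof (induction k arbitrary: f g)
  case 0
  then show ?case
    by (simp add: cont_family_compose2 case_prod_unfold bounded_bilinear.continuous_on[OF assms(2)] continuous_on_fst continuous_on_snd)
next
  case (Suc k)
  note D = ck_family_Suc_derivative[OF Suc.prems(1)]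
  note D' = ck_family_Suc_derivative[OF Suc.prems(2)]
  show ?case
  proof (rule ck_family_has_derivativeI[OF assms(1)])
    show "cont_family T W (\<lambda>t u. p (f t u) (g t u))"
      using Suc.prems
      by (simp add: cont_family_compose2 case_prod_unfold bounded_bilinear.continuous_on[OF assms(2)] continuous_on_fst continuous_on_snd)
    show "((\<lambda>u. p (f t u) (g t u)) has_derivative
       (\<lambda>h. p (f t u) (frechet_derivative (g t) (at u) h) + p (frechet_derivative (f t) (at u) h) (g t u))) (at u)"
      if "(t, u) \<in> W" for t u
      using bounded_bilinear.FDERIV[OF assms(2) D(1)[OF that] D'(1)[OF that]] .
    show "ck_family k T W (\<lambda>t u. p (f t u) (frechet_derivative (g t) (at u) h) + p (frechet_derivative (f t) (at u) h) (g t u))" for h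
      using Suc.prems[THEN ck_family_SucD] D(2) D'(2) by (intro ck_family_add[OF assms(1)] Suc.IH)
  qed
qed

lemma ck_family_ident: "openin (prod_topology T euclidean) W \<Longrightarrow> ck_family k T W (\<lambda>t u. u)"
proof (cases k)
  case 0
  then show ?thesis 
    by (simp add: cont_family_def case_prod_unfold continuous_map_subtopology_snd)
next
  case (Suc k)
  assume W: "openin (prod_topology T euclidean) W"
  show ?thesis unfolding Suc
    by (rule ck_family_has_derivativeI[OF W, of _ "\<lambda>t u h. h"])
      (auto simp: cont_family_def case_prod_unfold continuous_map_subtopology_snd ck_family_const)
qed

text \<open>A pair is the sum of its images under the linear embeddings of the two factors.\<close>

lemma ck_family_Pair:
  assumes "openin (prod_topology T euclidean) W" "ck_family k T W f" "ck_family k T W g"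
  shows "ck_family k T W (\<lambda>t u. (f t u, g t u))"
proof -
  have "ck_family k T W (\<lambda>t u. (f t u, 0) + (0, g t u))"
    by (intro ck_family_add ck_family_bounded_linear[of _ _ "\<lambda>x. (x, 0)"] ck_family_bounded_linear[of _ _ "\<lambda>x. (0, x)"]
      assms bounded_linear_Pair bounded_linear_ident bounded_linear_zero)
  then show ?thesis by simp
qed

lemma openin_compose_family:
  assumes "openin (prod_topology T euclidean) W" "openin (prod_topology T euclidean) W'" "cont_family T W g"
  shows "openin (prod_topology T euclidean) {(t, u). (t, u) \<in> W \<and> (t, g t u) \<in> W'}"
proof -
  have "continuous_map (subtopology (prod_topology T euclidean) W) (prod_topology T euclidean)
      (\<lambda>z. (fst z, (\<lambda>(t, u). g t u) z))"
    using assms(3) unfolding cont_family_def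
    by (intro continuous_map_pairedI) (auto simp: continuous_map_subtopology_fst)
  from openin_continuous_map_preimage[OF this assms(2)]
  have "openin (prod_topology T euclidean) {x \<in> topspace (subtopology (prod_topology T euclidean) W). (fst x, (\<lambda>(t, u). g t u) x) \<in> W'}"
    using assms(1) openin_trans_full by blast
  moreover have "{x \<in> topspace (subtopology (prod_topology T euclidean) W). (fst x, (\<lambda>(t, u). g t u) x) \<in> W'}
     = {(t, u). (t, u) \<in> W \<and> (t, g t u) \<in> W'}"
    using openin_subset[OF assms(1)] by auto
  ultimately show ?thesis by simp
qed

lemma cont_family_compose:
  assumes "cont_family T W g" "cont_family T W' f" "\<And>t u. (t, u) \<in> W \<Longrightarrow> (t, g t u) \<in> W'"
  shows "cont_family T W (\<lambda>t u. f t (g t u))"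
proof -
  have "continuous_map (subtopology (prod_topology T euclidean) W) (subtopology (prod_topology T euclidean) W')
      (\<lambda>z. (fst z, (\<lambda>(t, u). g t u) z))"
    using assms(1,3) unfolding cont_family_def
    by (auto simp: continuous_map_in_subtopology continuous_map_paired continuous_map_subtopology_fst)
  from continuous_map_compose[OF this assms(2)[unfolded cont_family_def]]
  show ?thesis unfolding cont_family_def by (simp add: o_def case_prod_unfold)
qed

text \<open>In the chain rule the direction \<open>frechet_derivative (g t) (at u) h\<close> itself
  depends on \<open>u\<close>, whereas \<open>ck_family\<close> speaks of fixed directions.
  Expanding it in a finite spanning set \<open>C\<close> (this is \<open>d\<close>) turns the
  derivative into a finite sum of products: a coefficient of order k, times a derivative of
  \<open>f t\<close> in a fixed direction composed with \<open>g t\<close>, to which the induction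
  hypothesis applies. Finite dimension is required of the intermediate space.\<close>

lemma ck_family_compose:
  fixes g :: "'t \<Rightarrow> 'm::real_normed_vector \<Rightarrow> 'n::real_inner"
    and f :: "'t \<Rightarrow> 'n \<Rightarrow> 'p::real_normed_vector"
  assumes fin: "finite_dim TYPE('n)" and W: "openin (prod_topology T euclidean) W"
    and "ck_family k T W g" "ck_family k T W' f" and WW: "\<And>t u. (t, u) \<in> W \<Longrightarrow> (t, g t u) \<in> W'"
  shows "ck_family k T W (\<lambda>t u. f t (g t u))"
  using assms(3,4)
proof (induction k arbitrary: f)
  case 0
  then show ?case using WW cont_family_compose[of T W g W' f] by simp
next
  case (Suc k)
  obtain C :: "'n set" where C: "finite C" "\<And>v. v = (\<Sum>c\<in>C. (v \<bullet> c / (c \<bullet> c)) *\<^sub>R c)"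
    using finite_dim_expansion[OF fin] by blast
  note G = ck_family_Suc_derivative[OF Suc.prems(1)]
  note F = ck_family_Suc_derivative[OF Suc.prems(2)]
  define d where "d t u h = (\<Sum>c\<in>C. (frechet_derivative (g t) (at u) h \<bullet> c / (c \<bullet> c)) *\<^sub>R
      frechet_derivative (f t) (at (g t u)) c)" for t u h
  show ?case
  proof (rule ck_family_has_derivativeI[OF W])
    show "cont_family T W (\<lambda>t u. f t (g t u))"
      using Suc.prems[THEN ck_family_cont] WW by (rule cont_family_compose)
    show "((\<lambda>u. f t (g t u)) has_derivative d t u) (at u)" if tu: "(t, u) \<in> W" for t u
    proof -
      note 1 = F(1)[OF WW[OF tu]]
      have "d t u = (\<lambda>h. frechet_derivative (f t) (at (g t u)) (frechet_derivative (g t) (at u) h))"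
        by (rule ext, subst (2) C(2)) (simp add: d_def linear_sum[OF has_derivative_linear[OF 1]] 
           linear_scale[OF has_derivative_linear[OF 1]])
      then show ?thesis
        using diff_chain_at[OF G(1)[OF tu] 1] by (simp add: o_def)
    qed
    fix h
    have "ck_family k T W (\<lambda>t u. frechet_derivative (f t) (at (g t u)) c)" for c
      using Suc.IH[OF ck_family_SucD[OF Suc.prems(1)] F(2)] .
    moreover have "ck_family k T W (\<lambda>t u. frechet_derivative (g t) (at u) h \<bullet> c / (c \<bullet> c))" for c
    proof -
      have "bounded_linear (\<lambda>v. v \<bullet> c / (c \<bullet> c))"
        by (rule bounded_linear_compose[OF bounded_linear_divide bounded_linear_inner_left])
      from ck_family_bounded_linear[OF W this G(2)] show ?thesis .
    qed
    ultimately show "ck_family k T W (\<lambda>t u. d t u h)"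
      unfolding d_def
      by (intro ck_family_sum[OF W] ck_family_bilinear[OF W bounded_bilinear_scaleR])
  qed
qed

lemma smooth_family_compose:
  fixes g :: "'t \<Rightarrow> 'm::real_normed_vector \<Rightarrow> 'n::real_inner"
  assumes "finite_dim TYPE('n)" "smooth_family T W g" "smooth_family T W' f"
  shows "smooth_family T {(t, u). (t, u) \<in> W \<and> (t, g t u) \<in> W'} (\<lambda>t u. f t (g t u))"
proof -
  let ?W = "{(t, u). (t, u) \<in> W \<and> (t, g t u) \<in> W'}"
  have W: "openin (prod_topology T euclidean) ?W"
    using assms(2,3) by (intro openin_compose_family smooth_family_cont smooth_family_openin)
  have "ck_family k T ?W (\<lambda>t u. f t (g t u))" for k
    by (rule ck_family_compose[OF assms(1) W])
      (use assms(2,3) in \<open>auto simp: smooth_family_iff_ck intro: ck_family_mono\<close>)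
  with W show ?thesis unfolding smooth_family_iff_ck by blast
qed

lemma smooth_family_restrict_param:
  fixes W :: "('t \<times> 'm::real_normed_vector) set"
  assumes "smooth_family T W g"
  shows "smooth_family (subtopology T S) (W \<inter> S \<times> UNIV) g"
proof -
  have "prod_topology (subtopology T S) (euclidean :: 'm topology) = subtopology (prod_topology T euclidean) (S \<times> UNIV)"
    using prod_topology_subtopology(1)[of T S euclidean] by simp
  moreover have "S \<times> UNIV \<inter> (W \<inter> S \<times> UNIV) = S \<times> UNIV \<inter> W" by blast
  ultimately show ?thesis
    using assms unfolding smooth_family_def cont_family_def
    by (auto simp: subtopology_subtopology openin_subtopology_Int
       intro: continuous_map_from_subtopology_mono)
qed

text \<open>For a function independent of \<open>t\<close>, joint continuity of the derivatives is
  their continuity in \<open>u\<close>, which follows from the differentiability of every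
  order.\<close>

lemma smooth_family_const_param:
  assumes "open S" "smooth_on S g"
  shows "smooth_family T (topspace T \<times> S) (\<lambda>t. g)"
  unfolding smooth_family_def
proof (intro conjI allI)
  show "openin (prod_topology T euclidean) (topspace T \<times> S)"
    using assms(1) by (simp add: openin_prod_Times_iff)
  fix hs
  show "\<forall>(t, u)\<in>topspace T \<times> S. dderivs hs g differentiable at u"
    using assms(2) by (auto simp: smooth_on_def)
  have "continuous_on S (dderivs hs g)"
    using assms(2)
    by (auto simp: smooth_on_def intro!: continuous_at_imp_continuous_on differentiable_imp_continuous_within)
  then have "continuous_map (top_of_set S) euclidean (dderivs hs g)" by simp
  moreover have "continuous_map (subtopology (prod_topology T euclidean) (topspace T \<times> S)) (top_of_set S) snd"
    by (auto simp: continuous_map_in_subtopology continuous_map_subtopology_snd)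
  ultimately have "continuous_map (subtopology (prod_topology T euclidean) (topspace T \<times> S)) euclidean (dderivs hs g \<circ> snd)"
    by (rule continuous_map_compose[rotated])
  then show "cont_family T (topspace T \<times> S) (\<lambda>t. dderivs hs g)"
    unfolding cont_family_def by (simp add: o_def case_prod_unfold)
qed

lemma smooth_family_smooth_on:
  assumes "smooth_family T W g"
  shows "smooth_on {u. (t, u) \<in> W} (g t)"
  using assms unfolding smooth_family_def smooth_on_def by blast

lemma smooth_family_const:
  "openin (prod_topology T euclidean) W \<Longrightarrow> smooth_family T W (\<lambda>t u. c)"
  by (simp add: smooth_family_iff_ck ck_family_const)

lemma smooth_family_ident:
  "openin (prod_topology T euclidean) W \<Longrightarrow> smooth_family T W (\<lambda>t u. u)"
  by (simp add: smooth_family_iff_ck ck_family_ident)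

lemma smooth_family_bounded_linear:
  "bounded_linear p \<Longrightarrow> smooth_family T W g \<Longrightarrow> smooth_family T W (\<lambda>t u. p (g t u))"
  by (simp add: smooth_family_iff_ck ck_family_bounded_linear)

lemma smooth_family_bilinear:
  "bounded_bilinear p \<Longrightarrow> smooth_family T W f \<Longrightarrow> smooth_family T W g \<Longrightarrow>
    smooth_family T W (\<lambda>t u. p (f t u) (g t u))"
  by (simp add: smooth_family_iff_ck ck_family_bilinear)

lemma smooth_family_add:
  "smooth_family T W f \<Longrightarrow> smooth_family T W g \<Longrightarrow> smooth_family T W (\<lambda>t u. f t u + g t u)"
  by (simp add: smooth_family_iff_ck ck_family_add)

lemma smooth_family_diff:
  assumes "smooth_family T W f" "smooth_family T W g"
  shows "smooth_family T W (\<lambda>t u. f t u - g t u)"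
  using smooth_family_add[OF assms(1) smooth_family_bounded_linear[OF bounded_linear_minus[OF bounded_linear_ident] assms(2)]]
  by simp

lemma smooth_family_Pair:
  "smooth_family T W f \<Longrightarrow> smooth_family T W g \<Longrightarrow> smooth_family T W (\<lambda>t u. (f t u, g t u))"
  by (simp add: smooth_family_iff_ck ck_family_Pair)

lemma smooth_family_compose_subset:
  fixes g :: "'t \<Rightarrow> 'm::real_normed_vector \<Rightarrow> 'n::real_inner"
  assumes "finite_dim TYPE('n)" "smooth_family T W g" "smooth_family T W' f"
    and "\<And>t u. (t, u) \<in> W \<Longrightarrow> (t, g t u) \<in> W'"
  shows "smooth_family T W (\<lambda>t u. f t (g t u))"
proof -
  have "{(t, u). (t, u) \<in> W \<and> (t, g t u) \<in> W'} = W" using assms(4) by auto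
  then show ?thesis using smooth_family_compose[OF assms(1-3)] by simp
qed

section \<open>Bump functions\<close>

text \<open>The powers of \<open>1 / s\<close> make the family closed under differentiation.\<close>

definition flat :: "nat \<Rightarrow> real \<Rightarrow> real" where
  "flat n s = (if s \<le> 0 then 0 else (1 / s) ^ n * exp (- (1 / s)))"

text \<open>In terms of \<open>1 / s\<close>, the claim from the right is that the exponential
  outgrows every power; from the left \<open>flat n\<close> is 0.\<close>

lemma flat_tendsto_0: "(flat n \<longlongrightarrow> 0) (at 0)"
proof (rule filterlim_split_at)
  have "eventually (\<lambda>s. 0 = flat n s) (at_left 0)"
    by (auto simp: flat_def eventually_at_filter)
  then show "(flat n \<longlongrightarrow> 0) (at_left 0)"
    by (rule Lim_transform_eventually[OF tendsto_const])
  have "((\<lambda>s. (inverse s) ^ n / exp (inverse s)) \<longlongrightarrow> 0) (at_right (0::real))"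
    by (rule filterlim_compose[OF tendsto_power_div_exp_0 filterlim_inverse_at_top_right])
  moreover have "eventually (\<lambda>s. (inverse s) ^ n / exp (inverse s) = flat n s) (at_right 0)"
    by (auto simp: flat_def eventually_at_filter exp_minus divide_inverse)
  ultimately show "(flat n \<longlongrightarrow> 0) (at_right 0)"
    by (rule Lim_transform_eventually)
qed

text \<open>For positive \<open>s\<close> this is the product rule. At 0 the difference quotient of
  \<open>flat n\<close> is \<open>flat (Suc n)\<close>, which tends to 0.\<close>

lemma flat_has_derivative:
  "(flat n has_real_derivative (flat (n + 2) s - n * flat (n + 1) s)) (at s)"
proof -
  consider "s < 0" | "s = 0" | "s > 0" by linarith
  then show ?thesis
  proof cases
    case 1
    have "((\<lambda>s. 0) has_real_derivative 0) (at s)" by simp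
    then have "(flat n has_real_derivative 0) (at s)"
      by (rule has_field_derivative_transform_within_open[where S = "{..<0}"]) (use 1 in \<open>auto simp: flat_def\<close>)
    then show ?thesis using 1 by (simp add: flat_def)
  next
    case 2
    have "(\<lambda>h. (flat n (0 + h) - flat n 0) / h) = flat (Suc n)"
      by (rule ext) (simp add: flat_def)
    then have "(flat n has_real_derivative 0) (at 0)"
      unfolding DERIV_def using flat_tendsto_0[of "Suc n"] by simp
    then show ?thesis using 2 by (simp add: flat_def)
  next
    case 3
    have "((\<lambda>s. (1 / s) ^ n * exp (- (1 / s))) has_real_derivative
        (flat (n + 2) s - n * flat (n + 1) s)) (at s)"
      by (rule derivative_eq_intros refl | use 3 in \<open>force\<close>)+
        (use 3 in \<open>cases n; simp add: flat_def field_simps power2_eq_square\<close>)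
    then show ?thesis
      by (rule has_field_derivative_transform_within_open[where S = "{0<..}"]) (use 3 in \<open>auto simp: flat_def\<close>)
  qed
qed

lemma openin_topspace_Times:
  "open S \<Longrightarrow> openin (prod_topology T euclidean) (topspace T \<times> S)"
  by (simp add: openin_prod_Times_iff)

lemma smooth_family_flat: "smooth_family T (topspace T \<times> UNIV) (\<lambda>t. flat n)"
proof -
  let ?W = "topspace T \<times> (UNIV :: real set)"
  have W: "openin (prod_topology T euclidean) ?W" by (rule openin_topspace_Times) simp
  have cont: "continuous_on UNIV (flat n)" for n
    using DERIV_isCont[OF flat_has_derivative] by (intro continuous_at_imp_continuous_on ballI)
  have "ck_family k T ?W (\<lambda>t. flat n)" for k n
  proof (induction k arbitrary: n)
    case 0
    have "cont_family T ?W (\<lambda>t u. u)" by (rule smooth_family_cont[OF smooth_family_ident[OF W]])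
    from cont_family_compose1[OF this cont] show ?case by simp
  next
    case (Suc k)
    show ?case
    proof (rule ck_family_has_derivativeI[OF W, where d = "\<lambda>t s h. h * (flat (n + 2) s - n * flat (n + 1) s)"])
      have "cont_family T ?W (\<lambda>t u. u)" by (rule smooth_family_cont[OF smooth_family_ident[OF W]])
      from cont_family_compose1[OF this cont] show "cont_family T ?W (\<lambda>t. flat n)" .
      show "(flat n has_derivative (\<lambda>h. h * (flat (n + 2) s - real n * flat (n + 1) s))) (at s)" for s
        using flat_has_derivative[of n s] by (simp add: has_field_derivative_def mult_commute_abs)
      show "ck_family k T ?W (\<lambda>t s. h * (flat (n + 2) s - real n * flat (n + 1) s))" for h
      proof -
        have "ck_family k T ?W (\<lambda>t s. h * flat (n + 2) s + (- h * real n) * flat (n + 1) s)"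
          by (intro ck_family_add[OF W] ck_family_bounded_linear[OF W bounded_linear_mult_right] Suc.IH)
        then show ?thesis by (simp add: algebra_simps)
      qed
    qed
  qed
  with W show ?thesis unfolding smooth_family_iff_ck by blast
qed

text \<open>The derivative is \<open>- h\<close> times the product of \<open>inverse\<close> with
  itself, so the product rule closes the induction.\<close>

lemma smooth_family_inverse: "smooth_family T (topspace T \<times> (- {0})) (\<lambda>t (s::real). inverse s)"
proof -
  let ?W = "topspace T \<times> (- {0 :: real})"
  have W: "openin (prod_topology T euclidean) ?W" by (rule openin_topspace_Times) auto
  have cont: "cont_family T ?W (\<lambda>t s. inverse s)"
  proof -
    have "continuous_map (subtopology (prod_topology T euclidean) ?W) (top_of_set (- {0})) snd"
      by (auto simp: continuous_map_in_subtopology continuous_map_subtopology_snd)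
    moreover have "continuous_map (top_of_set (- {0})) euclidean (inverse :: real \<Rightarrow> real)"
      by (auto intro!: continuous_on_inverse)
    ultimately have "continuous_map (subtopology (prod_topology T euclidean) ?W) euclidean (inverse \<circ> snd)"
      by (rule continuous_map_compose)
    then show ?thesis
      unfolding cont_family_def by (simp add: o_def case_prod_unfold)
  qed
  have "ck_family k T ?W (\<lambda>t s. inverse s)" for k
  proof (induction k)
    case 0
    with cont show ?case by simp
  next
    case (Suc k)
    show ?case
    proof (rule ck_family_has_derivativeI[OF W cont, where d = "\<lambda>t s h. - (inverse s * h * inverse s)"])
      show "(inverse has_derivative (\<lambda>h. - (inverse s * h * inverse s))) (at s)"
        if "(t, s) \<in> ?W" for t and s :: real
        by (rule has_derivative_inverse') (use that in auto)
      show "ck_family k T ?W (\<lambda>t s. - (inverse s * h * inverse s))" for h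
      proof -
        have "ck_family k T ?W (\<lambda>t s. (- h) * (inverse s * inverse s))"
          by (intro ck_family_bounded_linear[OF W bounded_linear_mult_right]
              ck_family_bilinear[OF W bounded_bilinear_mult] Suc.IH)
        then show ?thesis by (simp add: mult.assoc mult.left_commute)
      qed
    qed
  qed
  with W show ?thesis unfolding smooth_family_iff_ck by blast
qed

text \<open>The classical quotient a / (a + b), built from \<open>flat 0\<close>, which is exp(-1/s)
  for positive s: \<open>a\<close> is positive exactly inside radius 2r and \<open>b\<close> exactly
  outside radius r, so the denominator never vanishes. Squared distances keep both smooth at the
  centre. The parameter space is quantified inside the conclusion, so that one \<open>w\<close>
  still serves after the parameter space has been shrunk.\<close>

lemma smooth_bump_exists:
  fixes c :: "'m::real_inner"
  assumes "0 < r"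
  obtains w :: "'m \<Rightarrow> real"
  where "\<And>(T :: 't topology). smooth_family T (topspace T \<times> UNIV) (\<lambda>t. w)"
    "\<And>u. 0 \<le> w u" "\<And>u. w u \<le> 1" "\<And>u. dist c u \<le> r \<Longrightarrow> w u = 1" "\<And>u. dist c u \<ge> 2 * r \<Longrightarrow> w u = 0"
proof -
  define a where "a u = flat 0 (4 * r\<^sup>2 - (u - c) \<bullet> (u - c))" for u :: 'm
  define b where "b u = flat 0 ((u - c) \<bullet> (u - c) - r\<^sup>2)" for u :: 'm
  define w where "w u = a u * inverse (a u + b u)" for u
  have nn: "a u \<ge> 0" "b u \<ge> 0" for u by (auto simp: a_def b_def flat_def)
  have pos: "a u + b u > 0" for u
  proof (cases "(u - c) \<bullet> (u - c) < 4 * r\<^sup>2")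
    case True
    then have "a u > 0" by (simp add: a_def flat_def)
    with nn(2)[of u] show ?thesis by linarith
  next
    case False
    moreover have "r\<^sup>2 > 0" using assms by simp
    ultimately have "(u - c) \<bullet> (u - c) - r\<^sup>2 > 0" by linarith
    then have "b u > 0" by (simp add: b_def flat_def)
    with nn(1)[of u] show ?thesis by linarith
  qed
  have dist: "(u - c) \<bullet> (u - c) = (dist c u)\<^sup>2" for u
    by (simp add: dist_norm norm_minus_commute dot_square_norm)
  show thesis
  proof
    fix T :: "'t topology"
    let ?W = "topspace T \<times> (UNIV :: 'm set)"
    have W: "openin (prod_topology T euclidean) ?W" by (rule openin_topspace_Times) simp
    have sq: "smooth_family T ?W (\<lambda>t u. (u - c) \<bullet> (u - c))"
      by (intro smooth_family_bilinear[OF bounded_bilinear_inner] smooth_family_diff smooth_family_ident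
          smooth_family_const W)
    have a: "smooth_family T ?W (\<lambda>t. a)"
      unfolding a_def
      by (rule smooth_family_compose_subset[OF finite_dim_real _ smooth_family_flat])
        (intro smooth_family_diff sq smooth_family_const[OF W], auto)
    have b: "smooth_family T ?W (\<lambda>t. b)"
      unfolding b_def
      by (rule smooth_family_compose_subset[OF finite_dim_real _ smooth_family_flat])
        (intro smooth_family_diff sq smooth_family_const[OF W], auto)
    have "smooth_family T ?W (\<lambda>t u. inverse (a u + b u))"
      by (rule smooth_family_compose_subset[OF finite_dim_real smooth_family_add[OF a b] smooth_family_inverse])
        (simp add: pos less_imp_neq[symmetric])
    from smooth_family_bilinear[OF bounded_bilinear_mult a this]
    show "smooth_family T ?W (\<lambda>t. w)" by (simp add: w_def[abs_def])
  next
    fix u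
    show "0 \<le> w u" using nn pos[of u] by (simp add: w_def)
    show "w u \<le> 1" using nn[of u] pos[of u] by (simp add: w_def field_simps)
    show "w u = 1" if "dist c u \<le> r"
    proof -
      have "(dist c u)\<^sup>2 \<le> r\<^sup>2" using that by (simp add: power_mono)
      then have "b u = 0" by (simp add: b_def flat_def dist)
      with pos[of u] show ?thesis by (simp add: w_def)
    qed
    show "w u = 0" if "dist c u \<ge> 2 * r"
    proof -
      have "(2 * r)\<^sup>2 \<le> (dist c u)\<^sup>2" using that assms by (intro power_mono) auto
      then have "a u = 0" by (simp add: a_def flat_def dist power_mult_distrib)
      then show ?thesis by (simp add: w_def)
    qed
  qed
qed

section \<open>Families of manifolds and of smooth maps\<close>

lemma continuous_map_locally:
  assumes "\<And>x. x \<in> topspace X \<Longrightarrow> \<exists>G. openin X G \<and> x \<in> G \<and> continuous_map (subtopology X G) Y f"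
  shows "continuous_map X Y f"
  unfolding continuous_map_def
proof (intro conjI allI impI)
  show "f \<in> topspace X \<rightarrow> topspace Y"
    using assms by (fastforce simp: continuous_map_def)
  fix B assume B: "openin Y B"
  show "openin X {x \<in> topspace X. f x \<in> B}"
  proof (subst openin_subopen, safe)
    fix x assume x: "x \<in> topspace X" "f x \<in> B"
    then obtain G where G: "openin X G" "x \<in> G" "continuous_map (subtopology X G) Y f"
      using assms by blast
    have "openin X {x \<in> topspace (subtopology X G). f x \<in> B}"
      using openin_continuous_map_preimage[OF G(3) B] G(1) openin_trans_full by blast
    then show "\<exists>S. openin X S \<and> x \<in> S \<and> S \<subseteq> {x \<in> topspace X. f x \<in> B}"
      using x G(2) by (intro exI[of _ "{x \<in> topspace (subtopology X G). f x \<in> B}"]) auto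
  qed
qed

lemma openin_preimage_on:
  assumes "openin Z G" "continuous_map (subtopology Z G) Z' h" "openin Z' B"
  shows "openin Z {z \<in> G. h z \<in> B}"
proof -
  have "openin Z {z \<in> topspace (subtopology Z G). h z \<in> B}"
    using openin_continuous_map_preimage[OF assms(2,3)] assms(1) openin_trans_full by blast
  moreover have "topspace (subtopology Z G) = G" using openin_subset[OF assms(1)] by auto
  ultimately show ?thesis by (simp only:)
qed

lemma continuous_map_into_open_subset:
  "continuous_map Z Z' h \<Longrightarrow> (\<And>z. z \<in> topspace Z \<Longrightarrow> h z \<in> S) \<Longrightarrow> continuous_map Z (subtopology Z' S) h"
  by (auto simp: continuous_map_in_subtopology)

definition total_space :: "'t topology \<Rightarrow> ('t \<Rightarrow> 'a set) \<Rightarrow> ('t \<times> 'a) set" where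
  "total_space T S = {(t, p). t \<in> topspace T \<and> p \<in> S t}"

text \<open>The family \<open>S\<close> is often replaced by smaller sets such as
  \<open>D' \<inter> S t\<close> or \<open>{p \<in> S t. f t p \<in> D'}\<close>, so that the
  domains of transition maps and of maps read in charts have the same form.\<close>

definition chart_image :: "'t topology \<Rightarrow> ('t \<Rightarrow> 'a set) \<Rightarrow> 'a set \<Rightarrow> ('a \<Rightarrow> 'm) \<Rightarrow> ('t \<times> 'm) set" where
  "chart_image T S D \<phi> = {(t, \<phi> p) | t p. t \<in> topspace T \<and> p \<in> D \<inter> S t}"

definition family_chart ::
    "'t topology \<Rightarrow> ('a, 'm::real_inner) manifold \<Rightarrow> ('t \<Rightarrow> 'a set) \<Rightarrow> 'a set \<Rightarrow> ('a \<Rightarrow> 'm) \<Rightarrow> bool" where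
  "family_chart T A S D \<phi> \<longleftrightarrow>
     openin (mtop A) D \<and> continuous_map (subtopology (mtop A) D) euclidean \<phi> \<and>
     (\<forall>t\<in>topspace T. inj_on \<phi> (D \<inter> S t)) \<and>
     openin (prod_topology T euclidean) (chart_image T S D \<phi>) \<and>
     continuous_map (subtopology (prod_topology T euclidean) (chart_image T S D \<phi>)) (mtop A)
       (\<lambda>(t, u). inv_into (D \<inter> S t) \<phi> u)"

text \<open>
  The manifolds \<open>S t\<close> vary with the parameter.  What makes \<open>(t, p) \<mapsto> (t, \<phi> p)\<close> a chart of the total
  space is that its image is open in \<open>T\<close> times the model space and its inverse is continuous.
\<close>

definition manifold_family ::
    "'t topology \<Rightarrow> ('a, 'm::real_inner) manifold \<Rightarrow> ('t \<Rightarrow> 'a set) \<Rightarrow> bool" where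
  "manifold_family T A S \<longleftrightarrow>
     finite_dim TYPE('m) \<and>
     (\<forall>t\<in>topspace T. S t \<subseteq> points A \<and> (\<forall>p\<in>S t. \<exists>(D, \<phi>)\<in>atlas A. p \<in> D)) \<and>
     (\<forall>(D, \<phi>)\<in>atlas A. family_chart T A S D \<phi>) \<and>
     (\<forall>(D, \<phi>)\<in>atlas A. \<forall>(D', \<phi>')\<in>atlas A.
        smooth_family T (chart_image T (\<lambda>t. D' \<inter> S t) D \<phi>) (\<lambda>t. \<phi>' \<circ> inv_into (D \<inter> S t) \<phi>))"

text \<open>\<open>A\<close> and \<open>N\<close> need not be manifolds; only the slices
  \<open>S t\<close> and \<open>R t\<close>, with the charts restricted to them, have to be. Through
  \<open>smooth_family\<close> the last clause also says that the domains of the maps read in charts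
  are open.\<close>

definition smooth_map_family ::
    "'t topology \<Rightarrow> ('a, 'm::real_inner) manifold \<Rightarrow> ('t \<Rightarrow> 'a set) \<Rightarrow> ('b, 'n::real_inner) manifold
      \<Rightarrow> ('t \<Rightarrow> 'b set) \<Rightarrow> ('t \<Rightarrow> 'a \<Rightarrow> 'b) \<Rightarrow> bool" where
  "smooth_map_family T A S N R f \<longleftrightarrow>
     (\<forall>t\<in>topspace T. \<forall>p\<in>S t. f t p \<in> R t) \<and>
     continuous_map (subtopology (prod_topology T (mtop A)) (total_space T S)) (mtop N) (\<lambda>(t, p). f t p) \<and>
     (\<forall>(D, \<phi>)\<in>atlas A. \<forall>(D', \<psi>)\<in>atlas N.
        smooth_family T (chart_image T (\<lambda>t. {p \<in> S t. f t p \<in> D'}) D \<phi>) (\<lambda>t. \<psi> \<circ> f t \<circ> inv_into (D \<inter> S t) \<phi>))"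

text \<open>An explicit inverse \<open>j\<close> on a set \<open>W\<close> known to be open replaces
  \<open>inv_into\<close> and \<open>chart_image\<close>, whose continuity and openness are awkward
  to establish directly.\<close>

lemma family_chartI:
  assumes "openin (mtop A) D" "continuous_map (subtopology (mtop A) D) euclidean \<phi>"
    and W: "openin (prod_topology T euclidean) W"
    and 1: "\<And>t u. (t, u) \<in> W \<Longrightarrow> j t u \<in> D \<inter> S t \<and> \<phi> (j t u) = u"
    and 2: "\<And>t p. t \<in> topspace T \<Longrightarrow> p \<in> D \<Longrightarrow> p \<in> S t \<Longrightarrow> (t, \<phi> p) \<in> W \<and> j t (\<phi> p) = p"
    and cont: "continuous_map (subtopology (prod_topology T euclidean) W) (mtop A) (\<lambda>(t, u). j t u)"
  shows "family_chart T A S D \<phi>" "chart_image T S D \<phi> = W"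
    "\<And>t u. (t, u) \<in> W \<Longrightarrow> inv_into (D \<inter> S t) \<phi> u = j t u"
proof -
  have tW: "t \<in> topspace T" if "(t, u) \<in> W" for t u using openin_subset[OF W] that by auto
  have inj: "inj_on \<phi> (D \<inter> S t)" if "t \<in> topspace T" for t
    by (rule inj_on_inverseI[where g = "j t"]) (use 2 that in auto)
  show *: "chart_image T S D \<phi> = W"
  proof (intro equalityI subsetI)
    fix z assume "z \<in> chart_image T S D \<phi>" then show "z \<in> W" using 2 by (auto simp: chart_image_def)
  next
    fix z assume z: "z \<in> W"
    then have "t \<in> topspace T \<and> j t u \<in> D \<inter> S t \<and> \<phi> (j t u) = u" if "z = (t, u)" for t u
      using 1 tW that by blast
    then show "z \<in> chart_image T S D \<phi>" unfolding chart_image_def by (cases z) (smt (verit) mem_Collect_eq)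
  qed
  show **: "inv_into (D \<inter> S t) \<phi> u = j t u" if "(t, u) \<in> W" for t u
    using 1[OF that] inv_into_f_f[OF inj[OF tW[OF that]], of "j t u"] by simp
  have "continuous_map (subtopology (prod_topology T euclidean) W) (mtop A) (\<lambda>(t, u). inv_into (D \<inter> S t) \<phi> u)"
    by (rule continuous_map_eq[OF cont]) (use ** in auto)
  then show "family_chart T A S D \<phi>"
    unfolding family_chart_def * using assms inj by blast
qed

section \<open>Charts of the total space of a family of manifolds\<close>

context
  fixes T :: "'t topology" and A :: "('a, 'm::real_inner) manifold" and S
  assumes A: "manifold_family T A S"
begin

lemma mf_finite_dim: "finite_dim TYPE('m)"
  using A by (simp add: manifold_family_def)

lemma mf_subset: "t \<in> topspace T \<Longrightarrow> p \<in> S t \<Longrightarrow> p \<in> points A"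
  using A by (auto simp: manifold_family_def)

lemma mf_cover:
  assumes "t \<in> topspace T" "p \<in> S t"
  obtains D \<phi> where "(D, \<phi>) \<in> atlas A" "p \<in> D"
  using A assms unfolding manifold_family_def by blast

lemma mf_chart: "(D, \<phi>) \<in> atlas A \<Longrightarrow> family_chart T A S D \<phi>"
  using A by (auto simp: manifold_family_def)

lemma mf_inv:
  "(D, \<phi>) \<in> atlas A \<Longrightarrow> t \<in> topspace T \<Longrightarrow> p \<in> D \<Longrightarrow> p \<in> S t \<Longrightarrow> inv_into (D \<inter> S t) \<phi> (\<phi> p) = p"
  using mf_chart[of D \<phi>] by (simp add: family_chart_def)

lemma mf_chart_image_iff:
  assumes "(D, \<phi>) \<in> atlas A" "t \<in> topspace T" "p \<in> D" "p \<in> S t" "S' t \<subseteq> S t"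
  shows "(t, \<phi> p) \<in> chart_image T S' D \<phi> \<longleftrightarrow> p \<in> S' t"
proof
  assume "(t, \<phi> p) \<in> chart_image T S' D \<phi>"
  then obtain q where q: "\<phi> p = \<phi> q" "q \<in> D" "q \<in> S' t" by (auto simp: chart_image_def)
  then have "p = q"
    using mf_chart[OF assms(1)] assms by (auto simp: family_chart_def dest: inj_onD)
  with q show "p \<in> S' t" by simp
next
  assume "p \<in> S' t"
  then show "(t, \<phi> p) \<in> chart_image T S' D \<phi>" using assms by (auto simp: chart_image_def)
qed

lemma mf_transition:
  "(D, \<phi>) \<in> atlas A \<Longrightarrow> (D', \<phi>') \<in> atlas A \<Longrightarrow>
    smooth_family T (chart_image T (\<lambda>t. D' \<inter> S t) D \<phi>) (\<lambda>t. \<phi>' \<circ> inv_into (D \<inter> S t) \<phi>)"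
  using A unfolding manifold_family_def by blast

lemma mf_openin_total:
  assumes "openin (mtop A) D"
  shows "openin (subtopology (prod_topology T (mtop A)) (total_space T S)) {(t, p) \<in> total_space T S. p \<in> D}"
proof -
  have "openin (prod_topology T (mtop A)) (topspace T \<times> D)" using assms by (simp add: openin_prod_Times_iff)
  moreover have "{(t, p) \<in> total_space T S. p \<in> D} = total_space T S \<inter> (topspace T \<times> D)"
    by (auto simp: total_space_def)
  ultimately show ?thesis by (metis openin_subtopology_Int2)
qed

lemma topspace_total [simp]:
  "topspace (subtopology (prod_topology T (mtop A)) (total_space T S)) = total_space T S"
  using mf_subset by (auto simp: total_space_def)

lemma mf_chart_continuous:
  assumes "(D, \<phi>) \<in> atlas A"
  shows "continuous_map (subtopology (subtopology (prod_topology T (mtop A)) (total_space T S)) {(t, p) \<in> total_space T S. p \<in> D})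
     (subtopology (prod_topology T euclidean) (chart_image T S D \<phi>)) (\<lambda>(t, p). (t, \<phi> p))"
proof -
  let ?G = "{(t, p) \<in> total_space T S. p \<in> D}"
  let ?X = "subtopology (prod_topology T (mtop A)) ?G"
  have eq: "subtopology (subtopology (prod_topology T (mtop A)) (total_space T S)) ?G = ?X"
    by (simp add: subtopology_subtopology) (rule arg_cong2[where f = subtopology], auto)
  have "continuous_map ?X (subtopology (mtop A) D) snd"
    by (auto simp: continuous_map_in_subtopology continuous_map_subtopology_snd)
  moreover have "continuous_map (subtopology (mtop A) D) euclidean \<phi>"
    using mf_chart[OF assms] by (simp add: family_chart_def)
  ultimately have "continuous_map ?X euclidean (\<phi> \<circ> snd)" by (rule continuous_map_compose)
  moreover have "continuous_map ?X T fst" by (simp add: continuous_map_subtopology_fst)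
  ultimately have "continuous_map ?X (prod_topology T euclidean) (\<lambda>z. (fst z, (\<phi> \<circ> snd) z))"
    by (intro continuous_map_pairedI) (simp_all add: o_def)
  then have "continuous_map ?X (prod_topology T euclidean) (\<lambda>(t, p). (t, \<phi> p))"
    by (simp add: case_prod_unfold)
  then show ?thesis
    unfolding eq continuous_map_in_subtopology
    by (auto simp: chart_image_def total_space_def)
qed

lemma mf_chart_nbhd:
  assumes "(D, \<phi>) \<in> atlas A" "openin (prod_topology T euclidean) W"
  shows "openin (subtopology (prod_topology T (mtop A)) (total_space T S))
     {(t, p) \<in> total_space T S. p \<in> D \<and> (t, \<phi> p) \<in> W}"
proof -
  let ?G = "{(t, p) \<in> total_space T S. p \<in> D}"
  let ?X = "subtopology (prod_topology T (mtop A)) (total_space T S)"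
  have G: "openin ?X ?G"
    using mf_openin_total mf_chart[OF assms(1)] by (simp add: family_chart_def)
  have "continuous_map (subtopology ?X ?G) (prod_topology T euclidean) (\<lambda>(t, p). (t, \<phi> p))"
    using mf_chart_continuous[OF assms(1)] continuous_map_in_subtopology by blast
  from openin_continuous_map_preimage[OF this assms(2)]
  have "openin ?X {x \<in> topspace (subtopology ?X ?G). (\<lambda>(t, p). (t, \<phi> p)) x \<in> W}"
    using G openin_trans_full by blast
  moreover have "{x \<in> topspace (subtopology ?X ?G). (\<lambda>(t, p). (t, \<phi> p)) x \<in> W}
      = {(t, p) \<in> total_space T S. p \<in> D \<and> (t, \<phi> p) \<in> W}"
    using mf_subset by (auto simp: total_space_def)
  ultimately show ?thesis by simp
qed

text \<open>The inverse of the chart is continuous on an open set, so it pulls open sets of the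
  total space back to open sets of T times the model space. This is the purpose of the last clause
  of \<open>family_chart\<close>.\<close>

lemma mf_openin_chart_image:
  assumes "(D, \<phi>) \<in> atlas A"
    and "openin (subtopology (prod_topology T (mtop A)) (total_space T S)) G"
  shows "openin (prod_topology T euclidean) {(t, u). (t, u) \<in> chart_image T S D \<phi> \<and> (t, inv_into (D \<inter> S t) \<phi> u) \<in> G}"
proof -
  let ?W = "chart_image T S D \<phi>"
  have W: "openin (prod_topology T euclidean) ?W"
    "continuous_map (subtopology (prod_topology T euclidean) ?W) (mtop A) (\<lambda>(t, u). inv_into (D \<inter> S t) \<phi> u)"
    using mf_chart[OF assms(1)] by (simp_all add: family_chart_def)
  have "continuous_map (subtopology (prod_topology T euclidean) ?W) (prod_topology T (mtop A))
    (\<lambda>z. (fst z, (\<lambda>(t, u). inv_into (D \<inter> S t) \<phi> u) z))"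
    using W(2) by (intro continuous_map_pairedI) (simp_all add: continuous_map_subtopology_fst)
  moreover have "(fst z, (\<lambda>(t, u). inv_into (D \<inter> S t) \<phi> u) z) \<in> total_space T S" if "z \<in> ?W" for z
    using that mf_inv[OF assms(1)] by (auto simp: chart_image_def total_space_def)
  ultimately have "continuous_map (subtopology (prod_topology T euclidean) ?W) (subtopology (prod_topology T (mtop A)) (total_space T S))
    (\<lambda>z. (fst z, (\<lambda>(t, u). inv_into (D \<inter> S t) \<phi> u) z))"
    by (auto simp: continuous_map_in_subtopology)
  from openin_continuous_map_preimage[OF this assms(2)] W(1)
  have "openin (prod_topology T euclidean) {x \<in> topspace (subtopology (prod_topology T euclidean) ?W). (fst x, (\<lambda>(t, u). inv_into (D \<inter> S t) \<phi> u) x) \<in> G}"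
    using openin_trans_full by blast
  moreover have "{x \<in> topspace (subtopology (prod_topology T euclidean) ?W). (fst x, (\<lambda>(t, u). inv_into (D \<inter> S t) \<phi> u) x) \<in> G}
     = {(t, u). (t, u) \<in> chart_image T S D \<phi> \<and> (t, inv_into (D \<inter> S t) \<phi> u) \<in> G}"
    by (auto simp: chart_image_def)
  ultimately show ?thesis by simp
qed

lemma mf_openin_preimage:
  assumes "continuous_map (subtopology (prod_topology T (mtop A)) (total_space T S)) N (\<lambda>(t, p). f t p)"
    and "(D, \<phi>) \<in> atlas A" "openin N D'"
  shows "openin (prod_topology T euclidean) (chart_image T (\<lambda>t. {p \<in> S t. f t p \<in> D'}) D \<phi>)"
proof -
  let ?G = "{z \<in> total_space T S. (\<lambda>(t, p). f t p) z \<in> D'}"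
  from openin_continuous_map_preimage[OF assms(1,3)]
  have "openin (subtopology (prod_topology T (mtop A)) (total_space T S)) ?G" unfolding topspace_total .
  from mf_openin_chart_image[OF assms(2) this]
  have "openin (prod_topology T euclidean) {(t, u). (t, u) \<in> chart_image T S D \<phi> \<and> (t, inv_into (D \<inter> S t) \<phi> u) \<in> ?G}" .
  moreover have "{(t, u). (t, u) \<in> chart_image T S D \<phi> \<and> (t, inv_into (D \<inter> S t) \<phi> u) \<in> ?G}
      = chart_image T (\<lambda>t. {p \<in> S t. f t p \<in> D'}) D \<phi>"
    using mf_inv[OF assms(2)] by (auto simp: chart_image_def total_space_def)
  ultimately show ?thesis by simp
qed

end

text \<open>A local form of smoothness: one pair of charts around the point, and any smooth family
  \<open>r\<close> that represents the map there. Continuity is not presupposed, because it is part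
  of the condition that \<open>f t' p'\<close> stays in \<open>D'\<close>.\<close>

definition smooth_map_family_at ::
    "'t topology \<Rightarrow> ('a, 'm::real_inner) manifold \<Rightarrow> ('t \<Rightarrow> 'a set) \<Rightarrow> ('b, 'n::real_inner) manifold
      \<Rightarrow> ('t \<Rightarrow> 'a \<Rightarrow> 'b) \<Rightarrow> 't \<Rightarrow> 'a \<Rightarrow> bool" where
  "smooth_map_family_at T A S N f t p \<longleftrightarrow>
     (\<exists>D \<phi> D' \<psi> W r. (D, \<phi>) \<in> atlas A \<and> (D', \<psi>) \<in> atlas N \<and> p \<in> D \<and> (t, \<phi> p) \<in> W \<and> smooth_family T W r \<and>
        (\<forall>t' p'. t' \<in> topspace T \<and> p' \<in> D \<and> p' \<in> S t' \<and> (t', \<phi> p') \<in> W \<longrightarrow>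
           f t' p' \<in> D' \<and> \<psi> (f t' p') = r t' (\<phi> p')))"

lemma smooth_map_family_atI:
  assumes "(D, \<phi>) \<in> atlas A" "(D', \<psi>) \<in> atlas N" "p \<in> D" "(t, \<phi> p) \<in> W" "smooth_family T W r"
    and "\<And>t' p'. t' \<in> topspace T \<Longrightarrow> p' \<in> D \<Longrightarrow> p' \<in> S t' \<Longrightarrow> (t', \<phi> p') \<in> W \<Longrightarrow>
           f t' p' \<in> D' \<and> \<psi> (f t' p') = r t' (\<phi> p')"
  shows "smooth_map_family_at T A S N f t p"
  unfolding smooth_map_family_at_def
  by (rule exI[of _ D], rule exI[of _ \<phi>], rule exI[of _ D'], rule exI[of _ \<psi>], rule exI[of _ W], rule exI[of _ r])
    (use assms in simp)

text \<open>Near each point \<open>f\<close> is the chart of the source, then \<open>r\<close>, then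
  the inverse chart of the target, all continuous jointly with \<open>t\<close>; hence
  \<open>f\<close> is continuous. In any other pair of charts its expression is a transition map,
  then \<open>r\<close>, then a transition map.\<close>

lemma smooth_map_familyI:
  fixes A :: "('a, 'm::real_inner) manifold" and N :: "('b, 'n::real_inner) manifold"
  assumes A: "manifold_family T A S" and N: "manifold_family T N R"
    and maps: "\<And>t p. t \<in> topspace T \<Longrightarrow> p \<in> S t \<Longrightarrow> f t p \<in> R t"
    and loc: "\<And>t p. t \<in> topspace T \<Longrightarrow> p \<in> S t \<Longrightarrow>
      smooth_map_family_at T A S N f t p"
  shows "smooth_map_family T A S N R f"
proof -
  let ?X = "subtopology (prod_topology T (mtop A)) (total_space T S)"
  have cont: "continuous_map ?X (mtop N) (\<lambda>(t, p). f t p)"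
  proof (rule continuous_map_locally)
    fix z assume "z \<in> topspace ?X"
    then have "z \<in> total_space T S" using topspace_total[OF A] by simp
    then obtain t p where z: "z = (t, p)" "t \<in> topspace T" "p \<in> S t" by (auto simp: total_space_def)
    from loc[OF z(2,3)] obtain D \<phi> D' \<psi> W r where l: "(D, \<phi>) \<in> atlas A" "(D', \<psi>) \<in> atlas N" "p \<in> D"
      "(t, \<phi> p) \<in> W" "smooth_family T W r"
      "\<And>t' p'. t' \<in> topspace T \<Longrightarrow> p' \<in> D \<Longrightarrow> p' \<in> S t' \<Longrightarrow> (t', \<phi> p') \<in> W \<Longrightarrow>
           f t' p' \<in> D' \<and> \<psi> (f t' p') = r t' (\<phi> p')"
      unfolding smooth_map_family_at_def by blast
    let ?G = "{(t, p) \<in> total_space T S. p \<in> D \<and> (t, \<phi> p) \<in> W}"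
    have G: "openin ?X ?G" by (rule mf_chart_nbhd[OF A l(1) smooth_family_openin[OF l(5)]])
    have "subtopology (subtopology ?X {(t, p) \<in> total_space T S. p \<in> D}) ?G = subtopology ?X ?G"
      by (simp add: subtopology_subtopology) (rule arg_cong2[where f = subtopology], auto)
    then have 1: "continuous_map (subtopology ?X ?G) (subtopology (prod_topology T euclidean) W) (\<lambda>(t, p). (t, \<phi> p))"
      using continuous_map_from_subtopology[OF mf_chart_continuous[OF A l(1)], of ?G]
      by (auto simp: continuous_map_in_subtopology)
    have "continuous_map (subtopology ?X ?G) euclidean ((\<lambda>(t, u). r t u) \<circ> (\<lambda>(t, p). (t, \<phi> p)))"
      using smooth_family_cont[OF l(5)] unfolding cont_family_def by (rule continuous_map_compose[OF 1])
    moreover have "continuous_map (subtopology ?X ?G) T fst"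
      by (simp add: continuous_map_subtopology_fst subtopology_subtopology)
    ultimately have "continuous_map (subtopology ?X ?G) (prod_topology T euclidean)
         (\<lambda>z. (fst z, ((\<lambda>(t, u). r t u) \<circ> (\<lambda>(t, p). (t, \<phi> p))) z))"
      by (intro continuous_map_pairedI)
    moreover have "(fst z, ((\<lambda>(t, u). r t u) \<circ> (\<lambda>(t, p). (t, \<phi> p))) z) \<in> chart_image T R D' \<psi>" if "z \<in> ?G" for z
    proof -
      obtain t p where z: "z = (t, p)" "t \<in> topspace T" "p \<in> S t" "p \<in> D" "(t, \<phi> p) \<in> W"
        using \<open>z \<in> ?G\<close> by (auto simp: total_space_def)
      then have "r t (\<phi> p) = \<psi> (f t p)" "f t p \<in> D' \<inter> R t" using l(6)[of t p] maps by auto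
      then show ?thesis using z by (auto simp: chart_image_def)
    qed
    ultimately have 2: "continuous_map (subtopology ?X ?G) (subtopology (prod_topology T euclidean) (chart_image T R D' \<psi>))
         (\<lambda>z. (fst z, ((\<lambda>(t, u). r t u) \<circ> (\<lambda>(t, p). (t, \<phi> p))) z))"
      by (auto simp: continuous_map_in_subtopology)
    have "continuous_map (subtopology (prod_topology T euclidean) (chart_image T R D' \<psi>)) (mtop N)
       (\<lambda>(t, u). inv_into (D' \<inter> R t) \<psi> u)"
      using mf_chart[OF N l(2)] by (simp add: family_chart_def)
    from continuous_map_compose[OF 2 this]
    have "continuous_map (subtopology ?X ?G) (mtop N) (\<lambda>(t, p). f t p)"
    proof (rule continuous_map_eq)
      fix z assume "z \<in> topspace (subtopology ?X ?G)"
      then obtain t p where z: "z = (t, p)" "t \<in> topspace T" "p \<in> S t" "p \<in> D" "(t, \<phi> p) \<in> W"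
        by (auto simp: total_space_def)
      then have "r t (\<phi> p) = \<psi> (f t p)" "f t p \<in> D'" "f t p \<in> R t" using l(6)[of t p] maps by auto
      then show "((\<lambda>(t, u). inv_into (D' \<inter> R t) \<psi> u) \<circ> (\<lambda>z. (fst z, ((\<lambda>(t, u). r t u) \<circ> (\<lambda>(t, p). (t, \<phi> p))) z))) z
         = (\<lambda>(t, p). f t p) z"
        using mf_inv[OF N l(2) z(2)] z(1) by simp
    qed
    with G z l show "\<exists>G. openin ?X G \<and> z \<in> G \<and> continuous_map (subtopology ?X G) (mtop N) (\<lambda>(t, p). f t p)"
      by (intro exI[of _ ?G]) (auto simp: total_space_def)
  qed
  moreover have "smooth_family T (chart_image T (\<lambda>t. {p \<in> S t. f t p \<in> D1'}) D1 \<phi>1) (\<lambda>t. \<psi>1 \<circ> f t \<circ> inv_into (D1 \<inter> S t) \<phi>1)"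
    if c: "(D1, \<phi>1) \<in> atlas A" "(D1', \<psi>1) \<in> atlas N" for D1 \<phi>1 D1' \<psi>1
  proof (rule smooth_family_local)
    \<comment> \<open>Openness of the domain rests on the continuity just obtained.\<close>
    have "openin (mtop N) D1'" using mf_chart[OF N c(2)] by (simp add: family_chart_def)
    with cont c(1) show "openin (prod_topology T euclidean) (chart_image T (\<lambda>t. {p \<in> S t. f t p \<in> D1'}) D1 \<phi>1)"
      by (rule mf_openin_preimage[OF A])
  next
    fix z assume "z \<in> chart_image T (\<lambda>t. {p \<in> S t. f t p \<in> D1'}) D1 \<phi>1"
    then obtain t p where z: "z = (t, \<phi>1 p)" "t \<in> topspace T" "p \<in> D1" "p \<in> S t" "f t p \<in> D1'"
      by (auto simp: chart_image_def)
    from loc[OF z(2,4)] obtain D \<phi> D' \<psi> W r where l: "(D, \<phi>) \<in> atlas A" "(D', \<psi>) \<in> atlas N" "p \<in> D"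
      "(t, \<phi> p) \<in> W" "smooth_family T W r"
      "\<And>t' p'. t' \<in> topspace T \<Longrightarrow> p' \<in> D \<Longrightarrow> p' \<in> S t' \<Longrightarrow> (t', \<phi> p') \<in> W \<Longrightarrow>
           f t' p' \<in> D' \<and> \<psi> (f t' p') = r t' (\<phi> p')"
      unfolding smooth_map_family_at_def by blast
    note a = mf_transition[OF A c(1) l(1)] and b = mf_transition[OF N l(2) c(2)]
    note rb = smooth_family_compose[OF mf_finite_dim[OF N] l(5) b]
    note arb = smooth_family_compose[OF mf_finite_dim[OF A] a rb]
    let ?W = "{(t, u). (t, u) \<in> chart_image T (\<lambda>t. D \<inter> S t) D1 \<phi>1 \<and>
       (t, (\<phi> \<circ> inv_into (D1 \<inter> S t) \<phi>1) u) \<in> {(t, u). (t, u) \<in> W \<and> (t, r t u) \<in> chart_image T (\<lambda>t. D1' \<inter> R t) D' \<psi>}}"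
    have "smooth_family T ?W (\<lambda>t. \<psi>1 \<circ> f t \<circ> inv_into (D1 \<inter> S t) \<phi>1)"
    proof (rule smooth_family_cong[OF arb])
      fix t u assume tu: "(t, u) \<in> ?W"
      then obtain p where p: "u = \<phi>1 p" "t \<in> topspace T" "p \<in> D1" "p \<in> S t" "p \<in> D"
        by (auto simp: chart_image_def)
      then have "inv_into (D1 \<inter> S t) \<phi>1 u = p" using mf_inv[OF A c(1)] by simp
      moreover from this tu have "(t, \<phi> p) \<in> W" by simp
      ultimately show "(\<psi>1 \<circ> inv_into (D' \<inter> R t) \<psi>) (r t ((\<phi> \<circ> inv_into (D1 \<inter> S t) \<phi>1) u)) =
         (\<psi>1 \<circ> f t \<circ> inv_into (D1 \<inter> S t) \<phi>1) u"
        using l(6)[OF p(2,5,4)] mf_inv[OF N l(2) p(2), of "f t p"] maps[OF p(2,4)] by simp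
    qed
    moreover have "z \<in> ?W"
    proof -
      have i: "inv_into (D1 \<inter> S t) \<phi>1 (\<phi>1 p) = p" using mf_inv[OF A c(1)] z by simp
      have "(t, \<phi>1 p) \<in> chart_image T (\<lambda>t. D \<inter> S t) D1 \<phi>1" using z l by (auto simp: chart_image_def)
      moreover have "(t, \<psi> (f t p)) \<in> chart_image T (\<lambda>t. D1' \<inter> R t) D' \<psi>"
        unfolding chart_image_def using z l(6)[OF z(2) l(3) z(4) l(4)] maps[OF z(2,4)] by blast
      ultimately show ?thesis using l(4) l(6)[OF z(2) l(3) z(4) l(4)] i z(1) by simp
    qed
    ultimately show "\<exists>W'. z \<in> W' \<and> smooth_family T W' (\<lambda>t. \<psi>1 \<circ> f t \<circ> inv_into (D1 \<inter> S t) \<phi>1)"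
      by (intro exI[of _ ?W] conjI)
  qed
  ultimately show ?thesis unfolding smooth_map_family_def using maps by blast
qed

lemma smf_maps: "smooth_map_family T A S N R f \<Longrightarrow> t \<in> topspace T \<Longrightarrow> p \<in> S t \<Longrightarrow> f t p \<in> R t"
  by (simp add: smooth_map_family_def)

lemma smf_continuous:
  "smooth_map_family T A S N R f \<Longrightarrow>
    continuous_map (subtopology (prod_topology T (mtop A)) (total_space T S)) (mtop N) (\<lambda>(t, p). f t p)"
  by (simp add: smooth_map_family_def)

lemma smf_smooth:
  "smooth_map_family T A S N R f \<Longrightarrow> (D, \<phi>) \<in> atlas A \<Longrightarrow> (D', \<psi>) \<in> atlas N \<Longrightarrow>
    smooth_family T (chart_image T (\<lambda>t. {p \<in> S t. f t p \<in> D'}) D \<phi>) (\<lambda>t. \<psi> \<circ> f t \<circ> inv_into (D \<inter> S t) \<phi>)"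
  unfolding smooth_map_family_def by blast

text \<open>A middle chart is chosen around \<open>f t p\<close>; the domain of the composite keeps
  only the points that \<open>f\<close> still sends into it, and on that domain the inverse of the
  middle chart cancels.\<close>

lemma smooth_map_family_compose:
  assumes A: "manifold_family T A S" and N: "manifold_family T N R" and Q: "manifold_family T Q P"
    and f: "smooth_map_family T A S N R f" and g: "smooth_map_family T N R Q P g"
  shows "smooth_map_family T A S Q P (\<lambda>t p. g t (f t p))"
proof (rule smooth_map_familyI[OF A Q])
  fix t p assume t: "t \<in> topspace T" "p \<in> S t"
  note f' = smf_maps[OF f] and g' = smf_maps[OF g]
  show "g t (f t p) \<in> P t" using t f' g' by blast
  obtain D \<phi> where D: "(D, \<phi>) \<in> atlas A" "p \<in> D" using mf_cover[OF A t] .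
  obtain D1 \<phi>1 where D1: "(D1, \<phi>1) \<in> atlas N" "f t p \<in> D1" using mf_cover[OF N t(1) f'[OF t]] .
  obtain D2 \<phi>2 where D2: "(D2, \<phi>2) \<in> atlas Q" "g t (f t p) \<in> D2" using mf_cover[OF Q t(1) g'[OF t(1) f'[OF t]]] .
  note sf = smf_smooth[OF f D(1) D1(1)] and sg = smf_smooth[OF g D1(1) D2(1)]
  note sfg = smooth_family_compose[OF mf_finite_dim[OF N] sf sg]
  let ?W = "{(t, u). (t, u) \<in> chart_image T (\<lambda>t. {p \<in> S t. f t p \<in> D1}) D \<phi> \<and>
      (t, (\<phi>1 \<circ> f t \<circ> inv_into (D \<inter> S t) \<phi>) u) \<in> chart_image T (\<lambda>t. {p \<in> R t. g t p \<in> D2}) D1 \<phi>1}"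
  let ?r = "\<lambda>t u. (\<phi>2 \<circ> g t \<circ> inv_into (D1 \<inter> R t) \<phi>1) ((\<phi>1 \<circ> f t \<circ> inv_into (D \<inter> S t) \<phi>) u)"
  have "(t, \<phi> p) \<in> ?W"
  proof -
    have "(t, \<phi> p) \<in> chart_image T (\<lambda>t. {p \<in> S t. f t p \<in> D1}) D \<phi>"
      using t D D1 by (auto simp: chart_image_def)
    moreover have "(t, \<phi>1 (f t p)) \<in> chart_image T (\<lambda>t. {p \<in> R t. g t p \<in> D2}) D1 \<phi>1"
      using t D1 D2 f' by (auto simp: chart_image_def)
    ultimately show ?thesis using mf_inv[OF A D(1) t(1) D(2) t(2)] by simp
  qed
  moreover have "g t' (f t' p') \<in> D2 \<and> \<phi>2 (g t' (f t' p')) = ?r t' (\<phi> p')"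
    if "t' \<in> topspace T" "p' \<in> D" "p' \<in> S t'" "(t', \<phi> p') \<in> ?W" for t' p'
  proof -
    have i: "inv_into (D \<inter> S t') \<phi> (\<phi> p') = p'" using mf_inv[OF A D(1)] that by simp
    from that(4) have "(t', \<phi> p') \<in> chart_image T (\<lambda>t. {p \<in> S t. f t p \<in> D1}) D \<phi>" by simp
    then have fD1: "f t' p' \<in> D1"
      using mf_chart_image_iff[OF A D(1) that(1-3), of "\<lambda>t. {p \<in> S t. f t p \<in> D1}"] by simp
    then have i1: "inv_into (D1 \<inter> R t') \<phi>1 (\<phi>1 (f t' p')) = f t' p'"
      using mf_inv[OF N D1(1) that(1)] f' that by simp
    from that(4) i have "(t', \<phi>1 (f t' p')) \<in> chart_image T (\<lambda>t. {p \<in> R t. g t p \<in> D2}) D1 \<phi>1" by simp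
    then have "g t' (f t' p') \<in> D2"
      using mf_chart_image_iff[OF N D1(1) that(1) fD1 f'[OF that(1,3)], of "\<lambda>t. {p \<in> R t. g t p \<in> D2}"] by simp
    with i i1 show ?thesis by simp
  qed
  ultimately show "smooth_map_family_at T A S Q (\<lambda>t p. g t (f t p)) t p"
    by (rule smooth_map_family_atI[OF D(1) D2(1) D(2) _ sfg])
qed

text \<open>Agreement is asked for on the total space only, and for the target sets only over
  \<open>topspace T\<close>. This allows \<open>inv_into\<close> to replace an explicit inverse, and
  a constant set to replace a family.\<close>

lemma smooth_map_family_cong:
  assumes A: "manifold_family T A S" and f: "smooth_map_family T A S N R f"
    and eq: "\<And>t p. t \<in> topspace T \<Longrightarrow> p \<in> S t \<Longrightarrow> f t p = g t p"
    and R: "\<And>t. t \<in> topspace T \<Longrightarrow> R t = R' t"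
  shows "smooth_map_family T A S N R' g"
proof -
  have "g t p \<in> R' t" if "t \<in> topspace T" "p \<in> S t" for t p
    using smf_maps[OF f that] eq[OF that] R[OF that(1)] by simp
  moreover have "continuous_map (subtopology (prod_topology T (mtop A)) (total_space T S)) (mtop N) (\<lambda>(t, p). g t p)"
    by (rule continuous_map_eq[OF smf_continuous[OF f]])
      (use eq in \<open>auto simp: total_space_def\<close>)
  moreover have "smooth_family T (chart_image T (\<lambda>t. {p \<in> S t. g t p \<in> D'}) D \<phi>) (\<lambda>t. \<psi> \<circ> g t \<circ> inv_into (D \<inter> S t) \<phi>)"
    if c: "(D, \<phi>) \<in> atlas A" "(D', \<psi>) \<in> atlas N" for D \<phi> D' \<psi>
  proof -
    have "chart_image T (\<lambda>t. {p \<in> S t. g t p \<in> D'}) D \<phi> = chart_image T (\<lambda>t. {p \<in> S t. f t p \<in> D'}) D \<phi>"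
      unfolding chart_image_def by (intro Collect_cong ex_cong1) (use eq in auto)
    moreover have "smooth_family T (chart_image T (\<lambda>t. {p \<in> S t. f t p \<in> D'}) D \<phi>) (\<lambda>t. \<psi> \<circ> g t \<circ> inv_into (D \<inter> S t) \<phi>)"
      by (rule smooth_family_cong[OF smf_smooth[OF f c]])
        (use eq mf_inv[OF A c(1)] in \<open>auto simp: chart_image_def\<close>)
    ultimately show ?thesis by simp
  qed
  ultimately show ?thesis unfolding smooth_map_family_def by (auto split: prod.splits)
qed

lemma smooth_map_family_id:
  assumes A: "manifold_family T A S"
  shows "smooth_map_family T A S A S (\<lambda>t p. p)"
proof (rule smooth_map_familyI[OF A A])
  fix t p assume t: "t \<in> topspace T" "p \<in> S t"
  obtain D \<phi> where D: "(D, \<phi>) \<in> atlas A" "p \<in> D" using mf_cover[OF A t] .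
  have oW: "openin (prod_topology T euclidean) (chart_image T S D \<phi>)"
    using mf_chart[OF A D(1)] by (simp add: family_chart_def)
  show "smooth_map_family_at T A S A (\<lambda>t p. p) t p"
    by (rule smooth_map_family_atI[OF D(1) D(1) D(2) _ smooth_family_ident[OF oW]])
      (use t D in \<open>auto simp: chart_image_def\<close>)
qed

section \<open>A single smooth manifold as a constant family\<close>

context
  fixes M :: "('a, 'm::real_inner) manifold"
  assumes M: "smooth_manifold M"
begin

lemma sm_finite_dim: "finite_dim TYPE('m)"
  using M by (simp add: smooth_manifold_def finite_dim_def)

lemma sm_cover:
  assumes "p \<in> points M"
  obtains D \<phi> where "(D, \<phi>) \<in> atlas M" "p \<in> D"
proof -
  have "p \<in> (\<Union>(D, \<phi>)\<in>atlas M. D)" using M assms by (simp add: smooth_manifold_def)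
  then show thesis using that by blast
qed

context
  fixes D \<phi> assumes D: "(D, \<phi>) \<in> atlas M"
begin

lemma sm_openin: "openin (mtop M) D" and sm_open_image: "open (\<phi> ` D)"
  and sm_homeomorphic: "homeomorphic_map (subtopology (mtop M) D) (top_of_set (\<phi> ` D)) \<phi>"
  using M D unfolding smooth_manifold_def by blast+

lemma sm_subset: "D \<subseteq> points M"
  using sm_openin by (rule openin_subset)

lemma sm_Int_points [simp]: "D \<inter> points M = D"
  using sm_subset by blast

lemma sm_continuous: "continuous_map (subtopology (mtop M) D) euclidean \<phi>"
  using homeomorphic_imp_continuous_map[OF sm_homeomorphic] by (simp add: continuous_map_in_subtopology)

lemma sm_inj: "inj_on \<phi> D"
  using homeomorphic_imp_injective_map[OF sm_homeomorphic] sm_subset by (simp add: Int_absorb1)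

lemma sm_inv: "p \<in> D \<Longrightarrow> inv_into D \<phi> (\<phi> p) = p"
  using sm_inj by simp

lemma sm_inv_continuous: "continuous_map (top_of_set (\<phi> ` D)) (subtopology (mtop M) D) (inv_into D \<phi>)"
proof -
  obtain g where g: "homeomorphic_maps (subtopology (mtop M) D) (top_of_set (\<phi> ` D)) \<phi> g"
    using sm_homeomorphic homeomorphic_map_maps by blast
  show ?thesis
  proof (rule continuous_map_eq)
    show "continuous_map (top_of_set (\<phi> ` D)) (subtopology (mtop M) D) g"
      using g by (simp add: homeomorphic_maps_def)
    show "g u = inv_into D \<phi> u" if "u \<in> topspace (top_of_set (\<phi> ` D))" for u
      using that g sm_inv sm_subset by (auto simp: homeomorphic_maps_def)
  qed
qed

lemma sm_open_image_subset:
  assumes "openin (mtop M) G" "G \<subseteq> D"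
  shows "open (\<phi> ` G)"
proof -
  have "openin (subtopology (mtop M) D) G" using assms sm_openin by (simp add: openin_open_subtopology)
  then have "openin (top_of_set (\<phi> ` D)) (\<phi> ` G)"
    using homeomorphic_imp_open_map[OF sm_homeomorphic] by (simp add: open_map_def)
  then show ?thesis using sm_open_image openin_open_trans by blast
qed

lemma sm_openin_preimage:
  assumes "open B"
  shows "openin (mtop M) {p \<in> D. \<phi> p \<in> B}"
proof -
  have "openin (subtopology (mtop M) D) {p \<in> topspace (subtopology (mtop M) D). \<phi> p \<in> B}"
    using openin_continuous_map_preimage[OF sm_continuous] assms by simp
  then show ?thesis using sm_openin sm_subset by (auto simp: openin_open_subtopology Int_absorb1)
qed

lemma sm_family_chart:
  "family_chart T M (\<lambda>_. points M) D \<phi>" "chart_image T (\<lambda>_. points M) D \<phi> = topspace T \<times> \<phi> ` D"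
proof -
  let ?W = "topspace T \<times> \<phi> ` D"
  have W: "openin (prod_topology T euclidean) ?W" by (rule openin_topspace_Times[OF sm_open_image])
  have "continuous_map (subtopology (prod_topology T euclidean) ?W) (top_of_set (\<phi> ` D)) snd"
    by (auto simp: continuous_map_in_subtopology continuous_map_subtopology_snd)
  from continuous_map_compose[OF this sm_inv_continuous]
  have "continuous_map (subtopology (prod_topology T euclidean) ?W) (mtop M) (inv_into D \<phi> \<circ> snd)"
    by (simp add: continuous_map_in_subtopology)
  then have c: "continuous_map (subtopology (prod_topology T euclidean) ?W) (mtop M) (\<lambda>(t, u). inv_into D \<phi> u)"
    by (simp add: o_def case_prod_unfold)
  show "family_chart T M (\<lambda>_. points M) D \<phi>"
    by (rule family_chartI(1)[where j = "\<lambda>t. inv_into D \<phi>", OF sm_openin sm_continuous W _ _ c])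
      (auto simp: sm_inv f_inv_into_f dest: inv_into_into sm_subset[THEN subsetD])
  show "chart_image T (\<lambda>_. points M) D \<phi> = ?W"
    by (rule family_chartI(2)[where j = "\<lambda>t. inv_into D \<phi>", OF sm_openin sm_continuous W _ _ c])
      (auto simp: sm_inv f_inv_into_f dest: inv_into_into sm_subset[THEN subsetD])
qed

end

lemma sm_transition:
  assumes "(D, \<phi>) \<in> atlas M" "(D', \<phi>') \<in> atlas M"
  shows "smooth_on (\<phi> ` (D \<inter> D')) (\<phi>' \<circ> inv_into D \<phi>)"
  using M assms unfolding smooth_manifold_def by fast

lemma manifold_family_const: "manifold_family T M (\<lambda>_. points M)"
proof -
  have "smooth_family T (chart_image T (\<lambda>t. D' \<inter> points M) D \<phi>) (\<lambda>t. \<phi>' \<circ> inv_into (D \<inter> points M) \<phi>)"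
    if z: "(D, \<phi>) \<in> atlas M" "(D', \<phi>') \<in> atlas M" for D \<phi> D' \<phi>'
  proof -
    have "open (\<phi> ` (D \<inter> D'))"
      using z sm_openin by (intro sm_open_image_subset[of D]) auto
    moreover have "smooth_on (\<phi> ` (D \<inter> D')) (\<phi>' \<circ> inv_into D \<phi>)"
      using z by (rule sm_transition)
    ultimately have "smooth_family T (topspace T \<times> \<phi> ` (D \<inter> D')) (\<lambda>t. \<phi>' \<circ> inv_into D \<phi>)"
      by (rule smooth_family_const_param)
    moreover have "chart_image T (\<lambda>t. D' \<inter> points M) D \<phi> = topspace T \<times> \<phi> ` (D \<inter> D')"
      using sm_subset[OF z(2)] by (auto simp: chart_image_def)
    ultimately show ?thesis using z by simp
  qed
  moreover have "\<exists>(D, \<phi>)\<in>atlas M. p \<in> D" if "p \<in> points M" for p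
    using sm_cover[OF that] by blast
  ultimately show ?thesis
    unfolding manifold_family_def using sm_finite_dim sm_family_chart(1) by (auto split: prod.splits)
qed

end

lemma smooth_map_family_const:
  assumes M: "smooth_manifold M" and N: "smooth_manifold N" and f: "smooth_map M N f"
  shows "smooth_map_family T M (\<lambda>_. points M) N (\<lambda>_. points N) (\<lambda>_. f)"
proof -
  have cont: "continuous_map (mtop M) (mtop N) f" using f by (simp add: smooth_map_def)
  have "continuous_map (subtopology (prod_topology T (mtop M)) (total_space T (\<lambda>_. points M))) (mtop M) snd"
    by (simp add: continuous_map_subtopology_snd)
  from continuous_map_compose[OF this cont]
  have "continuous_map (subtopology (prod_topology T (mtop M)) (total_space T (\<lambda>_. points M))) (mtop N) (\<lambda>(t, p). f p)"
    by (simp add: o_def case_prod_unfold)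
  moreover have "f p \<in> points N" if "p \<in> points M" for p
    using cont that by (auto simp: continuous_map_def)
  moreover have "smooth_family T (chart_image T (\<lambda>_. {p \<in> points M. f p \<in> D'}) D \<phi>) (\<lambda>t. \<psi> \<circ> f \<circ> inv_into (D \<inter> points M) \<phi>)"
    if c: "(D, \<phi>) \<in> atlas M" "(D', \<psi>) \<in> atlas N" for D \<phi> D' \<psi>
  proof -
    let ?G = "{p \<in> D. f p \<in> D'}"
    have "openin (mtop M) {p \<in> points M. f p \<in> D'}"
      by (rule openin_continuous_map_preimage[OF cont sm_openin[OF N c(2)]])
    from openin_Int[OF sm_openin[OF M c(1)] this]
    have "openin (mtop M) (D \<inter> {p \<in> points M. f p \<in> D'})" .
    moreover have "D \<inter> {p \<in> points M. f p \<in> D'} = ?G" using sm_subset[OF M c(1)] by auto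
    ultimately have "open (\<phi> ` ?G)" by (intro sm_open_image_subset[OF M c(1)]) auto
    moreover have "smooth_on (\<phi> ` ?G) (\<psi> \<circ> f \<circ> inv_into D \<phi>)"
      using f c unfolding smooth_map_def by fast
    ultimately have "smooth_family T (topspace T \<times> \<phi> ` ?G) (\<lambda>t. \<psi> \<circ> f \<circ> inv_into D \<phi>)"
      by (rule smooth_family_const_param)
    moreover have "chart_image T (\<lambda>_. {p \<in> points M. f p \<in> D'}) D \<phi> = topspace T \<times> \<phi> ` ?G"
      using sm_subset[OF M c(1)] by (auto simp: chart_image_def)
    ultimately show ?thesis using sm_Int_points[OF M c(1)] by simp
  qed
  ultimately show ?thesis unfolding smooth_map_family_def by (auto split: prod.splits)
qed

section \<open>Shrinking the parameter space, slices, and the link with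
  \<open>continuous_family\<close>\<close>

lemma smooth_map_family_restrict_param:
  assumes f: "smooth_map_family T A S N R f"
  shows "smooth_map_family (subtopology T T') A S N R f"
proof -
  have "smooth_family (subtopology T T') (chart_image (subtopology T T') (\<lambda>t. {p \<in> S t. f t p \<in> D'}) D \<phi>)
      (\<lambda>t. \<psi> \<circ> f t \<circ> inv_into (D \<inter> S t) \<phi>)"
    if c: "(D, \<phi>) \<in> atlas A" "(D', \<psi>) \<in> atlas N" for D \<phi> D' \<psi>
  proof -
    have "chart_image (subtopology T T') (\<lambda>t. {p \<in> S t. f t p \<in> D'}) D \<phi>
        = chart_image T (\<lambda>t. {p \<in> S t. f t p \<in> D'}) D \<phi> \<inter> T' \<times> UNIV"
      by (auto simp: chart_image_def)
    then show ?thesis using smooth_family_restrict_param[OF smf_smooth[OF f c], of T'] by simp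
  qed
  moreover have "continuous_map (subtopology (prod_topology (subtopology T T') (mtop A)) (total_space (subtopology T T') S))
      (mtop N) (\<lambda>(t, p). f t p)"
  proof -
    have "prod_topology (subtopology T T') (mtop A) = subtopology (prod_topology T (mtop A)) (T' \<times> points A)"
      using prod_topology_subtopology(1) by blast
    then show ?thesis
      using smf_continuous[OF f]
      by (simp add: subtopology_subtopology)
        (rule continuous_map_from_subtopology_mono, auto simp: total_space_def)
  qed
  ultimately show ?thesis
    unfolding smooth_map_family_def using smf_maps[OF f] by (auto split: prod.splits)
qed

lemma smooth_map_family_slice:
  assumes A: "manifold_family T A S" and f: "smooth_map_family T A S N R f" and t: "t \<in> topspace T"
  shows "smooth_map (restrict_to A (S t)) (restrict_to N (R t)) (f t)"
proof -
  have "continuous_map (subtopology (mtop A) (S t)) (subtopology (prod_topology T (mtop A)) (total_space T S)) (\<lambda>p. (t, p))"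
    using t by (auto simp: continuous_map_in_subtopology continuous_map_pairedI total_space_def continuous_map_from_subtopology)
  from continuous_map_compose[OF this smf_continuous[OF f]]
  have "continuous_map (subtopology (mtop A) (S t)) (mtop N) (f t)" by (simp add: o_def)
  then have "continuous_map (subtopology (mtop A) (S t)) (subtopology (mtop N) (R t)) (f t)"
    using smf_maps[OF f t] by (auto simp: continuous_map_in_subtopology)
  moreover have "smooth_on (\<phi> ` {p \<in> D \<inter> S t. f t p \<in> D' \<inter> R t}) (\<psi> \<circ> f t \<circ> inv_into (D \<inter> S t) \<phi>)"
    if c: "(D, \<phi>) \<in> atlas A" "(D', \<psi>) \<in> atlas N" for D \<phi> D' \<psi>
  proof -
    have "{u. (t, u) \<in> chart_image T (\<lambda>t. {p \<in> S t. f t p \<in> D'}) D \<phi>} = \<phi> ` {p \<in> D \<inter> S t. f t p \<in> D' \<inter> R t}"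
      using t smf_maps[OF f t] by (auto simp: chart_image_def)
    then show ?thesis using smooth_family_smooth_on[OF smf_smooth[OF f c], of t] by simp
  qed
  ultimately show ?thesis
    unfolding smooth_map_def restrict_to_def by auto
qed

text \<open>The charts of \<open>restrict_to N R\<close> have smaller domains than those of
  \<open>N\<close>, but \<open>f t\<close> takes values in \<open>R\<close>, so the maps read in
  charts keep their domains.\<close>

lemma smooth_map_family_imp_continuous_family:
  assumes A: "manifold_family T A S" and f: "smooth_map_family T A S N (\<lambda>_. R) f"
  shows "continuous_family T A S (restrict_to N R) f"
proof -
  have "smooth_map (restrict_to A (S t)) (restrict_to N R) (f t)" if "t \<in> topspace T" for t
    by (rule smooth_map_family_slice[OF A f that])
  moreover have "continuous_map (subtopology (prod_topology T (mtop A)) {(t, p). t \<in> topspace T \<and> p \<in> S t})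
     (mtop (restrict_to N R)) (\<lambda>(t, p). f t p)"
    using smf_continuous[OF f] smf_maps[OF f]
    by (auto simp: restrict_to_def continuous_map_in_subtopology total_space_def)
  moreover have "continuous_map
          (subtopology (prod_topology T euclidean)
             {(t, \<phi> p) | t p. t \<in> topspace T \<and> p \<in> D \<inter> S t \<and> f t p \<in> D1})
          euclidean
          (\<lambda>(t, u). dderivs hs (\<psi> \<circ> f t \<circ> inv_into (D \<inter> S t) \<phi>) u)"
    if c: "(D, \<phi>) \<in> atlas A" "(D1, \<psi>) \<in> atlas (restrict_to N R)" for D \<phi> D1 \<psi> hs
  proof -
    obtain D' where D': "D1 = D' \<inter> R" "(D', \<psi>) \<in> atlas N" using c by (auto simp: restrict_to_def)
    have eq: "{(t, \<phi> p) | t p. t \<in> topspace T \<and> p \<in> D \<inter> S t \<and> f t p \<in> D1}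
       = chart_image T (\<lambda>t. {p \<in> S t. f t p \<in> D'}) D \<phi>"
      using smf_maps[OF f] by (auto simp: chart_image_def D')
    have "smooth_family T (chart_image T (\<lambda>t. {p \<in> S t. f t p \<in> D'}) D \<phi>) (\<lambda>t. \<psi> \<circ> f t \<circ> inv_into (D \<inter> S t) \<phi>)"
      by (rule smf_smooth[OF f c(1) D'(2)])
    then show ?thesis
      unfolding eq smooth_family_def cont_family_def by blast
  qed
  ultimately show ?thesis unfolding continuous_family_def by fast
qed

text \<open>The last clause of \<open>continuous_family\<close> records continuity of the
  derivatives, but neither their existence nor openness of the domains. Existence comes from the
  smoothness of each single \<open>f t\<close>, openness from joint continuity.\<close>

lemma continuous_family_imp_smooth_map_family:
  assumes A: "manifold_family T A S" and N: "smooth_manifold N" and f: "continuous_family T A S N f"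
  shows "smooth_map_family T A S N (\<lambda>_. points N) f"
proof -
  have sl: "smooth_map (restrict_to A (S t)) N (f t)" if "t \<in> topspace T" for t
    using f that unfolding continuous_family_def by blast
  have cont: "continuous_map (subtopology (prod_topology T (mtop A)) (total_space T S)) (mtop N) (\<lambda>(t, p). f t p)"
    using f unfolding continuous_family_def total_space_def by blast
  have "f t p \<in> points N" if "t \<in> topspace T" "p \<in> S t" for t p
    using sl[OF that(1)] that mf_subset[OF A] by (auto simp: smooth_map_def restrict_to_def continuous_map_def)
  moreover have "smooth_family T (chart_image T (\<lambda>t. {p \<in> S t. f t p \<in> D'}) D \<phi>) (\<lambda>t. \<psi> \<circ> f t \<circ> inv_into (D \<inter> S t) \<phi>)"
    if c: "(D, \<phi>) \<in> atlas A" "(D', \<psi>) \<in> atlas N" for D \<phi> D' \<psi>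
  proof -
    let ?W = "chart_image T (\<lambda>t. {p \<in> S t. f t p \<in> D'}) D \<phi>"
    have W: "openin (prod_topology T euclidean) ?W"
      by (rule mf_openin_preimage[OF A cont c(1) sm_openin[OF N c(2)]])
    have eq: "{(t, \<phi> p) | t p. t \<in> topspace T \<and> p \<in> D \<inter> S t \<and> f t p \<in> D'} = ?W"
      by (auto simp: chart_image_def)
    have "\<forall>hs. continuous_map
          (subtopology (prod_topology T euclidean)
             {(t, \<phi> p) | t p. t \<in> topspace T \<and> p \<in> D \<inter> S t \<and> f t p \<in> D'})
          euclidean
          (\<lambda>(t, u). dderivs hs (\<psi> \<circ> f t \<circ> inv_into (D \<inter> S t) \<phi>) u)"
      using f c unfolding continuous_family_def by fast
    moreover have "dderivs hs (\<psi> \<circ> f t \<circ> inv_into (D \<inter> S t) \<phi>) differentiable at u" if tu: "(t, u) \<in> ?W" for t u hs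
    proof -
      obtain p where p: "u = \<phi> p" "t \<in> topspace T" "p \<in> D \<inter> S t" "f t p \<in> D'"
        using tu by (auto simp: chart_image_def)
      have "(D \<inter> S t, \<phi>) \<in> atlas (restrict_to A (S t))" using c by (force simp: restrict_to_def)
      then have "smooth_on (\<phi> ` {p \<in> D \<inter> S t. f t p \<in> D'}) (\<psi> \<circ> f t \<circ> inv_into (D \<inter> S t) \<phi>)"
        using sl[OF p(2)] c(2) unfolding smooth_map_def by fast
      then show ?thesis using p unfolding smooth_on_def by blast
    qed
    ultimately show ?thesis unfolding smooth_family_def cont_family_def eq using W by blast
  qed
  ultimately show ?thesis unfolding smooth_map_family_def using cont by (auto split: prod.splits)
qed

text \<open>The inverse chart carries the compact ball into the manifold; the ball has to lie inside
  the image of the chart, so that no part of it is cut off.\<close>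

lemma compactin_chart_cball:
  assumes M: "smooth_manifold M" and D: "(D, \<phi>) \<in> atlas M" and sub: "cball c r \<subseteq> \<phi> ` D"
  shows "compactin (mtop M) {x \<in> D. \<phi> x \<in> cball c r}"
proof -
  have "compactin (top_of_set (\<phi> ` D)) (cball c r)"
    using sub compact_cball_finite_dim[OF sm_finite_dim[OF M], of c r] by (simp add: compactin_subtopology)
  from image_compactin[OF this sm_inv_continuous[OF M D]]
  have "compactin (mtop M) (inv_into D \<phi> ` cball c r)" by (simp add: compactin_subtopology)
  moreover have "inv_into D \<phi> ` cball c r = {x \<in> D. \<phi> x \<in> cball c r}"
  proof (intro equalityI subsetI)
    fix x assume "x \<in> inv_into D \<phi> ` cball c r"
    then show "x \<in> {x \<in> D. \<phi> x \<in> cball c r}"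
      using sub by (auto simp: f_inv_into_f subset_iff intro: inv_into_into)
  next
    fix x assume x: "x \<in> {x \<in> D. \<phi> x \<in> cball c r}"
    show "x \<in> inv_into D \<phi> ` cball c r"
      by (rule image_eqI[of _ _ "\<phi> x"]) (use x sm_inv[OF M D] in auto)
  qed
  ultimately show ?thesis by simp
qed

section \<open>Local trivializations\<close>

lemma atlas_prodI:
  "(D, \<phi>) \<in> atlas M \<Longrightarrow> (D', \<psi>) \<in> atlas N \<Longrightarrow> (D \<times> D', map_prod \<phi> \<psi>) \<in> atlas (prod_manifold M N)"
  by (auto simp: prod_manifold_def)

lemma atlas_restrictI: "(D, \<phi>) \<in> atlas M \<Longrightarrow> (D \<inter> S, \<phi>) \<in> atlas (restrict_to M S)"
  by (force simp: restrict_to_def)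

text \<open>Boxes form a base of the product topology, and each factor is an open map on its chart
  domain. With this, \<open>prod_manifold\<close> need not be shown to be a manifold.\<close>

lemma open_image_map_prod:
  assumes M: "smooth_manifold M" and N: "smooth_manifold N"
    and D: "(D, \<phi>) \<in> atlas M" and D': "(D', \<psi>) \<in> atlas N"
    and G: "openin (prod_topology (mtop M) (mtop N)) G" "G \<subseteq> D \<times> D'"
  shows "open (map_prod \<phi> \<psi> ` G)"
proof (subst open_subopen, rule ballI)
  fix z assume "z \<in> map_prod \<phi> \<psi> ` G"
  then obtain x y where xy: "(x, y) \<in> G" and z: "z = map_prod \<phi> \<psi> (x, y)" by force
  obtain G1 G2 where G12: "openin (mtop M) G1" "openin (mtop N) G2" "x \<in> G1" "y \<in> G2" "G1 \<times> G2 \<subseteq> G"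
    using openin_prod_topology_alt[THEN iffD1, OF G(1), rule_format, OF xy] by blast
  have "G1 \<subseteq> D" "G2 \<subseteq> D'" using G12 G(2) by blast+
  then have "open (\<phi> ` G1)" "open (\<psi> ` G2)"
    using G12 sm_open_image_subset[OF M D] sm_open_image_subset[OF N D'] by auto
  then have "open (\<phi> ` G1 \<times> \<psi> ` G2)" by (rule open_Times)
  moreover have "\<phi> ` G1 \<times> \<psi> ` G2 \<subseteq> map_prod \<phi> \<psi> ` G" using G12(5) by force
  ultimately show "\<exists>T. open T \<and> z \<in> T \<and> T \<subseteq> map_prod \<phi> \<psi> ` G"
    using G12 z by (intro exI[of _ "\<phi> ` G1 \<times> \<psi> ` G2"]) auto
qed

abbreviation (input) over :: "('e, 'k) manifold \<Rightarrow> ('e \<Rightarrow> 'y) \<Rightarrow> 'y set \<Rightarrow> 'e set" where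
  "over E \<pi> V \<equiv> {e \<in> points E. \<pi> e \<in> V}"

context
  fixes E :: "('e, 'k::real_inner) manifold" and Y :: "('y, 'n::real_inner) manifold"
    and F :: "('f, 'l::real_inner) manifold" and \<pi> :: "'e \<Rightarrow> 'y"
  assumes B: "smooth_fibre_bundle E Y F \<pi>"
begin

lemma fb_manifolds: "smooth_manifold E" "smooth_manifold Y" "smooth_manifold F"
  using B by (simp_all add: smooth_fibre_bundle_def)

lemma fb_projection: "continuous_map (mtop E) (mtop Y) \<pi>"
  using B by (simp add: smooth_fibre_bundle_def smooth_map_def)

lemma fb_projection_mem: "e \<in> points E \<Longrightarrow> \<pi> e \<in> points Y"
  using fb_projection by (auto simp: continuous_map_def)

context
  fixes V \<Phi> assumes L: "local_trivialization E Y F \<pi> V \<Phi>"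
begin

lemma lt_openin: "openin (mtop Y) V"
  using L by (simp add: local_trivialization_def)

lemma lt_openin_over: "openin (mtop E) (over E \<pi> V)"
  by (rule openin_continuous_map_preimage[OF fb_projection lt_openin])

lemma lt_points:
  "points (restrict_to E (over E \<pi> V)) = over E \<pi> V"
  "points (prod_manifold (restrict_to Y V) F) = V \<times> points F"
  using openin_subset[OF lt_openin] by (auto simp: restrict_to_def prod_manifold_def)

lemma lt_bij: "bij_betw \<Phi> (over E \<pi> V) (V \<times> points F)"
  and lt_smooth: "smooth_map (restrict_to E (over E \<pi> V)) (prod_manifold (restrict_to Y V) F) \<Phi>"
  and lt_smooth_inv: "smooth_map (prod_manifold (restrict_to Y V) F) (restrict_to E (over E \<pi> V)) (inv_into (over E \<pi> V) \<Phi>)"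
  using L unfolding local_trivialization_def diffeomorphism_def lt_points by blast+

lemma lt_fst: "e \<in> points E \<Longrightarrow> \<pi> e \<in> V \<Longrightarrow> fst (\<Phi> e) = \<pi> e"
  using L by (simp add: local_trivialization_def)

lemma lt_snd: "e \<in> points E \<Longrightarrow> \<pi> e \<in> V \<Longrightarrow> snd (\<Phi> e) \<in> points F"
  using bij_betwE[OF lt_bij] by (metis (mono_tags, lifting) SigmaE mem_Collect_eq snd_conv)

lemma lt_inv:
  assumes "e \<in> points E" "\<pi> e \<in> V"
  shows "inv_into (over E \<pi> V) \<Phi> (\<pi> e, snd (\<Phi> e)) = e"
proof -
  have "(\<pi> e, snd (\<Phi> e)) = \<Phi> e" using lt_fst[OF assms] by (simp add: prod_eq_iff)
  then show ?thesis using bij_betw_inv_into_left[OF lt_bij, of e] assms by simp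
qed

lemma
  assumes "y \<in> V" "v \<in> points F"
  shows lt_inv_mem: "inv_into (over E \<pi> V) \<Phi> (y, v) \<in> points E" "\<pi> (inv_into (over E \<pi> V) \<Phi> (y, v)) = y"
    and lt_inv_right: "\<Phi> (inv_into (over E \<pi> V) \<Phi> (y, v)) = (y, v)"
proof -
  have *: "(y, v) \<in> \<Phi> ` over E \<pi> V" using assms lt_bij by (simp add: bij_betw_def)
  from inv_into_into[OF this] have 1: "inv_into (over E \<pi> V) \<Phi> (y, v) \<in> over E \<pi> V" .
  show 2: "\<Phi> (inv_into (over E \<pi> V) \<Phi> (y, v)) = (y, v)" using * by (rule f_inv_into_f)
  show "inv_into (over E \<pi> V) \<Phi> (y, v) \<in> points E" using 1 by simp
  show "\<pi> (inv_into (over E \<pi> V) \<Phi> (y, v)) = y" using 1 2 lt_fst by fastforce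
qed

lemma lt_continuous: "continuous_map (subtopology (mtop E) (over E \<pi> V)) (prod_topology (mtop Y) (mtop F)) \<Phi>"
proof -
  have "continuous_map (subtopology (mtop E) (over E \<pi> V)) (prod_topology (subtopology (mtop Y) V) (mtop F)) \<Phi>"
    using lt_smooth by (simp add: smooth_map_def restrict_to_def prod_manifold_def)
  then show ?thesis by (simp add: prod_topology_subtopology(1) continuous_map_in_subtopology)
qed

lemma lt_continuous_inv:
  "continuous_map (subtopology (prod_topology (mtop Y) (mtop F)) (V \<times> points F)) (mtop E) (inv_into (over E \<pi> V) \<Phi>)"
proof -
  have "continuous_map (prod_topology (subtopology (mtop Y) V) (mtop F)) (mtop E) (inv_into (over E \<pi> V) \<Phi>)"
    using lt_smooth_inv by (simp add: smooth_map_def restrict_to_def prod_manifold_def continuous_map_in_subtopology)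
  then show ?thesis by (simp add: prod_topology_subtopology(1))
qed

end

text \<open>The fibre component of a change of trivialization, read in charts of \<open>Y\<close>
  and \<open>F\<close>, factors through a chart \<open>\<eta>\<close> of \<open>E\<close>. Each half
  is smooth because a trivialization is a diffeomorphism, and the base component is projected away.
  The map does not depend on \<open>t\<close>; it is stated as a family because it is to be composed
  with one.\<close>

lemma smooth_family_trivialization_change:
  assumes L1: "local_trivialization E Y F \<pi> V1 \<Phi>1" and L2: "local_trivialization E Y F \<pi> V2 \<Phi>2"
    and DY: "(DY, \<psi>Y) \<in> atlas Y" and D1: "(D1, \<psi>1) \<in> atlas F" and D2: "(D2, \<psi>2) \<in> atlas F"
  shows "smooth_family T (topspace T \<times> map_prod \<psi>Y \<psi>1 `
       {p \<in> (DY \<inter> V1 \<inter> V2) \<times> D1. snd (\<Phi>2 (inv_into (over E \<pi> V1) \<Phi>1 p)) \<in> D2})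
     (\<lambda>t z. \<psi>2 (snd (\<Phi>2 (inv_into (over E \<pi> V1) \<Phi>1 (inv_into DY \<psi>Y (fst z), inv_into D1 \<psi>1 (snd z))))))"
proof -
  let ?I = "inv_into (over E \<pi> V1) \<Phi>1"
  let ?YF = "prod_topology (mtop Y) (mtop F)"
  let ?G = "{p \<in> (DY \<inter> V1 \<inter> V2) \<times> D1. snd (\<Phi>2 (?I p)) \<in> D2}"
  note M = fb_manifolds
  have YF1: "openin ?YF (V1 \<times> points F)" using lt_openin[OF L1] by (simp add: openin_prod_Times_iff)
  have D1F: "D1 \<subseteq> points F" by (rule sm_subset[OF M(3) D1])
  \<comment> \<open>The condition on \<open>\<Phi>2\<close> is first seen to be open in
    \<open>E\<close>, and is then pulled back along the inverse of \<open>\<Phi>1\<close>.\<close>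
  have oE: "openin (mtop E) {e \<in> over E \<pi> V2. snd (\<Phi>2 e) \<in> D2}"
  proof (rule openin_preimage_on[OF lt_openin_over[OF L2] _ sm_openin[OF M(3) D2]])
    show "continuous_map (subtopology (mtop E) (over E \<pi> V2)) (mtop F) (\<lambda>e. snd (\<Phi>2 e))"
      using continuous_map_compose[OF lt_continuous[OF L2] continuous_map_snd] by (simp add: o_def)
  qed
  have "openin ?YF {p \<in> V1 \<times> points F. ?I p \<in> {e \<in> over E \<pi> V2. snd (\<Phi>2 e) \<in> D2}}"
    by (rule openin_preimage_on[OF YF1 lt_continuous_inv[OF L1] oE])
  moreover have "openin ?YF ((DY \<inter> V1 \<inter> V2) \<times> D1)"
    using sm_openin[OF M(2) DY] lt_openin[OF L1] lt_openin[OF L2] sm_openin[OF M(3) D1]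
    by (simp add: openin_prod_Times_iff openin_Int)
  ultimately have "openin ?YF ((DY \<inter> V1 \<inter> V2) \<times> D1 \<inter> {p \<in> V1 \<times> points F. ?I p \<in> {e \<in> over E \<pi> V2. snd (\<Phi>2 e) \<in> D2}})"
    by blast
  moreover have "(DY \<inter> V1 \<inter> V2) \<times> D1 \<inter> {p \<in> V1 \<times> points F. ?I p \<in> {e \<in> over E \<pi> V2. snd (\<Phi>2 e) \<in> D2}} = ?G"
    using lt_inv_mem[OF L1] D1F by auto
  ultimately have oG: "openin ?YF ?G" by simp
  have "open (map_prod \<psi>Y \<psi>1 ` ?G)"
    by (rule open_image_map_prod[OF M(2,3) DY D1 oG]) auto
  then have oQ: "openin (prod_topology T euclidean) (topspace T \<times> map_prod \<psi>Y \<psi>1 ` ?G)"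
    by (rule openin_topspace_Times)
  show ?thesis
  proof (rule smooth_family_local[OF oQ])
    fix z assume "z \<in> topspace T \<times> map_prod \<psi>Y \<psi>1 ` ?G"
    then obtain t y v where z: "z = (t, (\<psi>Y y, \<psi>1 v))" "t \<in> topspace T" "y \<in> DY" "y \<in> V1" "y \<in> V2" "v \<in> D1"
      "snd (\<Phi>2 (?I (y, v))) \<in> D2" by auto
    define e where "e = ?I (y, v)"
    have v: "v \<in> points F" using z D1F by auto
    have e: "e \<in> points E" "\<pi> e = y" using lt_inv_mem[OF L1 z(4) v] by (simp_all add: e_def)
    obtain DE \<eta> where DE: "(DE, \<eta>) \<in> atlas E" "e \<in> DE" using sm_cover[OF M(1) e(1)] .
    \<comment> \<open>\<open>?G1\<close> and \<open>?G2\<close> are the domains on which the inverse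
      of \<open>\<Phi>1\<close> and the map \<open>\<Phi>2\<close> can be expressed in the chart
      \<open>\<eta>\<close>.\<close>
    let ?G1 = "{p \<in> (DY \<inter> V1) \<times> D1. ?I p \<in> DE \<inter> over E \<pi> V1}"
    let ?G2 = "{e \<in> DE \<inter> over E \<pi> V2. \<Phi>2 e \<in> (DY \<inter> V2) \<times> D2}"
    have "((DY \<inter> V1) \<times> D1, map_prod \<psi>Y \<psi>1) \<in> atlas (prod_manifold (restrict_to Y V1) F)"
      "(DE \<inter> over E \<pi> V1, \<eta>) \<in> atlas (restrict_to E (over E \<pi> V1))"
      using DY D1 DE by (auto intro: atlas_prodI atlas_restrictI)
    then have s1: "smooth_on (map_prod \<psi>Y \<psi>1 ` ?G1) (\<eta> \<circ> ?I \<circ> inv_into ((DY \<inter> V1) \<times> D1) (map_prod \<psi>Y \<psi>1))"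
      using lt_smooth_inv[OF L1] unfolding smooth_map_def by fast
    have "((DY \<inter> V2) \<times> D2, map_prod \<psi>Y \<psi>2) \<in> atlas (prod_manifold (restrict_to Y V2) F)"
      "(DE \<inter> over E \<pi> V2, \<eta>) \<in> atlas (restrict_to E (over E \<pi> V2))"
      using DY D2 DE by (auto intro: atlas_prodI atlas_restrictI)
    then have s2: "smooth_on (\<eta> ` ?G2) (map_prod \<psi>Y \<psi>2 \<circ> \<Phi>2 \<circ> inv_into (DE \<inter> over E \<pi> V2) \<eta>)"
      using lt_smooth[OF L2] unfolding smooth_map_def by fast
    have "openin ?YF {p \<in> V1 \<times> points F. ?I p \<in> DE}"
      by (rule openin_preimage_on[OF YF1 lt_continuous_inv[OF L1] sm_openin[OF M(1) DE(1)]])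
    moreover have "openin ?YF ((DY \<inter> V1) \<times> D1)"
      using sm_openin[OF M(2) DY] lt_openin[OF L1] sm_openin[OF M(3) D1]
      by (simp add: openin_prod_Times_iff openin_Int)
    ultimately have "openin ?YF ((DY \<inter> V1) \<times> D1 \<inter> {p \<in> V1 \<times> points F. ?I p \<in> DE})" by blast
    moreover have "(DY \<inter> V1) \<times> D1 \<inter> {p \<in> V1 \<times> points F. ?I p \<in> DE} = ?G1"
      using lt_inv_mem[OF L1] D1F by auto
    ultimately have "open (map_prod \<psi>Y \<psi>1 ` ?G1)"
      by (intro open_image_map_prod[OF M(2,3) DY D1]) auto
    note s1 = smooth_family_const_param[OF this s1, of T]
    have "openin (mtop E) {e \<in> over E \<pi> V2. \<Phi>2 e \<in> (DY \<inter> V2) \<times> D2}"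
      using sm_openin[OF M(2) DY] lt_openin[OF L2] sm_openin[OF M(3) D2]
      by (intro openin_preimage_on[OF lt_openin_over[OF L2] lt_continuous[OF L2]]) (simp add: openin_prod_Times_iff openin_Int)
    from openin_Int[OF sm_openin[OF M(1) DE(1)] this]
    have "openin (mtop E) (DE \<inter> {e \<in> over E \<pi> V2. \<Phi>2 e \<in> (DY \<inter> V2) \<times> D2})" .
    moreover have "DE \<inter> {e \<in> over E \<pi> V2. \<Phi>2 e \<in> (DY \<inter> V2) \<times> D2} = ?G2" by auto
    ultimately have "open (\<eta> ` ?G2)" by (intro sm_open_image_subset[OF M(1) DE(1)]) auto
    note s2 = smooth_family_const_param[OF this s2, of T]
    note s12 = smooth_family_bounded_linear[OF bounded_linear_snd smooth_family_compose[OF sm_finite_dim[OF M(1)] s1 s2]]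
    let ?W = "{(t, u). (t, u) \<in> topspace T \<times> map_prod \<psi>Y \<psi>1 ` ?G1 \<and>
        (t, (\<eta> \<circ> ?I \<circ> inv_into ((DY \<inter> V1) \<times> D1) (map_prod \<psi>Y \<psi>1)) u) \<in> topspace T \<times> \<eta> ` ?G2}"
    have inj: "inj_on (map_prod \<psi>Y \<psi>1) ((DY \<inter> V1) \<times> D1)"
      by (rule map_prod_inj_on) (use sm_inj[OF M(2) DY] sm_inj[OF M(3) D1] in \<open>auto intro: inj_on_subset\<close>)
    have inv1: "inv_into ((DY \<inter> V1) \<times> D1) (map_prod \<psi>Y \<psi>1) (\<psi>Y y, \<psi>1 v) = (y, v)"
      if "y \<in> DY" "y \<in> V1" "v \<in> D1" for y v
      using inv_into_f_f[OF inj, of "(y, v)"] that by simp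
    have inv2: "inv_into (DE \<inter> over E \<pi> V2) \<eta> (\<eta> e) = e" if "e \<in> DE" "e \<in> over E \<pi> V2" for e
      by (rule inv_into_f_f) (use sm_inj[OF M(1) DE(1)] that in \<open>auto intro: inj_on_subset\<close>)
    have "smooth_family T ?W
      (\<lambda>t z. \<psi>2 (snd (\<Phi>2 (?I (inv_into DY \<psi>Y (fst z), inv_into D1 \<psi>1 (snd z))))))"
    proof (rule smooth_family_cong[OF s12])
      fix t z assume tz: "(t, z) \<in> ?W"
      then obtain y v where z: "z = (\<psi>Y y, \<psi>1 v)" "y \<in> DY" "y \<in> V1" "v \<in> D1" "?I (y, v) \<in> DE"
        by auto
      \<comment> \<open>Membership in \<open>?W\<close> only concerns coordinates; injectivity of
        \<open>\<eta>\<close> turns it into a statement about the point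
        \<open>?I (y, v)\<close>.\<close>
      have "\<eta> (?I (y, v)) \<in> \<eta> ` ?G2" using tz inv1[OF z(2-4)] by (simp add: z(1))
      then obtain e where e: "\<eta> (?I (y, v)) = \<eta> e" "e \<in> ?G2" by (rule imageE)
      have "e \<in> DE" using e(2) by simp
      with e(1) z(5) have "?I (y, v) = e" by (rule inj_onD[OF sm_inj[OF M(1) DE(1)]])
      then show "snd ((map_prod \<psi>Y \<psi>2 \<circ> \<Phi>2 \<circ> inv_into (DE \<inter> over E \<pi> V2) \<eta>)
          ((\<eta> \<circ> ?I \<circ> inv_into ((DY \<inter> V1) \<times> D1) (map_prod \<psi>Y \<psi>1)) z))
        = \<psi>2 (snd (\<Phi>2 (?I (inv_into DY \<psi>Y (fst z), inv_into D1 \<psi>1 (snd z)))))"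
        using inv1[OF z(2-4)] inv2[of e] e(2) sm_inv[OF M(2) DY z(2)] sm_inv[OF M(3) D1 z(4)] by (simp add: z(1))
    qed
    moreover have "z \<in> ?W"
    proof -
      have "(y, v) \<in> ?G1" using z e DE by (auto simp: e_def)
      then have 1: "(\<psi>Y y, \<psi>1 v) \<in> map_prod \<psi>Y \<psi>1 ` ?G1" by (metis (no_types, lifting) image_eqI map_prod_simp)
      have "fst (\<Phi>2 e) = y" using lt_fst[OF L2] e z(5) by simp
      then have "e \<in> ?G2" using DE e z by (auto simp: e_def mem_Times_iff)
      then have 2: "\<eta> e \<in> \<eta> ` ?G2" by (rule imageI)
      show ?thesis using 1 2 z(1,2) inv1[OF z(3,4,6)] by (simp add: e_def)
    qed
    ultimately show "\<exists>W'. z \<in> W' \<and> smooth_family T W'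
      (\<lambda>t z. \<psi>2 (snd (\<Phi>2 (?I (inv_into DY \<psi>Y (fst z), inv_into D1 \<psi>1 (snd z))))))"
      by (intro exI[of _ ?W] conjI)
  qed
qed

end

section \<open>Charts of the pullback bundles\<close>

definition pullback_chart_domain ::
    "('e, 'k) manifold \<Rightarrow> ('e \<Rightarrow> 'y) \<Rightarrow> 'x set \<Rightarrow> 'y set \<Rightarrow> ('e \<Rightarrow> 'y \<times> 'f) \<Rightarrow> 'f set \<Rightarrow> ('x \<times> 'e) set" where
  "pullback_chart_domain E \<pi> D V \<Phi> D' = {(x, e). x \<in> D \<and> e \<in> points E \<and> \<pi> e \<in> V \<and> snd (\<Phi> e) \<in> D'}"

definition pullback_chart_map ::
    "('x \<Rightarrow> 'm) \<Rightarrow> ('e \<Rightarrow> 'y \<times> 'f) \<Rightarrow> ('f \<Rightarrow> 'l) \<Rightarrow> 'x \<times> 'e \<Rightarrow> 'm \<times> 'l" where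
  "pullback_chart_map \<phi> \<Phi> \<psi> = (\<lambda>(x, e). (\<phi> x, \<psi> (snd (\<Phi> e))))"

lemma atlas_pullback_charts:
  "atlas (pullback_charts X E Y F \<pi>) = {(pullback_chart_domain E \<pi> D V \<Phi> D', pullback_chart_map \<phi> \<Phi> \<psi>) | D \<phi> V \<Phi> D' \<psi>.
     (D, \<phi>) \<in> atlas X \<and> local_trivialization E Y F \<pi> V \<Phi> \<and> (D', \<psi>) \<in> atlas F}"
  by (simp add: pullback_charts_def pullback_chart_domain_def pullback_chart_map_def)

lemma atlas_pullback_chartsI:
  "(D, \<phi>) \<in> atlas X \<Longrightarrow> local_trivialization E Y F \<pi> V \<Phi> \<Longrightarrow> (D', \<psi>) \<in> atlas F \<Longrightarrow>
    (pullback_chart_domain E \<pi> D V \<Phi> D', pullback_chart_map \<phi> \<Phi> \<psi>) \<in> atlas (pullback_charts X E Y F \<pi>)"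
  unfolding atlas_pullback_charts by blast

lemma mtop_pullback_charts: "mtop (pullback_charts X E Y F \<pi>) = prod_topology (mtop X) (mtop E)"
  by (simp add: pullback_charts_def)

context
  fixes E :: "('e, 'k::real_inner) manifold" and Y :: "('y, 'n::real_inner) manifold"
    and F :: "('f, 'l::real_inner) manifold" and \<pi> :: "'e \<Rightarrow> 'y"
    and X :: "('x, 'm::real_inner) manifold" and T :: "'t topology" and U :: "'x set" and a :: "'t \<Rightarrow> 'x \<Rightarrow> 'y"
  assumes B: "smooth_fibre_bundle E Y F \<pi>" and X: "smooth_manifold X" and U: "openin (mtop X) U"
    and a: "smooth_map_family T X (\<lambda>_. points X) Y (\<lambda>_. points Y) a"
begin

private abbreviation (input) S where "S \<equiv> \<lambda>t. pullback_set U (points E) \<pi> (a t)"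

private abbreviation (input) PB where "PB \<equiv> pullback_charts X E Y F \<pi>"

context
  fixes D \<phi> V \<Phi> D' \<psi>
  assumes D: "(D, \<phi>) \<in> atlas X" and L: "local_trivialization E Y F \<pi> V \<Phi>" and D': "(D', \<psi>) \<in> atlas F"
begin

text \<open>The expected image of a pullback chart, described without points of \<open>E\<close>.
  The domain depends on \<open>t\<close> only through the last condition, which says that the fibre
  over the base point is seen by the trivialization.\<close>

definition pullback_image :: "('t \<times> 'm \<times> 'l) set" where
  "pullback_image = {(t, (u, w)). t \<in> topspace T \<and> u \<in> \<phi> ` (D \<inter> U) \<and> w \<in> \<psi> ` D' \<and> a t (inv_into D \<phi> u) \<in> V}"

text \<open>The fibre of the pullback over a point x is the fibre of \<open>E\<close> over
  \<open>a t x\<close>; there the inverse of \<open>\<Phi>\<close> recovers an element from its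
  fibre coordinate.\<close>

definition pullback_inv :: "'t \<Rightarrow> 'm \<times> 'l \<Rightarrow> 'x \<times> 'e" where
  "pullback_inv t z = (inv_into D \<phi> (fst z), inv_into (over E \<pi> V) \<Phi> (a t (inv_into D \<phi> (fst z)), inv_into D' \<psi> (snd z)))"

private abbreviation (input) D0 where "D0 \<equiv> pullback_chart_domain E \<pi> D V \<Phi> D'"

lemma pullback_image_cases:
  assumes "(t, z) \<in> pullback_image"
  obtains x v where "z = (\<phi> x, \<psi> v)" "t \<in> topspace T" "x \<in> D" "x \<in> U" "v \<in> D'" "v \<in> points F" "a t x \<in> V"
    "pullback_inv t z = (x, inv_into (over E \<pi> V) \<Phi> (a t x, v))"
proof -
  from assms obtain x v where *: "z = (\<phi> x, \<psi> v)" "t \<in> topspace T" "x \<in> D" "x \<in> U" "v \<in> D'" "a t (inv_into D \<phi> (\<phi> x)) \<in> V"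
    by (auto simp: pullback_image_def)
  show thesis
    by (rule that[of x v])
      (use * sm_inv[OF X D] sm_inv[OF fb_manifolds(3)[OF B] D'] sm_subset[OF fb_manifolds(3)[OF B] D']
        in \<open>auto simp: pullback_inv_def\<close>)
qed

text \<open>On the product \<open>?W\<close>, where the condition on \<open>V\<close> is dropped,
  the base point, its image under \<open>a t\<close> and the fibre point are continuous in
  \<open>(t, z)\<close>. The condition then cuts out an open set, and on it the inverse
  trivialization can be applied.\<close>

lemma openin_pullback_image: "openin (prod_topology T euclidean) pullback_image"
  and continuous_pullback_inv:
    "continuous_map (subtopology (prod_topology T euclidean) pullback_image) (mtop PB) (\<lambda>(t, z). pullback_inv t z)"
proof -
  note F = fb_manifolds(3)[OF B]
  let ?W = "topspace T \<times> (\<phi> ` (D \<inter> U) \<times> \<psi> ` D')"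
  let ?Z = "subtopology (prod_topology T euclidean) ?W"
  have "open (\<phi> ` (D \<inter> U))"
    using sm_openin[OF X D] U by (intro sm_open_image_subset[OF X D]) auto
  moreover have "open (\<psi> ` D')" by (rule sm_open_image[OF F D'])
  ultimately have "open (\<phi> ` (D \<inter> U) \<times> \<psi> ` D')" by (rule open_Times)
  then have oW: "openin (prod_topology T euclidean) ?W" by (rule openin_topspace_Times)
  have snd: "continuous_map ?Z euclidean snd" by (simp add: continuous_map_subtopology_snd)
  have t: "continuous_map ?Z T fst" by (simp add: continuous_map_subtopology_fst)
  have "continuous_map ?Z euclidean (fst \<circ> snd)"
    by (rule continuous_map_compose[OF snd]) (simp add: continuous_on_fst)
  then have "continuous_map ?Z (top_of_set (\<phi> ` D)) (fst \<circ> snd)"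
    by (rule continuous_map_into_open_subset) auto
  from continuous_map_compose[OF this sm_inv_continuous[OF X D]]
  have x: "continuous_map ?Z (mtop X) (\<lambda>z. inv_into D \<phi> (fst (snd z)))"
    by (simp add: continuous_map_in_subtopology o_def)
  have "continuous_map ?Z euclidean (snd \<circ> snd)"
    by (rule continuous_map_compose[OF snd]) (simp add: continuous_on_snd)
  then have "continuous_map ?Z (top_of_set (\<psi> ` D')) (snd \<circ> snd)"
    by (rule continuous_map_into_open_subset) auto
  from continuous_map_compose[OF this sm_inv_continuous[OF F D']]
  have v: "continuous_map ?Z (mtop F) (\<lambda>z. inv_into D' \<psi> (snd (snd z)))"
    by (simp add: continuous_map_in_subtopology o_def)
  have "continuous_map ?Z (prod_topology T (mtop X)) (\<lambda>z. (fst z, inv_into D \<phi> (fst (snd z))))"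
    using t x by (rule continuous_map_pairedI)
  then have "continuous_map ?Z (subtopology (prod_topology T (mtop X)) (total_space T (\<lambda>_. points X)))
      (\<lambda>z. (fst z, inv_into D \<phi> (fst (snd z))))"
    by (rule continuous_map_into_open_subset)
      (use sm_inv[OF X D] sm_subset[OF X D] in \<open>auto simp: total_space_def\<close>)
  from continuous_map_compose[OF this smf_continuous[OF a]]
  have y: "continuous_map ?Z (mtop Y) (\<lambda>z. a (fst z) (inv_into D \<phi> (fst (snd z))))"
    by (simp add: o_def)
  have eq: "{z \<in> ?W. a (fst z) (inv_into D \<phi> (fst (snd z))) \<in> V} = pullback_image"
    by (auto simp: pullback_image_def)
  show "openin (prod_topology T euclidean) pullback_image"
    using openin_preimage_on[OF oW y lt_openin[OF B L]] unfolding eq .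
  let ?Z' = "subtopology (prod_topology T euclidean) pullback_image"
  have sub: "pullback_image \<subseteq> ?W" unfolding eq[symmetric] by blast
  note mono = continuous_map_from_subtopology_mono[OF _ sub]
  have "continuous_map ?Z' (prod_topology (mtop Y) (mtop F)) (\<lambda>z. (a (fst z) (inv_into D \<phi> (fst (snd z))), inv_into D' \<psi> (snd (snd z))))"
    using mono[OF y] mono[OF v] by (rule continuous_map_pairedI)
  then have "continuous_map ?Z' (subtopology (prod_topology (mtop Y) (mtop F)) (V \<times> points F))
      (\<lambda>z. (a (fst z) (inv_into D \<phi> (fst (snd z))), inv_into D' \<psi> (snd (snd z))))"
    by (rule continuous_map_into_open_subset)
      (use sm_inv[OF F D'] sm_subset[OF F D'] in \<open>auto simp: pullback_image_def\<close>)
  from continuous_map_compose[OF this lt_continuous_inv[OF B L]]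
  have e: "continuous_map ?Z' (mtop E) (\<lambda>z. inv_into (over E \<pi> V) \<Phi> (a (fst z) (inv_into D \<phi> (fst (snd z))), inv_into D' \<psi> (snd (snd z))))"
    by (simp add: o_def)
  show "continuous_map ?Z' (mtop PB) (\<lambda>(t, z). pullback_inv t z)"
    using continuous_map_pairedI[OF mono[OF x] e]
    by (simp add: mtop_pullback_charts pullback_inv_def case_prod_unfold)
qed

lemma openin_pullback_chart_domain: "openin (mtop PB) D0"
proof -
  have "continuous_map (subtopology (mtop E) (over E \<pi> V)) (mtop F) (\<lambda>e. snd (\<Phi> e))"
    using continuous_map_compose[OF lt_continuous[OF B L] continuous_map_snd] by (simp add: o_def)
  from openin_preimage_on[OF lt_openin_over[OF B L] this sm_openin[OF fb_manifolds(3)[OF B] D']]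
  have "openin (mtop PB) (D \<times> {e \<in> over E \<pi> V. snd (\<Phi> e) \<in> D'})"
    using sm_openin[OF X D] by (simp add: mtop_pullback_charts openin_prod_Times_iff)
  moreover have "D \<times> {e \<in> over E \<pi> V. snd (\<Phi> e) \<in> D'} = D0" by (auto simp: pullback_chart_domain_def)
  ultimately show ?thesis by simp
qed

lemma continuous_pullback_chart: "continuous_map (subtopology (mtop PB) D0) euclidean (pullback_chart_map \<phi> \<Phi> \<psi>)"
proof -
  let ?Z = "subtopology (mtop PB) D0"
  have "continuous_map ?Z (mtop X) fst" "continuous_map ?Z (mtop E) snd"
    unfolding mtop_pullback_charts by (simp_all add: continuous_map_subtopology_fst continuous_map_subtopology_snd)
  then have f: "continuous_map ?Z (subtopology (mtop X) D) fst" and s: "continuous_map ?Z (subtopology (mtop E) (over E \<pi> V)) snd"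
    by (auto simp: continuous_map_in_subtopology pullback_chart_domain_def)
  have 1: "continuous_map ?Z euclidean (\<phi> \<circ> fst)" by (rule continuous_map_compose[OF f sm_continuous[OF X D]])
  have "continuous_map ?Z (mtop F) (snd \<circ> (\<Phi> \<circ> snd))"
    by (rule continuous_map_compose[OF continuous_map_compose[OF s lt_continuous[OF B L]] continuous_map_snd])
  then have "continuous_map ?Z (subtopology (mtop F) D') (snd \<circ> (\<Phi> \<circ> snd))"
    by (auto simp: continuous_map_in_subtopology pullback_chart_domain_def)
  from continuous_map_compose[OF this sm_continuous[OF fb_manifolds(3)[OF B] D']]
  have 2: "continuous_map ?Z euclidean (\<psi> \<circ> (snd \<circ> (\<Phi> \<circ> snd)))" .
  from continuous_map_pairedI[OF 1 2] show ?thesis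
    by (simp add: pullback_chart_map_def case_prod_unfold o_def)
qed

lemma pullback_inv_mem:
  assumes "(t, z) \<in> pullback_image"
  shows "pullback_inv t z \<in> D0 \<inter> S t \<and> pullback_chart_map \<phi> \<Phi> \<psi> (pullback_inv t z) = z"
proof -
  obtain x v where *: "z = (\<phi> x, \<psi> v)" "t \<in> topspace T" "x \<in> D" "x \<in> U" "v \<in> D'" "v \<in> points F" "a t x \<in> V"
    "pullback_inv t z = (x, inv_into (over E \<pi> V) \<Phi> (a t x, v))" using pullback_image_cases[OF assms] .
  show ?thesis
    using lt_inv_mem[OF B L *(7,6)] lt_inv_right[OF B L *(7,6)] *
    by (simp add: pullback_chart_domain_def pullback_chart_map_def pullback_set_def)
qed

lemma pullback_chart_mem:
  assumes "t \<in> topspace T" "p \<in> D0" "p \<in> S t"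
  shows "(t, pullback_chart_map \<phi> \<Phi> \<psi> p) \<in> pullback_image \<and> pullback_inv t (pullback_chart_map \<phi> \<Phi> \<psi> p) = p"
proof -
  obtain x e where p: "p = (x, e)" "x \<in> D" "x \<in> U" "e \<in> points E" "\<pi> e \<in> V" "snd (\<Phi> e) \<in> D'" "a t x = \<pi> e"
    using assms by (auto simp: pullback_chart_domain_def pullback_set_def)
  show ?thesis
    using p assms(1) sm_inv[OF X D p(2)] sm_inv[OF fb_manifolds(3)[OF B] D' p(6)] lt_inv[OF B L p(4,5)]
    by (auto simp: pullback_image_def pullback_inv_def pullback_chart_map_def)
qed

lemmas pullback_family_chart = family_chartI[where j = pullback_inv, OF openin_pullback_chart_domain
  continuous_pullback_chart openin_pullback_image pullback_inv_mem pullback_chart_mem continuous_pullback_inv]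

end

text \<open>The base part is a transition map of \<open>X\<close>. The fibre part is a change of
  trivialization at the point \<open>a t x\<close>, hence the composite of
  \<open>smooth_family_trivialization_change\<close> with \<open>a\<close> read in a chart of
  \<open>Y\<close>. This is the step that uses continuity in \<open>t\<close> of the derivatives of
  \<open>a t\<close>.\<close>

lemma pullback_transition:
  assumes D: "(D, \<phi>) \<in> atlas X" and L: "local_trivialization E Y F \<pi> V \<Phi>" and D': "(D', \<psi>) \<in> atlas F"
    and D1: "(D1, \<phi>1) \<in> atlas X" and L1: "local_trivialization E Y F \<pi> V1 \<Phi>1" and D1': "(D1', \<psi>1) \<in> atlas F"
  shows "smooth_family T
     (chart_image T (\<lambda>t. pullback_chart_domain E \<pi> D1 V1 \<Phi>1 D1' \<inter> S t) (pullback_chart_domain E \<pi> D V \<Phi> D') (pullback_chart_map \<phi> \<Phi> \<psi>))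
     (\<lambda>t. pullback_chart_map \<phi>1 \<Phi>1 \<psi>1 \<circ> inv_into (pullback_chart_domain E \<pi> D V \<Phi> D' \<inter> S t) (pullback_chart_map \<phi> \<Phi> \<psi>))"
proof -
  note F = fb_manifolds(3)[OF B] and Y = fb_manifolds(2)[OF B]
  let ?D0 = "pullback_chart_domain E \<pi> D V \<Phi> D'" and ?D1 = "pullback_chart_domain E \<pi> D1 V1 \<Phi>1 D1'"
  let ?f0 = "pullback_chart_map \<phi> \<Phi> \<psi>" and ?f1 = "pullback_chart_map \<phi>1 \<Phi>1 \<psi>1"
  let ?W = "pullback_image D \<phi> V D' \<psi>" and ?j = "pullback_inv D \<phi> V \<Phi> D' \<psi>"
  let ?W1 = "{z \<in> ?W. (\<lambda>(t, z). ?j t z) z \<in> ?D1}"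
  note oW = openin_pullback_image[OF D L D']
  have oW1: "openin (prod_topology T euclidean) ?W1"
    by (rule openin_preimage_on[OF oW continuous_pullback_inv[OF D L D'] openin_pullback_chart_domain[OF D1 L1 D1']])
  have W1: "chart_image T (\<lambda>t. ?D1 \<inter> S t) ?D0 ?f0 = ?W1"
  proof safe
    fix t z assume "(t, z) \<in> chart_image T (\<lambda>t. ?D1 \<inter> S t) ?D0 ?f0"
    then obtain p where p: "z = ?f0 p" "t \<in> topspace T" "p \<in> ?D0" "p \<in> ?D1" "p \<in> S t"
      by (auto simp: chart_image_def)
    show "(t, z) \<in> ?W" "?j t z \<in> ?D1" using pullback_chart_mem[OF D L D' p(2,3,5)] p by auto
  next
    fix t z assume tz: "(t, z) \<in> ?W" "?j t z \<in> ?D1"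
    have "t \<in> topspace T" using tz(1) by (auto simp: pullback_image_def[OF D L D'])
    with tz pullback_inv_mem[OF D L D' tz(1)] show "(t, z) \<in> chart_image T (\<lambda>t. ?D1 \<inter> S t) ?D0 ?f0"
      unfolding chart_image_def by (intro CollectI exI[of _ t] exI[of _ "?j t z"]) auto
  qed
  have "smooth_family T ?W1 (\<lambda>t z. ?f1 (?j t z))"
  proof (rule smooth_family_local[OF oW1])
    fix z0 assume "z0 \<in> ?W1"
    moreover obtain t0 z where "z0 = (t0, z)" by (cases z0)
    ultimately have z0: "z0 = (t0, z)" "(t0, z) \<in> ?W" "?j t0 z \<in> ?D1" by simp_all
    obtain x0 v0 where z: "z = (\<phi> x0, \<psi> v0)" "t0 \<in> topspace T" "x0 \<in> D" "x0 \<in> U" "v0 \<in> D'" "v0 \<in> points F" "a t0 x0 \<in> V"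
      "?j t0 z = (x0, inv_into (over E \<pi> V) \<Phi> (a t0 x0, v0))" using pullback_image_cases[OF D L D' z0(2)] .
    \<comment> \<open>The values of \<open>a\<close> need not stay in a single chart of
      \<open>Y\<close>, which is why the claim is proved near each point \<open>z0\<close>.\<close>
    have "a t0 x0 \<in> points Y" using openin_subset[OF lt_openin[OF B L]] z(7) by blast
    then obtain DY \<psi>Y where DY: "(DY, \<psi>Y) \<in> atlas Y" "a t0 x0 \<in> DY" by (rule sm_cover[OF Y])
    note q = smooth_family_trivialization_change[OF B L L1 DY(1) D' D1', of T]
    note \<alpha> = smf_smooth[OF a D DY(1)]
    note \<tau> = mf_transition[OF manifold_family_const[OF X] D D1]
    note W_fst = smooth_family_bounded_linear[OF bounded_linear_fst smooth_family_ident[OF oW]]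
    note W_snd = smooth_family_bounded_linear[OF bounded_linear_snd smooth_family_ident[OF oW]]
    note \<tau>W = smooth_family_compose[OF sm_finite_dim[OF X] W_fst \<tau>]
    note \<alpha>W = smooth_family_compose[OF sm_finite_dim[OF X] W_fst \<alpha>]
    let ?C\<alpha> = "chart_image T (\<lambda>t. {p \<in> points X. a t p \<in> DY}) D \<phi>"
    let ?C\<tau> = "chart_image T (\<lambda>t. D1 \<inter> points X) D \<phi>"
    \<comment> \<open>\<open>?W\<alpha>\<close> and \<open>?W\<tau>\<close> are the parts of the
      image on which \<open>a t\<close> sends the base point into \<open>DY\<close>, and on which
      the base point lies in \<open>D1\<close>.\<close>
    let ?W\<alpha> = "{(t, u). (t, u) \<in> ?W \<and> (t, fst u) \<in> ?C\<alpha>}"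
    let ?W\<tau> = "{(t, u). (t, u) \<in> ?W \<and> (t, fst u) \<in> ?C\<tau>}"
    have "smooth_family T ?W\<alpha> (\<lambda>t u. snd u)"
      by (rule smooth_family_mono[OF W_snd smooth_family_openin[OF \<alpha>W]]) auto
    from smooth_family_compose[OF finite_dim_prod[OF sm_finite_dim[OF Y] sm_finite_dim[OF F]] smooth_family_Pair[OF \<alpha>W this] q]
    have r2: "smooth_family T {(t, u). (t, u) \<in> ?W\<alpha> \<and> (t, (\<psi>Y \<circ> a t \<circ> inv_into (D \<inter> points X) \<phi>) (fst u), snd u) \<in> topspace T \<times> map_prod \<psi>Y \<psi> `
       {p \<in> (DY \<inter> V \<inter> V1) \<times> D'. snd (\<Phi>1 (inv_into (over E \<pi> V) \<Phi> p)) \<in> D1'}}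
      (\<lambda>t u. \<psi>1 (snd (\<Phi>1 (inv_into (over E \<pi> V) \<Phi> (inv_into DY \<psi>Y ((\<psi>Y \<circ> a t \<circ> inv_into (D \<inter> points X) \<phi>) (fst u)), inv_into D' \<psi> (snd u))))))"
      (is "smooth_family T ?Wq ?r2") by simp
    let ?r1 = "\<lambda>t u. (\<phi>1 \<circ> inv_into (D \<inter> points X) \<phi>) (fst u)"
    have oW3: "openin (prod_topology T euclidean) (?W\<tau> \<inter> ?Wq)"
      using smooth_family_openin[OF \<tau>W] smooth_family_openin[OF r2] by (rule openin_Int)
    have "smooth_family T (?W\<tau> \<inter> ?Wq) (\<lambda>t u. (?r1 t u, ?r2 t u))"
      by (intro smooth_family_Pair smooth_family_mono[OF \<tau>W oW3] smooth_family_mono[OF r2 oW3]) auto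
    then have "smooth_family T (?W\<tau> \<inter> ?Wq) (\<lambda>t z. ?f1 (?j t z))"
    proof (rule smooth_family_cong)
      fix t z assume tz: "(t, z) \<in> ?W\<tau> \<inter> ?Wq"
      then have "(t, z) \<in> ?W" by simp
      then obtain x v where z: "z = (\<phi> x, \<psi> v)" "t \<in> topspace T" "x \<in> D" "x \<in> U" "v \<in> D'" "v \<in> points F" "a t x \<in> V"
        "?j t z = (x, inv_into (over E \<pi> V) \<Phi> (a t x, v))" by (rule pullback_image_cases[OF D L D'])
      have "(t, \<phi> x) \<in> ?C\<alpha>" using tz z(1) by simp
      then have "a t x \<in> DY"
        using mf_chart_image_iff[OF manifold_family_const[OF X] D z(2,3), of "\<lambda>t. {p \<in> points X. a t p \<in> DY}"]
          z(3) sm_subset[OF X D] by auto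
      then show "(?r1 t z, ?r2 t z) = ?f1 (?j t z)"
        using z sm_Int_points[OF X D] sm_inv[OF X D z(3)] sm_inv[OF Y DY(1)] sm_inv[OF F D' z(5)]
        by (simp add: pullback_chart_map_def)
    qed
    moreover have "z0 \<in> ?W\<tau> \<inter> ?Wq"
    proof -
      let ?e = "inv_into (over E \<pi> V) \<Phi> (a t0 x0, v0)"
      have x0: "x0 \<in> points X" using sm_subset[OF X D] z(3) by blast
      have D1x: "x0 \<in> D1" "\<pi> ?e \<in> V1" "snd (\<Phi>1 ?e) \<in> D1'" using z0(3) z(8) by (auto simp: pullback_chart_domain_def)
      then have V1: "a t0 x0 \<in> V1" using lt_inv_mem(2)[OF B L z(7,6)] by simp
      have "(t0, \<phi> x0) \<in> ?C\<alpha>" "(t0, \<phi> x0) \<in> ?C\<tau>"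
        using z x0 D1x DY by (auto simp: chart_image_def)
      moreover have "(\<psi>Y (a t0 x0), \<psi> v0) \<in> map_prod \<psi>Y \<psi> ` {p \<in> (DY \<inter> V \<inter> V1) \<times> D'. snd (\<Phi>1 (inv_into (over E \<pi> V) \<Phi> p)) \<in> D1'}"
        by (rule image_eqI[of _ _ "(a t0 x0, v0)"]) (use DY z V1 D1x in auto)
      ultimately show ?thesis
        using z0(1,2) z(1,2) sm_Int_points[OF X D] sm_inv[OF X D z(3)] by simp
    qed
    ultimately show "\<exists>W'. z0 \<in> W' \<and> smooth_family T W' (\<lambda>t z. ?f1 (?j t z))"
      by (intro exI[of _ "?W\<tau> \<inter> ?Wq"] conjI)
  qed
  then show ?thesis
    unfolding W1
  proof (rule smooth_family_cong)
    fix t z assume "(t, z) \<in> ?W1"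
    then show "?f1 (?j t z) = (?f1 \<circ> inv_into (?D0 \<inter> S t) ?f0) z"
      using pullback_family_chart(3)[OF D L D'] by simp
  qed
qed

text \<open>Around a point \<open>(x, e)\<close> a chart arises from a chart of \<open>X\<close> at
  \<open>x\<close>, a trivialization over a neighbourhood of \<open>\<pi> e\<close>, and a chart of
  \<open>F\<close> at the fibre coordinate of \<open>e\<close>.\<close>

lemma manifold_family_pullback: "manifold_family T PB S"
proof -
  have "finite_dim TYPE('m \<times> 'l)"
    by (rule finite_dim_prod[OF sm_finite_dim[OF X] sm_finite_dim[OF fb_manifolds(3)[OF B]]])
  moreover have "p \<in> points PB \<and> (\<exists>(D, \<phi>)\<in>atlas PB. p \<in> D)" if t: "t \<in> topspace T" "p \<in> S t" for t p
  proof -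
    obtain x e where p: "p = (x, e)" "x \<in> points X" "e \<in> points E" "a t x = \<pi> e"
      using t(2) openin_subset[OF U] by (auto simp: pullback_set_def)
    obtain D \<phi> where D: "(D, \<phi>) \<in> atlas X" "x \<in> D" using sm_cover[OF X p(2)] .
    obtain V \<Phi> where L: "\<pi> e \<in> V" "local_trivialization E Y F \<pi> V \<Phi>"
      using B fb_projection_mem[OF B p(3)] unfolding smooth_fibre_bundle_def by blast
    obtain D' \<psi> where D': "(D', \<psi>) \<in> atlas F" "snd (\<Phi> e) \<in> D'"
      using sm_cover[OF fb_manifolds(3)[OF B] lt_snd[OF B L(2) p(3) L(1)]] .
    have "(pullback_chart_domain E \<pi> D V \<Phi> D', pullback_chart_map \<phi> \<Phi> \<psi>) \<in> atlas PB"
      unfolding atlas_pullback_charts using D(1) L(2) D'(1) by blast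
    moreover have "p \<in> pullback_chart_domain E \<pi> D V \<Phi> D'"
      using p D D' L by (simp add: pullback_chart_domain_def)
    ultimately show ?thesis using p by (auto simp: mtop_pullback_charts)
  qed
  moreover have "family_chart T PB S D \<phi>" if "(D, \<phi>) \<in> atlas PB" for D \<phi>
    using that pullback_family_chart(1) unfolding atlas_pullback_charts by blast
  moreover have "smooth_family T (chart_image T (\<lambda>t. D' \<inter> S t) D \<phi>) (\<lambda>t. \<phi>' \<circ> inv_into (D \<inter> S t) \<phi>)"
    if "(D, \<phi>) \<in> atlas PB" "(D', \<phi>') \<in> atlas PB" for D \<phi> D' \<phi>'
    using that pullback_transition unfolding atlas_pullback_charts by blast
  ultimately show ?thesis
    unfolding manifold_family_def by (auto split: prod.splits)
qed

end

section \<open>Transport between pullback bundles\<close>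

context
  fixes E :: "('e, 'k::real_inner) manifold" and Y :: "('y, 'n::real_inner) manifold"
    and F :: "('f, 'l::real_inner) manifold" and \<pi> :: "'e \<Rightarrow> 'y"
    and X :: "('x, 'm::real_inner) manifold" and U :: "'x set"
  assumes B: "smooth_fibre_bundle E Y F \<pi>" and X: "smooth_manifold X" and U: "openin (mtop X) U"
begin

private abbreviation (input) "PC \<equiv> pullback_charts X E Y F \<pi>"
private abbreviation (input) "PS a \<equiv> \<lambda>t. pullback_set U (points E) \<pi> (a t)"
private abbreviation (input) "smooth_maps T a \<equiv> smooth_map_family T X (\<lambda>_. points X) Y (\<lambda>_. points Y) a"

text \<open>The inverse is carried along as a second family: its smoothness and joint continuity in
  \<open>t\<close> are then part of the data and pass to composites, with no appeal to an inverse
  function theorem.\<close>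

definition bundle_iso :: "'t topology \<Rightarrow> ('t \<Rightarrow> 'x \<Rightarrow> 'y) \<Rightarrow> ('t \<Rightarrow> 'x \<Rightarrow> 'y)
    \<Rightarrow> ('t \<Rightarrow> 'x \<times> 'e \<Rightarrow> 'x \<times> 'e) \<Rightarrow> ('t \<Rightarrow> 'x \<times> 'e \<Rightarrow> 'x \<times> 'e) \<Rightarrow> bool" where
  "bundle_iso T a b \<Theta> \<Theta>' \<longleftrightarrow>
     smooth_map_family T PC (PS a) PC (PS b) \<Theta> \<and> smooth_map_family T PC (PS b) PC (PS a) \<Theta>' \<and>
     (\<forall>t\<in>topspace T. \<forall>p\<in>PS a t. fst (\<Theta> t p) = fst p \<and> \<Theta>' t (\<Theta> t p) = p) \<and>
     (\<forall>t\<in>topspace T. \<forall>p\<in>PS b t. fst (\<Theta>' t p) = fst p \<and> \<Theta> t (\<Theta>' t p) = p)"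

lemma bundle_iso_refl:
  assumes "smooth_maps T a"
  shows "bundle_iso T a a (\<lambda>t p. p) (\<lambda>t p. p)"
  unfolding bundle_iso_def
  using smooth_map_family_id[OF manifold_family_pullback[OF B X U assms]] by simp

lemma bundle_iso_trans:
  assumes a: "smooth_maps T a" and b: "smooth_maps T b" and c: "smooth_maps T c"
    and 1: "bundle_iso T a b \<Theta>1 \<Theta>1'" and 2: "bundle_iso T b c \<Theta>2 \<Theta>2'"
  shows "bundle_iso T a c (\<lambda>t p. \<Theta>2 t (\<Theta>1 t p)) (\<lambda>t p. \<Theta>1' t (\<Theta>2' t p))"
proof -
  note A = manifold_family_pullback[OF B X U]
  have s: "smooth_map_family T PC (PS a) PC (PS b) \<Theta>1" "smooth_map_family T PC (PS b) PC (PS a) \<Theta>1'"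
    "smooth_map_family T PC (PS b) PC (PS c) \<Theta>2" "smooth_map_family T PC (PS c) PC (PS b) \<Theta>2'"
    using 1 2 by (simp_all add: bundle_iso_def)
  show ?thesis
    unfolding bundle_iso_def
    using smooth_map_family_compose[OF A[OF a] A[OF b] A[OF c] s(1,3)]
      smooth_map_family_compose[OF A[OF c] A[OF b] A[OF a] s(4,2)]
      smf_maps[OF s(1)] smf_maps[OF s(4)] 1 2
    by (simp add: bundle_iso_def)
qed

lemma bundle_iso_restrict_param:
  "bundle_iso T a b \<Theta> \<Theta>' \<Longrightarrow> bundle_iso (subtopology T T') a b \<Theta> \<Theta>'"
  by (simp add: bundle_iso_def smooth_map_family_restrict_param)

text \<open>Only the target family \<open>b\<close> occurs, because the fibre coordinate is read off
  the point itself. The map back is therefore the same formula with the source family in place of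
  \<open>b\<close>.\<close>

definition transport :: "'x set \<Rightarrow> 'y set \<Rightarrow> ('e \<Rightarrow> 'y \<times> 'f) \<Rightarrow> ('t \<Rightarrow> 'x \<Rightarrow> 'y) \<Rightarrow> 't \<Rightarrow> 'x \<times> 'e \<Rightarrow> 'x \<times> 'e" where
  "transport G V \<Phi> b t p =
     (fst p, if fst p \<in> G then inv_into {e \<in> points E. \<pi> e \<in> V} \<Phi> (b t (fst p), snd (\<Phi> (snd p))) else snd p)"

context
  fixes V :: "'y set" and \<Phi> :: "'e \<Rightarrow> 'y \<times> 'f" and G K :: "'x set"
  assumes L: "local_trivialization E Y F \<pi> V \<Phi>" and G: "openin (mtop X) G" and K: "closedin (mtop X) K" "K \<subseteq> G"
begin

text \<open>Outside \<open>G\<close>, hence outside \<open>K\<close>, both families have the same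
  value at the base point, so that leaving \<open>e\<close> unchanged is correct. The room between
  \<open>K\<close> and \<open>G\<close> matters for smoothness: \<open>G\<close> and the complement
  of \<open>K\<close> are open and cover \<open>X\<close>.\<close>

lemma transport_mem:
  assumes "\<And>x. x \<in> G \<Longrightarrow> a t x \<in> V \<and> b t x \<in> V"
    and "\<And>x. x \<in> points X \<Longrightarrow> x \<notin> K \<Longrightarrow> a t x = b t x" and "p \<in> PS a t"
  shows "transport G V \<Phi> b t p \<in> PS b t" "transport G V \<Phi> a t (transport G V \<Phi> b t p) = p"
proof -
  obtain x e where p: "p = (x, e)" "x \<in> U" "x \<in> points X" "e \<in> points E" "a t x = \<pi> e"
    using assms(3) openin_subset[OF U] by (auto simp: pullback_set_def)
  have *: "x \<notin> G \<Longrightarrow> b t x = \<pi> e" using assms(2)[OF p(3)] K(2) p(5) by (metis subsetD)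
  have "x \<in> G \<Longrightarrow> \<pi> e \<in> V" "x \<in> G \<Longrightarrow> b t x \<in> V" using assms(1)[of x] p by auto
  note [simp] = lt_inv_mem[OF B L this(2) lt_snd[OF B L p(4) this(1)]]
    lt_inv_right[OF B L this(2) lt_snd[OF B L p(4) this(1)]] lt_inv[OF B L p(4) this(1)]
  show "transport G V \<Phi> b t p \<in> PS b t" "transport G V \<Phi> a t (transport G V \<Phi> b t p) = p"
    using p * by (auto simp: transport_def pullback_set_def)
qed

text \<open>Read in suitable pullback charts, transport is the identity.\<close>

lemma smooth_transport:
  assumes a: "smooth_maps T a" and b: "smooth_maps T b"
    and V: "\<And>t x. t \<in> topspace T \<Longrightarrow> x \<in> G \<Longrightarrow> a t x \<in> V \<and> b t x \<in> V"
    and off: "\<And>t x. t \<in> topspace T \<Longrightarrow> x \<in> points X \<Longrightarrow> x \<notin> K \<Longrightarrow> a t x = b t x"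
  shows "smooth_map_family T PC (PS a) PC (PS b) (transport G V \<Phi> b)"
proof (rule smooth_map_familyI[OF manifold_family_pullback[OF B X U a] manifold_family_pullback[OF B X U b]])
  fix t p assume t: "t \<in> topspace T" "p \<in> PS a t"
  show "transport G V \<Phi> b t p \<in> PS b t"
    by (rule transport_mem(1)[where a = a and b = b and t = t, OF V[OF t(1)] off[OF t(1)] t(2)])
  obtain x e where p: "p = (x, e)" "x \<in> points X" "e \<in> points E" "a t x = \<pi> e"
    using t(2) openin_subset[OF U] by (auto simp: pullback_set_def)
  obtain D \<phi> where D: "(D, \<phi>) \<in> atlas X" "x \<in> D" using sm_cover[OF X p(2)] .
  have inj: "x' \<in> H" if "x' \<in> D" "\<phi> x' \<in> \<phi> ` (D \<inter> H)" for x' H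
    using that inj_onD[OF sm_inj[OF X D(1)]] by blast
  show "smooth_map_family_at T PC (PS a) PC (transport G V \<Phi> b) t p"
  proof (cases "x \<in> G")
    case True
    have "\<pi> e \<in> V" using V[OF t(1) True] by (simp add: p(4))
    then obtain D' \<psi> where D': "(D', \<psi>) \<in> atlas F" "snd (\<Phi> e) \<in> D'"
      using sm_cover[OF fb_manifolds(3)[OF B] lt_snd[OF B L p(3)]] by blast
    note c = atlas_pullback_chartsI[OF D(1) L D'(1)]
    let ?W = "topspace T \<times> (\<phi> ` (D \<inter> G) \<times> UNIV)"
    have "open (\<phi> ` (D \<inter> G))"
      using sm_openin[OF X D(1)] G by (intro sm_open_image_subset[OF X D(1)]) auto
    then have oW: "openin (prod_topology T euclidean) ?W" by (intro openin_topspace_Times open_Times) auto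
    show ?thesis
    proof (rule smooth_map_family_atI[OF c c _ _ smooth_family_ident[OF oW]])
      show "p \<in> pullback_chart_domain E \<pi> D V \<Phi> D'"
        using p D D' \<open>\<pi> e \<in> V\<close> by (simp add: pullback_chart_domain_def)
      show "(t, pullback_chart_map \<phi> \<Phi> \<psi> p) \<in> ?W"
        using t p D True by (simp add: pullback_chart_map_def)
      fix t' p' assume *: "t' \<in> topspace T" "p' \<in> pullback_chart_domain E \<pi> D V \<Phi> D'" "p' \<in> PS a t'"
        "(t', pullback_chart_map \<phi> \<Phi> \<psi> p') \<in> ?W"
      then obtain x' e' where p': "p' = (x', e')" "x' \<in> D" "e' \<in> points E" "\<pi> e' \<in> V" "snd (\<Phi> e') \<in> D'"
        by (auto simp: pullback_chart_domain_def)
      have "\<phi> x' \<in> \<phi> ` (D \<inter> G)" using *(4) by (simp add: p'(1) pullback_chart_map_def)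
      then have "x' \<in> G" using inj p' by blast
      then have bV: "b t' x' \<in> V" using V[OF *(1)] by blast
      note i = lt_inv_mem[OF B L bV lt_snd[OF B L p'(3,4)]] lt_inv_right[OF B L bV lt_snd[OF B L p'(3,4)]]
      show "transport G V \<Phi> b t' p' \<in> pullback_chart_domain E \<pi> D V \<Phi> D' \<and>
        pullback_chart_map \<phi> \<Phi> \<psi> (transport G V \<Phi> b t' p') = pullback_chart_map \<phi> \<Phi> \<psi> p'"
        using \<open>x' \<in> G\<close> i p' bV by (simp add: transport_def pullback_chart_domain_def pullback_chart_map_def)
    qed
  next
    case False
    \<comment> \<open>Away from \<open>G\<close> the point \<open>\<pi> e\<close> need not lie in
      \<open>V\<close>, so any trivialization around it is used. The neighbourhood considered is the
      complement of \<open>K\<close>, which may reach into \<open>G\<close>.\<close>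
    obtain V1 \<Phi>1 where L1: "\<pi> e \<in> V1" "local_trivialization E Y F \<pi> V1 \<Phi>1"
      using B fb_projection_mem[OF B p(3)] unfolding smooth_fibre_bundle_def by blast
    obtain D' \<psi> where D': "(D', \<psi>) \<in> atlas F" "snd (\<Phi>1 e) \<in> D'"
      using sm_cover[OF fb_manifolds(3)[OF B] lt_snd[OF B L1(2) p(3) L1(1)]] .
    note c = atlas_pullback_chartsI[OF D(1) L1(2) D'(1)]
    let ?W = "topspace T \<times> (\<phi> ` (D \<inter> (points X - K)) \<times> UNIV)"
    have "openin (mtop X) (points X - K)" using K(1) by (simp add: openin_diff)
    then have "open (\<phi> ` (D \<inter> (points X - K)))"
      using sm_openin[OF X D(1)] by (intro sm_open_image_subset[OF X D(1)]) auto
    then have oW: "openin (prod_topology T euclidean) ?W" by (intro openin_topspace_Times open_Times) auto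
    show ?thesis
    proof (rule smooth_map_family_atI[OF c c _ _ smooth_family_ident[OF oW]])
      show "p \<in> pullback_chart_domain E \<pi> D V1 \<Phi>1 D'"
        using p D D' L1 by (simp add: pullback_chart_domain_def)
      show "(t, pullback_chart_map \<phi> \<Phi>1 \<psi> p) \<in> ?W"
        using t p D False K(2) by (auto simp: pullback_chart_map_def)
      fix t' p' assume *: "t' \<in> topspace T" "p' \<in> pullback_chart_domain E \<pi> D V1 \<Phi>1 D'" "p' \<in> PS a t'"
        "(t', pullback_chart_map \<phi> \<Phi>1 \<psi> p') \<in> ?W"
      then obtain x' e' where p': "p' = (x', e')" "x' \<in> D" "e' \<in> points E" "a t' x' = \<pi> e'"
        by (auto simp: pullback_chart_domain_def pullback_set_def)
      have "\<phi> x' \<in> \<phi> ` (D \<inter> (points X - K))" using *(4) by (simp add: p'(1) pullback_chart_map_def)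
      then have x': "x' \<in> points X - K" using inj p' by blast
      have "b t' x' = \<pi> e'" using off[OF *(1)] x' p' by auto
      \<comment> \<open>Inside \<open>G\<close> but off \<open>K\<close> the nontrivial branch of
        \<open>transport\<close> applies; it returns \<open>e'\<close> because
        \<open>b t' x' = \<pi> e'\<close>.\<close>
      moreover have "inv_into {e \<in> points E. \<pi> e \<in> V} \<Phi> (\<pi> e', snd (\<Phi> e')) = e'" if "x' \<in> G"
        using lt_inv[OF B L p'(3)] V[OF *(1) that] by (simp add: p'(4))
      ultimately have "transport G V \<Phi> b t' p' = p'" using p' by (simp add: transport_def)
      then show "transport G V \<Phi> b t' p' \<in> pullback_chart_domain E \<pi> D V1 \<Phi>1 D' \<and>
        pullback_chart_map \<phi> \<Phi>1 \<psi> (transport G V \<Phi> b t' p') = pullback_chart_map \<phi> \<Phi>1 \<psi> p'"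
        using *(2) by simp
    qed
  qed
qed

text \<open>Exchanging \<open>a\<close> and \<open>b\<close> preserves the hypotheses, so the map
  back is covered by the same two lemmas.\<close>

lemma bundle_iso_transport:
  assumes a: "smooth_maps T a" and b: "smooth_maps T b"
    and V: "\<And>t x. t \<in> topspace T \<Longrightarrow> x \<in> G \<Longrightarrow> a t x \<in> V \<and> b t x \<in> V"
    and off: "\<And>t x. t \<in> topspace T \<Longrightarrow> x \<in> points X \<Longrightarrow> x \<notin> K \<Longrightarrow> a t x = b t x"
  shows "bundle_iso T a b (transport G V \<Phi> b) (transport G V \<Phi> a)"
proof -
  have fst: "fst (transport G V \<Phi> c t p) = fst p" for c and t :: 't and p by (simp add: transport_def)
  have V': "b t x \<in> V \<and> a t x \<in> V" if "t \<in> topspace T" "x \<in> G" for t x using V[OF that] by simp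
  have off': "b t x = a t x" if "t \<in> topspace T" "x \<in> points X" "x \<notin> K" for t x using off[OF that] by simp
  have 1: "transport G V \<Phi> a t (transport G V \<Phi> b t p) = p" if "t \<in> topspace T" "p \<in> PS a t" for t p
    by (rule transport_mem(2)[where a = a and b = b and t = t, OF V[OF that(1)] off[OF that(1)] that(2)])
  have 2: "transport G V \<Phi> b t (transport G V \<Phi> a t p) = p" if "t \<in> topspace T" "p \<in> PS b t" for t p
    by (rule transport_mem(2)[where a = b and b = a and t = t, OF V'[OF that(1)] off'[OF that(1)] that(2)])
  show ?thesis
    unfolding bundle_iso_def
  proof (intro conjI ballI fst)
    show "smooth_map_family T PC (PS a) PC (PS b) (transport G V \<Phi> b)"
      by (rule smooth_transport[OF a b V off])
    show "smooth_map_family T PC (PS b) PC (PS a) (transport G V \<Phi> a)"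
      by (rule smooth_transport[OF b a V' off'])
  qed (rule 1 2; assumption)+
qed

end

section \<open>Deformation of the family of maps\<close>

text \<open>
  After shrinking the parameter space, \<open>f\<close> can be replaced, up to isomorphism of the pullback bundles,
  by a family that agrees with \<open>g\<close> on \<open>Q\<close> and still agrees with \<open>g\<close> wherever \<open>f\<close> did; the latter allows
  to treat several sets \<open>Q\<close> one after the other.  All topologies \<open>T\<close> are quantified over because each
  step shrinks the parameter space.
\<close>

definition deforms_to_on :: "('x \<Rightarrow> 'y) \<Rightarrow> 't itself \<Rightarrow> 'x set \<Rightarrow> bool" where
  "deforms_to_on g _ Q \<longleftrightarrow>
     (\<forall>(T :: 't topology) t\<^sub>0 f. smooth_maps T f \<and> t\<^sub>0 \<in> topspace T \<and> (\<forall>x\<in>points X. f t\<^sub>0 x = g x) \<longrightarrow>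
        (\<exists>T\<^sub>0 f' \<Theta> \<Theta>'. openin T T\<^sub>0 \<and> t\<^sub>0 \<in> T\<^sub>0 \<and> smooth_maps (subtopology T T\<^sub>0) f' \<and>
           bundle_iso (subtopology T T\<^sub>0) f f' \<Theta> \<Theta>' \<and>
           (\<forall>t\<in>T\<^sub>0. \<forall>x\<in>points X. x \<in> Q \<or> f t x = g x \<longrightarrow> f' t x = g x)))"

lemma deforms_to_onD:
  assumes "deforms_to_on g TYPE('t) Q" "smooth_maps (T :: 't topology) f" "t\<^sub>0 \<in> topspace T"
    "\<And>x. x \<in> points X \<Longrightarrow> f t\<^sub>0 x = g x"
  obtains T\<^sub>0 f' \<Theta> \<Theta>' where "openin T T\<^sub>0" "t\<^sub>0 \<in> T\<^sub>0" "smooth_maps (subtopology T T\<^sub>0) f'"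
    "bundle_iso (subtopology T T\<^sub>0) f f' \<Theta> \<Theta>'"
    "\<And>t x. t \<in> T\<^sub>0 \<Longrightarrow> x \<in> points X \<Longrightarrow> x \<in> Q \<or> f t x = g x \<Longrightarrow> f' t x = g x"
proof -
  have "smooth_maps T f \<and> t\<^sub>0 \<in> topspace T \<and> (\<forall>x\<in>points X. f t\<^sub>0 x = g x)"
    using assms(2-4) by simp
  with assms(1)[unfolded deforms_to_on_def, THEN spec[where x = T], THEN spec[where x = t\<^sub>0], THEN spec[where x = f]]
  have "\<exists>T\<^sub>0 f' \<Theta> \<Theta>'. openin T T\<^sub>0 \<and> t\<^sub>0 \<in> T\<^sub>0 \<and> smooth_maps (subtopology T T\<^sub>0) f' \<and>
           bundle_iso (subtopology T T\<^sub>0) f f' \<Theta> \<Theta>' \<and>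
           (\<forall>t\<in>T\<^sub>0. \<forall>x\<in>points X. x \<in> Q \<or> f t x = g x \<longrightarrow> f' t x = g x)" by (rule mp)
  then obtain T\<^sub>0 f' \<Theta> \<Theta>' where 1: "openin T T\<^sub>0" "t\<^sub>0 \<in> T\<^sub>0" "smooth_maps (subtopology T T\<^sub>0) f'"
      "bundle_iso (subtopology T T\<^sub>0) f f' \<Theta> \<Theta>'"
    and 2: "\<forall>t\<in>T\<^sub>0. \<forall>x\<in>points X. x \<in> Q \<or> f t x = g x \<longrightarrow> f' t x = g x" by (elim exE conjE)
  show thesis by (rule that[OF 1]) (use 2 in blast)
qed

lemma deforms_to_on_empty: "deforms_to_on g TYPE('t) {}"
  unfolding deforms_to_on_def
proof (intro allI impI)
  fix T :: "'t topology" and t\<^sub>0 f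
  assume *: "smooth_maps T f \<and> t\<^sub>0 \<in> topspace T \<and> (\<forall>x\<in>points X. f t\<^sub>0 x = g x)"
  then have f: "smooth_maps T f" by blast
  show "\<exists>T\<^sub>0 f' \<Theta> \<Theta>'. openin T T\<^sub>0 \<and> t\<^sub>0 \<in> T\<^sub>0 \<and> smooth_maps (subtopology T T\<^sub>0) f' \<and>
           bundle_iso (subtopology T T\<^sub>0) f f' \<Theta> \<Theta>' \<and>
           (\<forall>t\<in>T\<^sub>0. \<forall>x\<in>points X. x \<in> {} \<or> f t x = g x \<longrightarrow> f' t x = g x)"
    by (rule exI[of _ "topspace T"], rule exI[of _ f], rule exI[of _ "\<lambda>t p. p"], rule exI[of _ "\<lambda>t p. p"])
      (use * f bundle_iso_refl[OF f] in simp)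
qed

text \<open>The second deformation starts from \<open>f'\<close>. It preserves agreement with
  \<open>g\<close>, hence the gain on \<open>P\<close>. Its own hypothesis at
  \<open>t\<^sub>0\<close> holds because the first deformation preserved the agreement of
  \<open>f t\<^sub>0\<close> with \<open>g\<close> on all of \<open>X\<close>.\<close>

lemma deforms_to_on_Un:
  assumes P: "deforms_to_on g TYPE('t) P" and Q: "deforms_to_on g TYPE('t) Q"
  shows "deforms_to_on g TYPE('t) (P \<union> Q)"
  unfolding deforms_to_on_def
proof (intro allI impI)
  fix T :: "'t topology" and t\<^sub>0 f
  assume *: "smooth_maps T f \<and> t\<^sub>0 \<in> topspace T \<and> (\<forall>x\<in>points X. f t\<^sub>0 x = g x)"
  then have f: "smooth_maps T f" "t\<^sub>0 \<in> topspace T" "\<And>x. x \<in> points X \<Longrightarrow> f t\<^sub>0 x = g x" by blast+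
  obtain T\<^sub>0 f' \<Theta> \<Theta>' where 1: "openin T T\<^sub>0" "t\<^sub>0 \<in> T\<^sub>0" "smooth_maps (subtopology T T\<^sub>0) f'"
    "bundle_iso (subtopology T T\<^sub>0) f f' \<Theta> \<Theta>'"
    "\<And>t x. t \<in> T\<^sub>0 \<Longrightarrow> x \<in> points X \<Longrightarrow> x \<in> P \<or> f t x = g x \<Longrightarrow> f' t x = g x"
    using deforms_to_onD[OF P f] by blast
  have "t\<^sub>0 \<in> topspace (subtopology T T\<^sub>0)" using f(2) 1(2) by simp
  moreover have "f' t\<^sub>0 x = g x" if "x \<in> points X" for x using 1(5)[OF 1(2) that] f(3)[OF that] by simp
  ultimately obtain T\<^sub>1 f'' \<Theta>1 \<Theta>1' where 2: "openin (subtopology T T\<^sub>0) T\<^sub>1" "t\<^sub>0 \<in> T\<^sub>1"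
    "smooth_maps (subtopology (subtopology T T\<^sub>0) T\<^sub>1) f''"
    "bundle_iso (subtopology (subtopology T T\<^sub>0) T\<^sub>1) f' f'' \<Theta>1 \<Theta>1'"
    "\<And>t x. t \<in> T\<^sub>1 \<Longrightarrow> x \<in> points X \<Longrightarrow> x \<in> Q \<or> f' t x = g x \<Longrightarrow> f'' t x = g x"
    using deforms_to_onD[OF Q 1(3)] by blast
  have T1: "openin T T\<^sub>1" "T\<^sub>1 \<subseteq> T\<^sub>0" using 2(1) 1(1) by (auto simp: openin_open_subtopology)
  then have eq: "subtopology (subtopology T T\<^sub>0) T\<^sub>1 = subtopology T T\<^sub>1"
    by (simp add: subtopology_subtopology Int_absorb1)
  note f1 = smooth_map_family_restrict_param[OF f(1), of T\<^sub>1]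
    and f1' = smooth_map_family_restrict_param[OF 1(3), of T\<^sub>1, unfolded eq]
  note iso = bundle_iso_trans[OF f1 f1' 2(3)[unfolded eq] bundle_iso_restrict_param[OF 1(4), of T\<^sub>1, unfolded eq] 2(4)[unfolded eq]]
  have "\<forall>t\<in>T\<^sub>1. \<forall>x\<in>points X. x \<in> P \<union> Q \<or> f t x = g x \<longrightarrow> f'' t x = g x"
    using 1(5) 2(5) T1(2) by blast
  then show "\<exists>T\<^sub>0 f' \<Theta> \<Theta>'. openin T T\<^sub>0 \<and> t\<^sub>0 \<in> T\<^sub>0 \<and> smooth_maps (subtopology T T\<^sub>0) f' \<and>
           bundle_iso (subtopology T T\<^sub>0) f f' \<Theta> \<Theta>' \<and>
           (\<forall>t\<in>T\<^sub>0. \<forall>x\<in>points X. x \<in> P \<union> Q \<or> f t x = g x \<longrightarrow> f' t x = g x)"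
    using T1(1) 2(2) 2(3)[unfolded eq] iso
    by (intro exI conjI)
qed

lemma deforms_to_on_Union:
  "finite \<Q> \<Longrightarrow> (\<And>Q. Q \<in> \<Q> \<Longrightarrow> deforms_to_on g TYPE('t) Q) \<Longrightarrow> deforms_to_on g TYPE('t) (\<Union>\<Q>)"
  by (induction \<Q> rule: finite_induct) (auto intro: deforms_to_on_empty deforms_to_on_Un)

text \<open>A convex combination of \<open>\<psi> (f t x)\<close> and \<open>\<psi> (g x)\<close>
  with weight \<open>w (\<phi> x)\<close> stays in the convex set \<open>C\<close>, so it is the
  coordinate of a point of \<open>V\<close>. At weight 1 it gives \<open>g x\<close>; if the two
  values already agree, it gives that value at every weight.\<close>

lemma deforms_to_on_chart_ball:
  assumes g: "smooth_map X Y g" and L: "local_trivialization E Y F \<pi> V \<Phi>"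
    and D: "(D, \<phi>) \<in> atlas X" and DY: "(DY, \<psi>) \<in> atlas Y" and \<rho>: "0 < \<rho>"
    and BY: "convex C" "open C" "C \<subseteq> \<psi> ` (DY \<inter> V)"
    and sub: "cball c (3 * \<rho>) \<subseteq> \<phi> ` {x \<in> D. g x \<in> DY \<and> \<psi> (g x) \<in> C}"
  shows "deforms_to_on g TYPE('t) {x \<in> D. \<phi> x \<in> ball c \<rho>}"
  unfolding deforms_to_on_def
proof (intro allI impI)
  note Y = fb_manifolds(2)[OF B]
  let ?Q = "{x \<in> D. \<phi> x \<in> ball c \<rho>}"
  let ?CY = "{y \<in> DY. \<psi> y \<in> C}"
  \<comment> \<open>Three concentric radii: \<open>\<rho>\<close>, within which the weight is 1;
    \<open>2 * \<rho>\<close>, beyond which it is 0, so that \<open>K\<close> contains every point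
    whose value changes; and \<open>3 * \<rho>\<close> for the open set \<open>G\<close> on which
    the coordinate formula is used. \<open>K3\<close> is a compact set containing
    \<open>G\<close>.\<close>
  define G where "G = {x \<in> D. \<phi> x \<in> ball c (3 * \<rho>)}"
  define K where "K = {x \<in> D. \<phi> x \<in> cball c (2 * \<rho>)}"
  define K3 where "K3 = {x \<in> D. \<phi> x \<in> cball c (3 * \<rho>)}"
  have oG: "openin (mtop X) G" unfolding G_def by (rule sm_openin_preimage[OF X D]) simp
  have oCY: "openin (mtop Y) ?CY" by (rule sm_openin_preimage[OF Y DY BY(2)])
  have CYV: "y \<in> V" if "y \<in> ?CY" for y
    using that BY(3) inj_onD[OF sm_inj[OF Y DY]] by blast
  have cballs: "cball c (3 * \<rho>) \<subseteq> \<phi> ` D" "cball c (2 * \<rho>) \<subseteq> \<phi> ` D"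
    using sub subset_cball[of "2 * \<rho>" "3 * \<rho>" c] \<rho> by (simp, blast)+
  have K3: "compactin (mtop X) K3" unfolding K3_def by (rule compactin_chart_cball[OF X D cballs(1)])
  have "compactin (mtop X) K" unfolding K_def by (rule compactin_chart_cball[OF X D cballs(2)])
  then have K: "closedin (mtop X) K" using X by (simp add: smooth_manifold_def compactin_imp_closedin)
  have GK3: "G \<subseteq> K3" "K \<subseteq> G" using \<rho> by (auto simp: G_def K_def K3_def)
  have gK3: "g x \<in> ?CY" if "x \<in> K3" for x
  proof -
    have "\<phi> x \<in> \<phi> ` {x \<in> D. g x \<in> DY \<and> \<psi> (g x) \<in> C}" using that sub by (auto simp: K3_def)
    then obtain x' where "\<phi> x = \<phi> x'" "x' \<in> D" "g x' \<in> ?CY" by auto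
    moreover have "x \<in> D" using that by (simp add: K3_def)
    ultimately show ?thesis using inj_onD[OF sm_inj[OF X D]] by metis
  qed
  have DX: "D \<subseteq> points X" by (rule sm_subset[OF X D])
  fix T :: "'t topology" and t\<^sub>0 f
  assume *: "smooth_maps T f \<and> t\<^sub>0 \<in> topspace T \<and> (\<forall>x\<in>points X. f t\<^sub>0 x = g x)"
  then have f: "smooth_maps T f" "t\<^sub>0 \<in> topspace T" "\<And>x. x \<in> points X \<Longrightarrow> f t\<^sub>0 x = g x" by blast+
  have tot: "total_space T (\<lambda>_. points X) = topspace (prod_topology T (mtop X))" by (auto simp: total_space_def)
  have "continuous_map (prod_topology T (mtop X)) (mtop Y) (\<lambda>(t, x). f t x)"
    using smf_continuous[OF f(1)] unfolding tot subtopology_topspace .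
  from openin_continuous_map_preimage[OF this oCY]
  have oW: "openin (prod_topology T (mtop X)) {z \<in> topspace (prod_topology T (mtop X)). (\<lambda>(t, x). f t x) z \<in> ?CY}"
    (is "openin _ ?W") .
  have "x \<in> points X" if "x \<in> K3" for x using that DX by (auto simp: K3_def)
  then have "{t\<^sub>0} \<times> K3 \<subseteq> ?W" using f(2,3) gK3 by auto
  \<comment> \<open>The tube lemma: \<open>K3\<close> is compact and \<open>f t\<^sub>0\<close>,
    being \<open>g\<close>, maps it into \<open>?CY\<close>, so one neighbourhood of
    \<open>t\<^sub>0\<close> works for all points of \<open>K3\<close>.\<close>
  then obtain T\<^sub>0 K3' where T0: "openin T T\<^sub>0" "t\<^sub>0 \<in> T\<^sub>0" "K3 \<subseteq> K3'" "T\<^sub>0 \<times> K3' \<subseteq> ?W"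
    using tube_lemma_right[OF oW K3 f(2)] by blast
  have fCY: "f t x \<in> ?CY" if "t \<in> T\<^sub>0" "x \<in> K3" for t x
  proof -
    have "(t, x) \<in> ?W" using that T0(3,4) by blast
    then show ?thesis by simp
  qed
  obtain w :: "'m \<Rightarrow> real" where w: "\<And>(T :: 't topology). smooth_family T (topspace T \<times> UNIV) (\<lambda>t. w)"
    "\<And>u. 0 \<le> w u" "\<And>u. w u \<le> 1" "\<And>u. dist c u \<le> \<rho> \<Longrightarrow> w u = 1" "\<And>u. dist c u \<ge> 2 * \<rho> \<Longrightarrow> w u = 0"
    using smooth_bump_exists[OF \<rho>, of c] by blast
  let ?T = "subtopology T T\<^sub>0"
  have tT: "topspace ?T = T\<^sub>0" using openin_subset[OF T0(1)] by auto
  define h where "h t x = \<psi> (f t x) + w (\<phi> x) *\<^sub>R (\<psi> (g x) - \<psi> (f t x))" for t x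
  \<comment> \<open>Between \<open>K\<close> and \<open>G\<close> the weight is 0 and the two
    branches agree (this is \<open>off\<close>), so no smoothness is lost across the boundary of
    \<open>G\<close>.\<close>
  define f' where "f' t x = (if x \<in> G then inv_into DY \<psi> (h t x) else f t x)" for t x
  have hC: "h t x \<in> C" if "t \<in> T\<^sub>0" "x \<in> G" for t x
  proof -
    have "(1 - w (\<phi> x)) *\<^sub>R \<psi> (f t x) + w (\<phi> x) *\<^sub>R \<psi> (g x) \<in> C"
      by (rule convexD_alt[OF BY(1)]) (use fCY gK3 that GK3 w in auto)
    then show ?thesis by (simp add: h_def algebra_simps)
  qed
  have f'G: "f' t x \<in> ?CY" "\<psi> (f' t x) = h t x" if "t \<in> T\<^sub>0" "x \<in> G" for t x
  proof -
    have "h t x \<in> \<psi> ` DY" using hC[OF that] BY(3) by blast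
    then show "f' t x \<in> ?CY" "\<psi> (f' t x) = h t x"
      using hC[OF that] that by (simp_all add: f'_def f_inv_into_f inv_into_into)
  qed
  have off: "f' t x = f t x" if "t \<in> T\<^sub>0" "x \<in> points X" "x \<notin> K" for t x
  proof (cases "x \<in> G")
    case True
    then have "w (\<phi> x) = 0" using that(3) by (intro w(5)) (auto simp: G_def K_def)
    then have "h t x = \<psi> (f t x)" by (simp add: h_def)
    moreover have "f t x \<in> DY" using fCY[OF that(1)] GK3 True by blast
    ultimately show ?thesis using sm_inv[OF Y DY] by (simp add: f'_def)
  qed (simp add: f'_def)
  have deform: "f' t x = g x" if "t \<in> T\<^sub>0" "x \<in> points X" "x \<in> ?Q \<or> f t x = g x" for t x
  proof (cases "x \<in> G")
    case True
    then have gx: "g x \<in> DY" using gK3 GK3 by blast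
    have "h t x = \<psi> (g x)"
    proof (cases "x \<in> ?Q")
      case True
      then have "w (\<phi> x) = 1" by (intro w(4)) auto
      then show ?thesis by (simp add: h_def)
    next
      case False
      then have "f t x = g x" using that(3) by blast
      then show ?thesis by (simp add: h_def)
    qed
    then show ?thesis using True sm_inv[OF Y DY gx] by (simp add: f'_def)
  next
    case False
    have "ball c \<rho> \<subseteq> ball c (3 * \<rho>)" using \<rho> by (intro subset_ball) simp
    then have "x \<notin> ?Q" using False by (auto simp: G_def)
    then have "f t x = g x" using that(3) by blast
    then show ?thesis using False by (simp add: f'_def)
  qed
  note fT = smooth_map_family_restrict_param[OF f(1), of T\<^sub>0]
  note gT = smooth_map_family_const[OF X Y g, of ?T]
  have f'T: "smooth_maps ?T f'"
  proof (rule smooth_map_familyI[OF manifold_family_const[OF X] manifold_family_const[OF Y]])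
    fix t x assume t: "t \<in> topspace ?T" "x \<in> points X"
    then have t': "t \<in> T\<^sub>0" by (simp add: tT)
    show "f' t x \<in> points Y"
      using f'G(1)[OF t', of x] sm_subset[OF Y DY] smf_maps[OF fT t] by (cases "x \<in> G") (auto simp: f'_def)
    show "smooth_map_family_at ?T X (\<lambda>_. points X) Y f' t x"
    proof (cases "x \<in> G")
      case True
      let ?W = "topspace ?T \<times> ball c (3 * \<rho>)"
      let ?\<alpha> = "\<lambda>t. \<psi> \<circ> f t \<circ> inv_into (D \<inter> points X) \<phi>" and ?\<gamma> = "\<psi> \<circ> g \<circ> inv_into (D \<inter> points X) \<phi>"
      have oW: "openin (prod_topology ?T euclidean) ?W" by (rule openin_topspace_Times) simp
      have W: "\<exists>x. u = \<phi> x \<and> x \<in> D \<and> x \<in> points X \<and> x \<in> K3" if "u \<in> ball c (3 * \<rho>)" for u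
      proof -
        have "u \<in> \<phi> ` D" using that cballs(1) by (auto simp: subset_iff)
        then obtain x where "u = \<phi> x" "x \<in> D" by blast
        then show ?thesis using that DX by (auto simp: K3_def)
      qed
      \<comment> \<open>Stated for an arbitrary \<open>k\<close>, since it serves both for
        \<open>f\<close> and for the constant family \<open>g\<close>.\<close>
      have Wsub: "?W \<subseteq> chart_image ?T (\<lambda>t. {p \<in> points X. k t p \<in> DY}) D \<phi>"
        if k: "\<And>t x. t \<in> T\<^sub>0 \<Longrightarrow> x \<in> K3 \<Longrightarrow> k t x \<in> DY" for k
      proof
        fix z assume z: "z \<in> ?W"
        then obtain t u where tu: "z = (t, u)" "t \<in> T\<^sub>0" "u \<in> ball c (3 * \<rho>)" unfolding tT by blast
        then obtain x where "u = \<phi> x" "x \<in> D" "x \<in> points X" "x \<in> K3" using W by blast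
        with tu k show "z \<in> chart_image ?T (\<lambda>t. {p \<in> points X. k t p \<in> DY}) D \<phi>"
          unfolding chart_image_def tT by blast
      qed
      have "smooth_family ?T ?W ?\<alpha>"
        by (rule smooth_family_mono[OF smf_smooth[OF fT D DY] oW Wsub]) (use fCY in blast)
      moreover have "smooth_family ?T ?W (\<lambda>t. ?\<gamma>)"
        by (rule smooth_family_mono[OF smf_smooth[OF gT D DY] oW Wsub]) (use gK3 in blast)
      moreover have "smooth_family ?T ?W (\<lambda>t. w)"
        by (rule smooth_family_mono[OF w(1) oW]) auto
      ultimately have r: "smooth_family ?T ?W (\<lambda>t u. ?\<alpha> t u + w u *\<^sub>R (?\<gamma> u - ?\<alpha> t u))"
        by (intro smooth_family_add smooth_family_bilinear[OF bounded_bilinear_scaleR] smooth_family_diff)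
      show ?thesis
      proof (rule smooth_map_family_atI[OF D DY _ _ r])
        show "x \<in> D" "(t, \<phi> x) \<in> ?W" using True t by (auto simp: G_def)
        fix t' x' assume *: "t' \<in> topspace ?T" "x' \<in> D" "x' \<in> points X" "(t', \<phi> x') \<in> ?W"
        then have "x' \<in> G" "t' \<in> T\<^sub>0" by (auto simp: G_def tT)
        then show "f' t' x' \<in> DY \<and> \<psi> (f' t' x') = ?\<alpha> t' (\<phi> x') + w (\<phi> x') *\<^sub>R (?\<gamma> (\<phi> x') - ?\<alpha> t' (\<phi> x'))"
          using f'G[of t' x'] sm_inv[OF X D *(2)] sm_Int_points[OF X D] by (simp add: h_def)
      qed
    next
      case False
      then have xK: "x \<notin> K" using GK3 by blast
      obtain D1 \<phi>1 where D1: "(D1, \<phi>1) \<in> atlas X" "x \<in> D1" using sm_cover[OF X t(2)] .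
      obtain D2 \<psi>2 where D2: "(D2, \<psi>2) \<in> atlas Y" "f t x \<in> D2" using sm_cover[OF Y smf_maps[OF fT t]] .
      let ?C = "chart_image ?T (\<lambda>t. {p \<in> points X. f t p \<in> D2}) D1 \<phi>1"
      \<comment> \<open>A point outside \<open>G\<close> has the complement of \<open>K\<close> as a
        neighbourhood, and there \<open>f'\<close> is \<open>f\<close>; it suffices to cut a chart
        expression of \<open>f\<close> down to it.\<close>
      let ?W = "?C \<inter> topspace ?T \<times> \<phi>1 ` (D1 \<inter> (points X - K))"
      note s = smf_smooth[OF fT D1(1) D2(1)]
      have "openin (mtop X) (points X - K)" using K by (simp add: openin_diff)
      then have "open (\<phi>1 ` (D1 \<inter> (points X - K)))"
        using sm_openin[OF X D1(1)] by (intro sm_open_image_subset[OF X D1(1)]) auto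
      from openin_Int[OF smooth_family_openin[OF s] openin_topspace_Times[OF this]]
      have oW: "openin (prod_topology ?T euclidean) ?W" .
      show ?thesis
      proof (rule smooth_map_family_atI[OF D1(1) D2(1) D1(2) _ smooth_family_mono[OF s oW Int_lower1]])
        show "(t, \<phi>1 x) \<in> ?W" using t D1 D2 xK by (auto simp: chart_image_def)
        fix t' x' assume *: "t' \<in> topspace ?T" "x' \<in> D1" "x' \<in> points X" "(t', \<phi>1 x') \<in> ?W"
        then have "x' \<notin> K" using inj_onD[OF sm_inj[OF X D1(1)]] by blast
        then have "f' t' x' = f t' x'" using off * tT by blast
        moreover have "f t' x' \<in> D2"
          using mf_chart_image_iff[OF manifold_family_const[OF X] D1(1) *(1-3), of "\<lambda>t. {p \<in> points X. f t p \<in> D2}"] *(4) by auto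
        ultimately show "f' t' x' \<in> D2 \<and> \<psi>2 (f' t' x') = (\<psi>2 \<circ> f t' \<circ> inv_into (D1 \<inter> points X) \<phi>1) (\<phi>1 x')"
          using sm_inv[OF X D1(1) *(2)] sm_Int_points[OF X D1(1)] by simp
      qed
    qed
  qed
  have V: "f t x \<in> V \<and> f' t x \<in> V" if "t \<in> topspace ?T" "x \<in> G" for t x
    using CYV fCY f'G(1) that GK3 unfolding tT by blast
  have off': "f t x = f' t x" if "t \<in> topspace ?T" "x \<in> points X" "x \<notin> K" for t x
    using off[of t x] that tT by simp
  note iso = bundle_iso_transport[OF L oG K GK3(2) fT f'T V off']
  have "\<forall>t\<in>T\<^sub>0. \<forall>x\<in>points X. x \<in> ?Q \<or> f t x = g x \<longrightarrow> f' t x = g x" using deform by blast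
  with T0(1,2) f'T iso show "\<exists>T\<^sub>0 f' \<Theta> \<Theta>'. openin T T\<^sub>0 \<and> t\<^sub>0 \<in> T\<^sub>0 \<and> smooth_maps (subtopology T T\<^sub>0) f' \<and>
           bundle_iso (subtopology T T\<^sub>0) f f' \<Theta> \<Theta>' \<and>
           (\<forall>t\<in>T\<^sub>0. \<forall>x\<in>points X. x \<in> ?Q \<or> f t x = g x \<longrightarrow> f' t x = g x)"
    by (intro exI conjI)
qed

text \<open>A ball around the coordinate of \<open>g x\<close>, inside the coordinate image of
  \<open>V\<close>, serves as the convex set; continuity of \<open>g\<close> then leaves room for a
  ball in a chart of \<open>X\<close>.\<close>

lemma deforms_to_on_neighbourhood:
  assumes g: "smooth_map X Y g" and x: "x \<in> points X"
  obtains Q where "openin (mtop X) Q" "x \<in> Q" "deforms_to_on g TYPE('t) Q"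
proof -
  note Y = fb_manifolds(2)[OF B]
  have contg: "continuous_map (mtop X) (mtop Y) g" using g by (simp add: smooth_map_def)
  then have gx: "g x \<in> points Y" using x by (auto simp: continuous_map_def)
  obtain V \<Phi> where L: "g x \<in> V" "local_trivialization E Y F \<pi> V \<Phi>"
    using B gx unfolding smooth_fibre_bundle_def by blast
  obtain D \<phi> where D: "(D, \<phi>) \<in> atlas X" "x \<in> D" using sm_cover[OF X x] .
  obtain DY \<psi> where DY: "(DY, \<psi>) \<in> atlas Y" "g x \<in> DY" using sm_cover[OF Y gx] .
  have "open (\<psi> ` (DY \<inter> V))"
    using sm_openin[OF Y DY(1)] lt_openin[OF B L(2)] by (intro sm_open_image_subset[OF Y DY(1)]) auto
  moreover have "\<psi> (g x) \<in> \<psi> ` (DY \<inter> V)" using DY L by blast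
  ultimately obtain \<epsilon> where \<epsilon>: "0 < \<epsilon>" "ball (\<psi> (g x)) \<epsilon> \<subseteq> \<psi> ` (DY \<inter> V)"
    using open_contains_ball by blast
  let ?C = "ball (\<psi> (g x)) \<epsilon>"
  let ?N = "{x \<in> D. g x \<in> DY \<and> \<psi> (g x) \<in> ?C}"
  have "openin (mtop Y) {y \<in> DY. \<psi> y \<in> ?C}" by (rule sm_openin_preimage[OF Y DY(1)]) simp
  from openin_Int[OF sm_openin[OF X D(1)] openin_continuous_map_preimage[OF contg this]]
  have "openin (mtop X) (D \<inter> {x \<in> points X. g x \<in> {y \<in> DY. \<psi> y \<in> ?C}})" .
  moreover have "D \<inter> {x \<in> points X. g x \<in> {y \<in> DY. \<psi> y \<in> ?C}} = ?N"
    using sm_subset[OF X D(1)] by auto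
  ultimately have "open (\<phi> ` ?N)" by (intro sm_open_image_subset[OF X D(1)]) auto
  moreover have "\<phi> x \<in> \<phi> ` ?N" using D DY \<epsilon>(1) by auto
  ultimately obtain e where e: "0 < e" "cball (\<phi> x) e \<subseteq> \<phi> ` ?N"
    using open_contains_cball by blast
  \<comment> \<open>The factor 3 makes room for the three radii of
    \<open>deforms_to_on_chart_ball\<close>.\<close>
  define \<rho> where "\<rho> = e / 3"
  have \<rho>: "0 < \<rho>" "cball (\<phi> x) (3 * \<rho>) \<subseteq> \<phi> ` ?N" using e by (simp_all add: \<rho>_def)
  let ?Q = "{x' \<in> D. \<phi> x' \<in> ball (\<phi> x) \<rho>}"
  show thesis
  proof
    show "openin (mtop X) ?Q" by (rule sm_openin_preimage[OF X D(1)]) simp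
    show "x \<in> ?Q" using D \<rho> by simp
    show "deforms_to_on g TYPE('t) ?Q"
      by (rule deforms_to_on_chart_ball[OF g L(2) D(1) DY(1) \<rho>(1) convex_ball open_ball \<epsilon>(2) \<rho>(2)])
  qed
qed

lemma deforms_to_on_compactin:
  assumes g: "smooth_map X Y g" and C: "compactin (mtop X) C"
  obtains Q where "C \<subseteq> Q" "deforms_to_on g TYPE('t) Q"
proof -
  let ?\<Q> = "{Q. openin (mtop X) Q \<and> deforms_to_on g TYPE('t) Q}"
  have "C \<subseteq> \<Union>?\<Q>"
  proof
    fix x assume "x \<in> C"
    then have "x \<in> points X" using C by (auto simp: compactin_def)
    then obtain Q where "openin (mtop X) Q" "x \<in> Q" "deforms_to_on g TYPE('t) Q"
      by (rule deforms_to_on_neighbourhood[OF g])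
    then show "x \<in> \<Union>?\<Q>" by blast
  qed
  then obtain \<Q> where \<Q>: "finite \<Q>" "\<Q> \<subseteq> ?\<Q>" "C \<subseteq> \<Union>\<Q>"
    using compactinD[OF C, of ?\<Q>] by auto
  show thesis
    by (rule that[OF \<Q>(3) deforms_to_on_Union[OF \<Q>(1)]]) (use \<Q>(2) in blast)
qed

end

text \<open>The deformed family \<open>f'\<close> agrees with \<open>f t\<^sub>0\<close> on
  \<open>U\<close>, so for every \<open>t\<close> near \<open>t\<^sub>0\<close> its pullback over
  \<open>U\<close> is literally the same set of pairs, with the same charts, as the pullback by
  \<open>f t\<^sub>0\<close>. The isomorphism onto the pullback by \<open>f' t\<close> is therefore
  already the required map.\<close>

theorem proposition2p2:
  fixes E :: "('e, 'k::real_inner) manifold"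
    and Y :: "('y, 'n::real_inner) manifold"
    and F :: "('f, 'l::real_inner) manifold"
    and \<pi> :: "'e \<Rightarrow> 'y"
    and X :: "('x, 'm::real_inner) manifold"
    and T :: "'t topology"
    and f :: "'t \<Rightarrow> 'x \<Rightarrow> 'y"
    and t\<^sub>0 :: 't
    and U :: "'x set"
  assumes "smooth_fibre_bundle E Y F \<pi>"
    and "smooth_manifold X"
    and "continuous_family T X (\<lambda>t. points X) Y f"
    and "t\<^sub>0 \<in> topspace T"
    and "openin (mtop X) U" and "connectedin (mtop X) U" and "U \<noteq> {}"
    and "compactin (mtop X) (mtop X closure_of U)"
  shows "let EU = (\<lambda>t. bundle_restriction (pullback_bundle X E Y F \<pi> (f t)) fst U) in
    \<exists>T\<^sub>0 \<Theta>. openin T T\<^sub>0 \<and> t\<^sub>0 \<in> T\<^sub>0 \<and>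
      (\<forall>t\<in>T\<^sub>0. fibre_bundle_diffeomorphism (EU t) fst (EU t\<^sub>0) fst U (\<Theta> t)) \<and>
      continuous_family (subtopology T T\<^sub>0) (pullback_charts X E Y F \<pi>)
        (\<lambda>t. pullback_set U (points E) \<pi> (f t)) (EU t\<^sub>0) \<Theta>"
proof -
  note B = assms(1) and X = assms(2) and U = assms(5)
  let ?PC = "pullback_charts X E Y F \<pi>"
  let ?S = "\<lambda>t. pullback_set U (points E) \<pi> (f t)"
  define EU where "EU t = bundle_restriction (pullback_bundle X E Y F \<pi> (f t)) fst U" for t
  have UX: "U \<subseteq> points X" by (rule openin_subset[OF U])
  have EU: "EU t = restrict_to ?PC (?S t)" for t
    unfolding EU_def by (rule bundle_restriction_pullback[OF UX])
  have f: "smooth_map_family T X (\<lambda>_. points X) Y (\<lambda>_. points Y) f"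
    by (rule continuous_family_imp_smooth_map_family[OF manifold_family_const[OF X] fb_manifolds(2)[OF B] assms(3)])
  \<comment> \<open>\<open>continuous_family\<close> speaks of the manifold restricted to its whole
    point set; this has to be identified with \<open>X\<close> itself before the smoothness of
    \<open>f t\<^sub>0\<close> can be read off.\<close>
  have "(\<lambda>(D, \<phi>). (D \<inter> points X, \<phi>)) ` atlas X = (\<lambda>z. z) ` atlas X"
    by (rule image_cong) (use sm_Int_points[OF X] in auto)
  then have "restrict_to X (points X) = X" by (simp add: restrict_to_def)
  then have g: "smooth_map X Y (f t\<^sub>0)"
    using assms(3,4) unfolding continuous_family_def by metis
  obtain Q where Q: "mtop X closure_of U \<subseteq> Q" "deforms_to_on E Y F \<pi> X U (f t\<^sub>0) TYPE('t) Q"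
    by (rule deforms_to_on_compactin[OF B X U g assms(8)])
  obtain T\<^sub>0 f' \<Theta> \<Theta>' where 1: "openin T T\<^sub>0" "t\<^sub>0 \<in> T\<^sub>0"
    "smooth_map_family (subtopology T T\<^sub>0) X (\<lambda>_. points X) Y (\<lambda>_. points Y) f'"
    "bundle_iso E Y F \<pi> X U (subtopology T T\<^sub>0) f f' \<Theta> \<Theta>'"
    "\<And>t x. t \<in> T\<^sub>0 \<Longrightarrow> x \<in> points X \<Longrightarrow> x \<in> Q \<or> f t x = f t\<^sub>0 x \<Longrightarrow> f' t x = f t\<^sub>0 x"
    by (rule deforms_to_onD[OF B X U Q(2) f assms(4)]) auto
  let ?T = "subtopology T T\<^sub>0"
  have tT: "topspace ?T = T\<^sub>0" using openin_subset[OF 1(1)] by auto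
  have "U \<subseteq> Q" using closure_of_subset[OF UX] Q(1) by blast
  then have "f' t x = f t\<^sub>0 x" if "t \<in> T\<^sub>0" "x \<in> U" for t x using 1(5) that UX by blast
  then have S': "pullback_set U (points E) \<pi> (f' t) = ?S t\<^sub>0" if "t \<in> T\<^sub>0" for t
    using that by (auto simp: pullback_set_def)
  have A: "manifold_family ?T ?PC ?S" and A': "manifold_family ?T ?PC (\<lambda>t. pullback_set U (points E) \<pi> (f' t))"
    using manifold_family_pullback[OF B X U smooth_map_family_restrict_param[OF f]]
      manifold_family_pullback[OF B X U 1(3)] by auto
  \<comment> \<open>The target sets are rewritten as one constant set, the form that
    \<open>smooth_map_family_imp_continuous_family\<close> requires.\<close>
  have \<Theta>: "smooth_map_family ?T ?PC ?S ?PC (\<lambda>_. ?S t\<^sub>0) \<Theta>"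
    by (rule smooth_map_family_cong[OF A, of _ "\<lambda>t. pullback_set U (points E) \<pi> (f' t)" \<Theta>])
      (use 1(4) S' tT in \<open>auto simp: bundle_iso_def[OF B X U]\<close>)
  have inv: "\<And>p. p \<in> ?S t \<Longrightarrow> fst (\<Theta> t p) = fst p \<and> \<Theta>' t (\<Theta> t p) = p"
    "\<And>p. p \<in> ?S t\<^sub>0 \<Longrightarrow> fst (\<Theta>' t p) = fst p \<and> \<Theta> t (\<Theta>' t p) = p \<and> \<Theta>' t p \<in> ?S t" if "t \<in> T\<^sub>0" for t
  proof -
    have t: "t \<in> topspace ?T" using that tT by simp
    note iso = 1(4)[unfolded bundle_iso_def[OF B X U]]
    show "fst (\<Theta> t p) = fst p \<and> \<Theta>' t (\<Theta> t p) = p" if "p \<in> ?S t" for p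
      using iso t that by blast
    show "fst (\<Theta>' t p) = fst p \<and> \<Theta> t (\<Theta>' t p) = p \<and> \<Theta>' t p \<in> ?S t" if "p \<in> ?S t\<^sub>0" for p
    proof -
      have p: "p \<in> pullback_set U (points E) \<pi> (f' t)" using that S'[OF \<open>t \<in> T\<^sub>0\<close>] by simp
      have "smooth_map_family ?T ?PC (\<lambda>t. pullback_set U (points E) \<pi> (f' t)) ?PC ?S \<Theta>'" using iso by blast
      from smf_maps[OF this t p] show ?thesis using iso t p by blast
    qed
  qed
  have bij: "bij_betw (\<Theta> t) (?S t) (?S t\<^sub>0)" if "t \<in> T\<^sub>0" for t
  proof (rule bij_betw_byWitness[where f' = "\<Theta>' t"])
    show "\<Theta> t ` ?S t \<subseteq> ?S t\<^sub>0" using smf_maps[OF \<Theta>] that unfolding tT by blast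
  qed (use inv[OF that] in blast)+
  \<comment> \<open>\<open>diffeomorphism\<close> is stated with \<open>inv_into\<close>, which is
    known to agree with the explicit inverse \<open>\<Theta>'\<close> on the target; smoothness is
    then passed on by \<open>smooth_map_family_cong\<close>.\<close>
  have inv_eq: "\<Theta>' t p = inv_into (?S t) (\<Theta> t) p" if "t \<in> T\<^sub>0" "p \<in> ?S t\<^sub>0" for t p
    using inv_into_f_eq[OF bij_betw_imp_inj_on[OF bij[OF that(1)]], of "\<Theta>' t p" p] inv(2)[OF that] by simp
  have \<Theta>': "smooth_map_family ?T ?PC (\<lambda>t. pullback_set U (points E) \<pi> (f' t)) ?PC ?S (\<lambda>t. inv_into (?S t) (\<Theta> t))"
    by (rule smooth_map_family_cong[OF A', of _ ?S \<Theta>'])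
      (use 1(4) S' tT inv_eq in \<open>auto simp: bundle_iso_def[OF B X U]\<close>)
  have pts: "points (EU t) = ?S t" for t
    using UX by (auto simp: EU restrict_to_def mtop_pullback_charts pullback_set_def)
  have "fibre_bundle_diffeomorphism (EU t) fst (EU t\<^sub>0) fst U (\<Theta> t)" if t: "t \<in> T\<^sub>0" for t
  proof -
    have tT': "t \<in> topspace ?T" unfolding tT by (rule t)
    have "smooth_map (EU t) (EU t\<^sub>0) (\<Theta> t)"
      using smooth_map_family_slice[OF A \<Theta> tT'] unfolding EU .
    moreover have "smooth_map (EU t\<^sub>0) (EU t) (inv_into (?S t) (\<Theta> t))"
      using smooth_map_family_slice[OF A' \<Theta>' tT'] unfolding EU S'[OF t] .
    moreover have "\<Theta> t ` {p \<in> ?S t. fst p = x} = {q \<in> ?S t\<^sub>0. fst q = x}" for x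
    proof (intro equalityI subsetI)
      fix q assume "q \<in> \<Theta> t ` {p \<in> ?S t. fst p = x}"
      then show "q \<in> {q \<in> ?S t\<^sub>0. fst q = x}"
        using inv(1)[OF t] bij_betwE[OF bij[OF t]] by auto
    next
      fix q assume q: "q \<in> {q \<in> ?S t\<^sub>0. fst q = x}"
      show "q \<in> \<Theta> t ` {p \<in> ?S t. fst p = x}"
        by (rule image_eqI[of _ _ "\<Theta>' t q"]) (use q inv(2)[OF t] in auto)
    qed
    ultimately show ?thesis
      using bij[OF t] by (simp add: fibre_bundle_diffeomorphism_def diffeomorphism_def pts)
  qed
  moreover have "continuous_family ?T ?PC ?S (EU t\<^sub>0) \<Theta>"
    unfolding EU by (rule smooth_map_family_imp_continuous_family[OF A \<Theta>])
  ultimately show ?thesis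
    unfolding Let_def EU_def[symmetric] using 1(1,2) by blast
qed

end
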